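(* Let $dM(\lambda)$ be a (locally finite nonnegative) measure on $[0,\infty)$ satisfying $$\int_0^\infty e^{-t\lambda}\,dM(\lambda)<\infty\quad\text{for all } t>0,$$ and let $h(t)=\int_0^\infty e^{-t\lambda}\,dM(\lambda)$. Then the Hankel quadratic form $$h[f,f]=\int_0^\infty\!\!\int_0^\infty h(t+s)f(s)\overline{f(t)}\,ds\,dt=\int_0^\infty|(\mathsf L f)(\lambda)|^2\,dM(\lambda)$$ defined on the set $\mathcal E$ (or on $C_0^\infty(\mathbb R_+)$) admits the closure in the space $L^2(\mathbb R_+)$ if and only if $M(\{0\})=0$. If $M(\{0\})=0$ and $\int_0^\infty(1+\lambda)^{-k}\,dM(\lambda)<\infty$ for some $k>0$, then this form is closed on the set $\mathcal D[h]$ of all $f\in L^2(\mathbb R_+)$ such that the integral $\int_0^\infty|(\mathsf L f)(\lambda)|^2\,dM(\lambda)$ is finite (that is, its closure is given by this integral on the domain $\mathcal D[h]$).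
   Context: $\mathbb R_+=(0,\infty)$; integrals $\int_0^\infty\dots dM$ are over $[0,\infty)$. $\mathsf L$ is the Laplace transform $(\mathsf L f)(\lambda)=\int_0^\infty e^{-t\lambda}f(t)\,dt$. $\mathcal E$ is the set of functions $f\in L^2(\mathbb R_+)$ compactly supported in $\mathbb R_+$ (vanishing outside a compact subset of the open half-line). For general $f\in L^2(\mathbb R_+)$, $(\mathsf L f)(\lambda)$ is defined for all $\lambda>0$. *)

theory Defs
  imports "HOL-Analysis.Analysis"
begin

section \<open>Functions on the open half-line\<close>

text \<open>
  Elements of the Hilbert space \<open>L\<^sup>2\<close> are represented by Borel functions, whose values outside
  \<open>{0<..}\<close> are irrelevant. Instead of passing to classes modulo null functions, every notion
  below is phrased so that it respects almost everywhere equality.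
\<close>

abbreviation halfline :: "real measure" where
  "halfline \<equiv> restrict_space lborel {0<..}"

definition L2 :: "(real \<Rightarrow> complex) set" where
  "L2 = {f. f \<in> borel_measurable halfline \<and> integrable halfline (\<lambda>t. (cmod (f t))\<^sup>2)}"

definition L2_compact_support :: "(real \<Rightarrow> complex) set" where
  "L2_compact_support =
     {f \<in> L2. \<exists>K. compact K \<and> K \<subseteq> {0<..} \<and> (AE t in halfline. t \<notin> K \<longrightarrow> f t = 0)}"

text \<open>In \<open>C0_infinity\<close>, \<open>F n\<close> is the derivative of \<open>f\<close> of order \<open>n\<close>;
  the functions are extended by zero to the whole line.\<close>

definition C0_infinity :: "(real \<Rightarrow> complex) set" where
  "C0_infinity =
     {f. (\<exists>F :: nat \<Rightarrow> real \<Rightarrow> complex. F 0 = f \<and>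
            (\<forall>n t. (F n has_vector_derivative F (Suc n) t) (at t))) \<and>
         (\<exists>K. compact K \<and> K \<subseteq> {0<..} \<and> (\<forall>t. t \<notin> K \<longrightarrow> f t = 0))}"

definition laplace :: "(real \<Rightarrow> complex) \<Rightarrow> real \<Rightarrow> complex" where
  "laplace f l = (LINT t|halfline. complex_of_real (exp (- t * l)) * f t)"


section \<open>Nonnegative quadratic forms in \<open>L\<^sup>2\<close>\<close>

text \<open>
  A form is given by its domain \<open>D\<close> and a sesquilinear map \<open>a\<close> (linear in the first argument)
  on it; the quadratic form is \<open>a f f\<close>, which is real because \<open>a\<close> is Hermitian.
  The last clause says that \<open>a\<close> is well defined on classes modulo null functions.
\<close>

definition nonneg_form ::
  "(real \<Rightarrow> complex) set \<Rightarrow> ((real \<Rightarrow> complex) \<Rightarrow> (real \<Rightarrow> complex) \<Rightarrow> complex) \<Rightarrow> bool" where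
  "nonneg_form D a \<longleftrightarrow>
     D \<subseteq> L2 \<and> (\<lambda>t. 0) \<in> D \<and>
     (\<forall>f\<in>D. \<forall>g\<in>D. (\<lambda>t. f t + g t) \<in> D) \<and>
     (\<forall>c. \<forall>f\<in>D. (\<lambda>t. c * f t) \<in> D) \<and>
     (\<forall>f\<in>D. \<forall>g\<in>D. \<forall>u\<in>D. a (\<lambda>t. f t + g t) u = a f u + a g u) \<and>
     (\<forall>c. \<forall>f\<in>D. \<forall>u\<in>D. a (\<lambda>t. c * f t) u = c * a f u) \<and>
     (\<forall>f\<in>D. \<forall>g\<in>D. a g f = cnj (a f g)) \<and>
     (\<forall>f\<in>D. 0 \<le> Re (a f f)) \<and>
     (\<forall>f\<in>D. \<forall>g\<in>D. (AE t in halfline. f t = 0) \<longrightarrow> a f g = 0)"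

definition form_norm ::
  "((real \<Rightarrow> complex) \<Rightarrow> (real \<Rightarrow> complex) \<Rightarrow> complex) \<Rightarrow> (real \<Rightarrow> complex) \<Rightarrow> real" where
  "form_norm a f = sqrt (Re (a f f) + (LINT t|halfline. (cmod (f t))\<^sup>2))"

definition closed_form ::
  "(real \<Rightarrow> complex) set \<Rightarrow> ((real \<Rightarrow> complex) \<Rightarrow> (real \<Rightarrow> complex) \<Rightarrow> complex) \<Rightarrow> bool" where
  "closed_form D a \<longleftrightarrow>
     nonneg_form D a \<and>
     (\<forall>u :: nat \<Rightarrow> real \<Rightarrow> complex.
        (\<forall>n. u n \<in> D) \<and>
        (\<forall>e>0. \<exists>N. \<forall>m\<ge>N. \<forall>n\<ge>N. form_norm a (\<lambda>t. u m t - u n t) < e) \<longrightarrow>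
        (\<exists>f\<in>D. (\<lambda>n. form_norm a (\<lambda>t. u n t - f t)) \<longlonglongrightarrow> 0))"

text \<open>
  The closure of \<open>a\<close> is the completion of its domain in the form norm, realized inside \<open>L\<^sup>2\<close>:
  a closed extension in which the original domain is dense. It is unique up to adding to its
  domain functions that agree almost everywhere with elements of the domain.
\<close>

definition is_form_closure ::
  "(real \<Rightarrow> complex) set \<Rightarrow> ((real \<Rightarrow> complex) \<Rightarrow> (real \<Rightarrow> complex) \<Rightarrow> complex) \<Rightarrow>
   (real \<Rightarrow> complex) set \<Rightarrow> ((real \<Rightarrow> complex) \<Rightarrow> (real \<Rightarrow> complex) \<Rightarrow> complex) \<Rightarrow> bool" where
  "is_form_closure D a D' a' \<longleftrightarrow>
     nonneg_form D a \<and> closed_form D' a' \<and>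
     D \<subseteq> D' \<and> (\<forall>f\<in>D. \<forall>g\<in>D. a' f g = a f g) \<and>
     (\<forall>f\<in>D'. \<exists>u :: nat \<Rightarrow> real \<Rightarrow> complex.
        (\<forall>n. u n \<in> D) \<and> (\<lambda>n. form_norm a' (\<lambda>t. u n t - f t)) \<longlonglongrightarrow> 0)"

definition admits_closure ::
  "(real \<Rightarrow> complex) set \<Rightarrow> ((real \<Rightarrow> complex) \<Rightarrow> (real \<Rightarrow> complex) \<Rightarrow> complex) \<Rightarrow> bool" where
  "admits_closure D a \<longleftrightarrow> (\<exists>D' a'. is_form_closure D a D' a')"


section \<open>Hankel forms\<close>

definition hankel_form ::
  "(real \<Rightarrow> real) \<Rightarrow> (real \<Rightarrow> complex) \<Rightarrow> (real \<Rightarrow> complex) \<Rightarrow> complex" where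
  "hankel_form h f g =
     (LINT t|halfline. LINT s|halfline. complex_of_real (h (t + s)) * f s * cnj (g t))"

text \<open>The polarization of the quadratic form \<open>\<integral>\<bar>L f\<bar>\<^sup>2 dM\<close>, and its maximal domain:\<close>

definition laplace_form ::
  "real measure \<Rightarrow> (real \<Rightarrow> complex) \<Rightarrow> (real \<Rightarrow> complex) \<Rightarrow> complex" where
  "laplace_form M f g = (LINT l|M. laplace f l * cnj (laplace g l))"

definition laplace_domain :: "real measure \<Rightarrow> (real \<Rightarrow> complex) set" where
  "laplace_domain M = {f \<in> L2. integrable M (\<lambda>l. (cmod (laplace f l))\<^sup>2)}"

end

theory Submission
  imports Defs
begin

text \<open>Everything is expressed through the Laplace transform. Fubini's theorem, applied once in each
variable, turns the Hankel form of two functions supported away from \<open>0\<close> and \<open>\<infinity>\<close> into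
\<open>\<integral> L f \<sqdot> cnj (L g) dM\<close>, which is a nonnegative form because \<open>L f\<close> decays exponentially
(\<open>hankel_form_eq_laplace_form\<close>).

An atom at \<open>0\<close> makes the form non-closable. The dilates \<open>n\<^sup>-\<^sup>1 \<phi> (t / n)\<close> of a bump tend to \<open>0\<close> in
\<open>L\<^sup>2\<close>, while their transforms \<open>(L \<phi>) (n l)\<close> keep the value \<open>\<integral> \<phi> > 0\<close> at \<open>l = 0\<close> and tend to \<open>0\<close>
everywhere else. They form a Cauchy sequence for the form whose energies tend to
\<open>(\<integral> \<phi>)\<^sup>2 M {0}\<close>; in a closed extension the limit would be the null function, of energy \<open>0\<close>
(\<open>not_admits_closure_hankel_form\<close>).

Without an atom, the form is closed on its maximal domain: by the Schwarz inequality,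
\<open>\<bar>L f l\<bar>\<^sup>2 \<le> \<parallel>f\<parallel>\<^sup>2 / (2 l)\<close> for \<open>l > 0\<close>, so convergence in \<open>L\<^sup>2\<close> forces pointwise convergence of
the transforms at almost every point for \<open>M\<close>, and Fatou's lemma identifies the limit in \<open>L\<^sup>2(M)\<close>
(\<open>closed_form_laplace_form\<close>).

What remains is that test functions are dense in the maximal domain for the form norm
(\<open>C0_infinity_core\<close>). Only operators that act on \<open>L f\<close> as bounded multipliers are safe there,
since \<open>L f \<in> L\<^sup>2(M)\<close> is all that is known; truncating \<open>f\<close> directly is not. Translation to the
right and averages of translations are of this kind, and they repair both ends of the spectrum:
\<^item> Translation by \<open>\<epsilon>\<close> multiplies the transform by \<open>exp (- \<epsilon> l)\<close>. Letting \<open>\<epsilon> \<rightarrow> 0\<close>, it may be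
  assumed that \<open>f\<close> vanishes on \<open>(0, \<epsilon>]\<close>; this yields exponential decay for large \<open>l\<close>.
\<^item> Let \<open>A\<^sub>j\<close> be the average of the translations by \<open>j, 2 j, \<dots>, j\<^sup>2\<close>. Truncations of \<open>f\<close> to
  \<open>(0, j]\<close> have disjoint translates, hence \<open>A\<^sub>j f \<rightarrow> 0\<close> in \<open>L\<^sup>2\<close>; the multiplier of \<open>A\<^sub>j\<close> lies between
  \<open>0\<close> and \<open>exp (- j l)\<close>, so \<open>L (A\<^sub>j f) \<rightarrow> 0\<close> in \<open>L\<^sup>2(M)\<close> as there is no atom. Thus \<open>f - A\<^sub>j f\<close>
  approximates \<open>f\<close>.
\<^item> The multiplier of \<open>1 - A\<^sub>j\<close> vanishes at \<open>l = 0\<close> to first order, which compensates the factor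
  \<open>1 / (2 l)\<close> in the bound on \<open>L f\<close>. Consequently, on functions that vanish on \<open>(0, \<epsilon>]\<close>, the form
  norm of \<open>v - A\<^sub>j v\<close> is bounded by the \<open>L\<^sup>2\<close> norm of \<open>v\<close>, and \<open>f - A\<^sub>j f\<close> may be replaced by
  \<open>u - A\<^sub>j u\<close> with a test function \<open>u\<close> close to \<open>f\<close> in \<open>L\<^sup>2\<close>.\<close>

section \<open>Smooth functions\<close>

definition smooth :: "(real \<Rightarrow> complex) \<Rightarrow> bool" where
  "smooth f \<longleftrightarrow> (\<exists>F :: nat \<Rightarrow> real \<Rightarrow> complex. F 0 = f \<and>
     (\<forall>n t. (F n has_vector_derivative F (Suc n) t) (at t)))"

lemma smooth_add:
  assumes "smooth f" "smooth g"
  shows "smooth (\<lambda>t. f t + g t)"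
proof -
  obtain F where F: "F 0 = f" "\<And>n t. (F n has_vector_derivative F (Suc n) t) (at t)"
    using assms(1) unfolding smooth_def by blast
  obtain G where G: "G 0 = g" "\<And>n t. (G n has_vector_derivative G (Suc n) t) (at t)"
    using assms(2) unfolding smooth_def by blast
  show ?thesis unfolding smooth_def
    by (intro exI[of _ "\<lambda>n t. F n t + G n t"])
       (use F G in \<open>auto intro!: has_vector_derivative_add\<close>)
qed

lemma smooth_cmult:
  assumes "smooth f"
  shows "smooth (\<lambda>t. c * f t)"
proof -
  obtain F where F: "F 0 = f" "\<And>n t. (F n has_vector_derivative F (Suc n) t) (at t)"
    using assms(1) unfolding smooth_def by blast
  show ?thesis unfolding smooth_def
    by (intro exI[of _ "\<lambda>n t. c * F n t"])
       (use F in \<open>auto intro!: has_vector_derivative_mult_right\<close>)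
qed

lemma smooth_affine:
  assumes "smooth f"
  shows "smooth (\<lambda>t. f (r * t + s))"
proof -
  obtain F where F: "F 0 = f" "\<And>n t. (F n has_vector_derivative F (Suc n) t) (at t)"
    using assms(1) unfolding smooth_def by blast
  have "((\<lambda>t. F n (r * t + s)) has_vector_derivative r *\<^sub>R F (Suc n) (r * t + s)) (at t)" for n t
  proof -
    have "((\<lambda>t. r * t + s) has_vector_derivative r) (at t)"
      by (auto intro!: derivative_eq_intros simp flip: has_real_derivative_iff_has_vector_derivative)
    from vector_diff_chain_at[OF this F(2)] show ?thesis by (simp add: o_def)
  qed
  then have "((\<lambda>t. r ^ n *\<^sub>R F n (r * t + s)) has_vector_derivative
      r ^ Suc n *\<^sub>R F (Suc n) (r * t + s)) (at t)" for n t
    by (auto intro!: derivative_eq_intros simp: mult.commute)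
  then show ?thesis unfolding smooth_def
    by (intro exI[of _ "\<lambda>n t. r ^ n *\<^sub>R F n (r * t + s)"]) (use F(1) in auto)
qed

text \<open>Differentiability to finite order, defined by recursion, makes the closure under products a
  plain induction that needs no Leibniz formula.\<close>

fun times_differentiable :: "nat \<Rightarrow> (real \<Rightarrow> complex) \<Rightarrow> bool" where
  "times_differentiable 0 f \<longleftrightarrow> True"
| "times_differentiable (Suc n) f \<longleftrightarrow>
     (\<exists>f'. (\<forall>t. (f has_vector_derivative f' t) (at t)) \<and> times_differentiable n f')"

lemma times_differentiable_Suc_imp: "times_differentiable (Suc n) f \<Longrightarrow> times_differentiable n f"
  by (induction n arbitrary: f) auto

lemma times_differentiable_add:
  "times_differentiable n f \<Longrightarrow> times_differentiable n g \<Longrightarrow> times_differentiable n (\<lambda>t. f t + g t)"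
proof (induction n arbitrary: f g)
  case (Suc n)
  then obtain f' g' where "\<And>t. (f has_vector_derivative f' t) (at t)" "times_differentiable n f'"
    "\<And>t. (g has_vector_derivative g' t) (at t)" "times_differentiable n g'" by auto
  with Suc.IH show ?case
    by (auto intro!: exI[of _ "\<lambda>t. f' t + g' t"] has_vector_derivative_add)
qed simp

lemma times_differentiable_mult:
  "times_differentiable n f \<Longrightarrow> times_differentiable n g \<Longrightarrow> times_differentiable n (\<lambda>t. f t * g t)"
proof (induction n arbitrary: f g)
  case (Suc n)
  then obtain f' g' where d: "\<And>t. (f has_vector_derivative f' t) (at t)" "times_differentiable n f'"
    "\<And>t. (g has_vector_derivative g' t) (at t)" "times_differentiable n g'" by auto
  have fg: "times_differentiable n f" "times_differentiable n g"
    using Suc.prems times_differentiable_Suc_imp by blast+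
  show ?case
    using times_differentiable_add[OF Suc.IH[OF fg(1) d(4)] Suc.IH[OF d(2) fg(2)]] d(1,3)
    by (auto intro!: exI[of _ "\<lambda>t. f t * g' t + f' t * g t"] has_vector_derivative_mult)
qed simp

text \<open>Derivatives are unique, so differentiability to every finite order fits together into one
sequence of derivatives.\<close>

lemma smooth_iff_times_differentiable: "smooth f \<longleftrightarrow> (\<forall>n. times_differentiable n f)"
proof
  assume "smooth f"
  then obtain F where F: "F 0 = f" "\<And>n t. (F n has_vector_derivative F (Suc n) t) (at t)"
    unfolding smooth_def by blast
  have "times_differentiable n (F m)" for n m
    by (induction n arbitrary: m) (use F(2) in auto)
  then show "\<forall>n. times_differentiable n f" using F(1) by auto
next
  assume all: "\<forall>n. times_differentiable n f"
  define D where "D = (\<lambda>(g::real \<Rightarrow> complex) t. vector_derivative g (at t))"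
  have step: "(\<forall>t. (g has_vector_derivative D g t) (at t)) \<and> (\<forall>n. times_differentiable n (D g))"
    if g: "\<forall>n. times_differentiable n g" for g
  proof -
    have "g' = D g" if "\<forall>t. (g has_vector_derivative g' t) (at t)" for g'
      using that by (auto simp: D_def fun_eq_iff intro!: vector_derivative_at[symmetric])
    moreover have "\<exists>g'. (\<forall>t. (g has_vector_derivative g' t) (at t)) \<and> times_differentiable n g'" for n
      using g[rule_format, of "Suc n"] by simp
    ultimately show ?thesis by metis
  qed
  have "\<forall>n. times_differentiable n ((D ^^ k) f)" for k
    by (induction k) (use all step in auto)
  then show "smooth f" unfolding smooth_def
    by (intro exI[of _ "\<lambda>k. (D ^^ k) f"]) (use step in auto)
qed

lemma smooth_mult:
  "smooth f \<Longrightarrow> smooth g \<Longrightarrow> smooth (\<lambda>t. f t * g t)"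
  by (simp add: smooth_iff_times_differentiable times_differentiable_mult)

lemma smooth_continuous: "smooth f \<Longrightarrow> continuous_on UNIV f"
  unfolding smooth_def
  by (metis continuous_at_imp_continuous_on has_vector_derivative_continuous)

text \<open>The functions \<open>p (1 / t) exp (- 1 / t)\<close>, extended by \<open>0\<close> to \<open>t \<le> 0\<close>. Keeping the polynomial \<open>p\<close> as
a parameter makes the family stable under differentiation, so that one derivative formula gives
smoothness.\<close>

definition flat_exp :: "real poly \<Rightarrow> real \<Rightarrow> real" where
  "flat_exp p t = (if t > 0 then poly p (1 / t) * exp (- (1 / t)) else 0)"

lemma tendsto_poly_exp_neg: "((\<lambda>x. poly p x * exp (- x)) \<longlongrightarrow> (0::real)) at_top"
proof -
  have "((\<lambda>x. \<Sum>k\<le>degree p. coeff p k * (x ^ k / exp x)) \<longlongrightarrow>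
      (\<Sum>k\<le>degree p. coeff p k * 0)) at_top"
    by (intro tendsto_sum tendsto_mult_left tendsto_power_div_exp_0)
  then show ?thesis by (simp add: poly_altdef exp_minus sum_distrib_right divide_inverse mult.assoc)
qed

lemma flat_exp_has_derivative:
  "(flat_exp p has_real_derivative flat_exp ([:0, 0, 1:] * (p - pderiv p)) t) (at t)"
proof -
  consider "t > 0" | "t < 0" | "t = 0" by linarith
  then show ?thesis
  proof cases
    case 1
    have "((\<lambda>t. poly p (1 / t) * exp (- (1 / t))) has_real_derivative
        flat_exp ([:0, 0, 1:] * (p - pderiv p)) t) (at t)"
      using 1
      by (auto intro!: derivative_eq_intros DERIV_chain2[OF poly_DERIV]
               simp: flat_exp_def field_simps power2_eq_square)
    then show ?thesis
      by (rule has_field_derivative_transform_within_open[where S="{0<..}"])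
         (use 1 in \<open>auto simp: flat_exp_def\<close>)
  next
    case 2
    have "((\<lambda>t. 0) has_real_derivative flat_exp ([:0, 0, 1:] * (p - pderiv p)) t) (at t)"
      using 2 by (auto simp: flat_exp_def)
    then show ?thesis
      by (rule has_field_derivative_transform_within_open[where S="{..<0}"])
         (use 2 in \<open>auto simp: flat_exp_def\<close>)
  next
    case 3
    \<comment> \<open>At the origin both one-sided difference quotients tend to \<open>0\<close>; on the right the substitution
    \<open>x = 1 / h\<close> gives a polynomial times \<open>exp (- x)\<close>.\<close>
    have "((\<lambda>h. flat_exp p h / h) \<longlongrightarrow> 0) (at_right 0)"
    proof -
      have "((\<lambda>h. poly (pCons 0 p) (inverse h) * exp (- inverse h)) \<longlongrightarrow> 0) (at_right 0)"
        by (rule filterlim_compose[OF tendsto_poly_exp_neg filterlim_inverse_at_top_right])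
      moreover have "\<forall>\<^sub>F h in at_right (0::real). poly (pCons 0 p) (inverse h) * exp (- inverse h) = flat_exp p h / h"
        by (auto simp: eventually_at_right_less flat_exp_def field_simps
            intro!: eventually_mono[OF eventually_at_right_less])
      ultimately show ?thesis by (rule Lim_transform_eventually)
    qed
    moreover have "((\<lambda>h. flat_exp p h / h) \<longlongrightarrow> 0) (at_left 0)"
      by (rule Lim_transform_eventually[OF tendsto_const])
         (auto simp: flat_exp_def intro!: eventually_at_leftI[of "-1"])
    ultimately have "((\<lambda>h. flat_exp p h / h) \<longlongrightarrow> 0) (at 0)"
      by (simp add: filterlim_at_split)
    then show ?thesis
      using 3 by (simp add: DERIV_def flat_exp_def)
  qed
qed

lemma smooth_flat_exp: "smooth (\<lambda>t. complex_of_real (flat_exp p t))"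
  unfolding smooth_def
proof (intro exI conjI allI)
  fix n t
  let ?T = "\<lambda>p. [:0, 0, 1:] * (p - pderiv p) :: real poly"
  show "((\<lambda>t. complex_of_real (flat_exp ((?T ^^ n) p) t)) has_vector_derivative
      complex_of_real (flat_exp ((?T ^^ Suc n) p) t)) (at t)"
    using flat_exp_has_derivative[of "(?T ^^ n) p" t]
    by (auto intro!: has_vector_derivative_of_real simp: has_real_derivative_iff_has_vector_derivative)
qed simp

section \<open>Square-integrable functions\<close>

definition sq_integrable :: "'a measure \<Rightarrow> ('a \<Rightarrow> complex) \<Rightarrow> bool" where
  "sq_integrable N f \<longleftrightarrow> f \<in> borel_measurable N \<and> integrable N (\<lambda>x. (cmod (f x))\<^sup>2)"

text \<open>The square of the \<open>L\<^sup>2\<close> norm. Working with squares and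
\<open>\<parallel>f + g\<parallel>\<^sup>2 \<le> 2 \<parallel>f\<parallel>\<^sup>2 + 2 \<parallel>g\<parallel>\<^sup>2\<close> avoids square roots and Minkowski's inequality.\<close>

definition sq_norm :: "'a measure \<Rightarrow> ('a \<Rightarrow> complex) \<Rightarrow> real" where
  "sq_norm N f = (LINT x|N. (cmod (f x))\<^sup>2)"

lemma sq_integrableD [dest]:
  assumes "sq_integrable N f"
  shows "f \<in> borel_measurable N" "integrable N (\<lambda>x. (cmod (f x))\<^sup>2)"
  using assms by (auto simp: sq_integrable_def)

lemma sq_norm_nonneg [simp]: "0 \<le> sq_norm N f"
  by (simp add: sq_norm_def)

lemma cmod_add_sq_le: "(cmod (a + b))\<^sup>2 \<le> 2 * (cmod a)\<^sup>2 + 2 * (cmod b)\<^sup>2"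
proof -
  have "(cmod (a + b))\<^sup>2 \<le> (cmod a + cmod b)\<^sup>2"
    by (intro power_mono norm_triangle_ineq) auto
  also have "\<dots> \<le> 2 * (cmod a)\<^sup>2 + 2 * (cmod b)\<^sup>2"
    using sum_squares_ge_zero[of "cmod a - cmod b" 0] by (simp add: power2_eq_square algebra_simps)
  finally show ?thesis .
qed

lemma sq_integrable_bound:
  assumes f: "f \<in> borel_measurable N" and g: "integrable N g" and le: "AE x in N. (cmod (f x))\<^sup>2 \<le> g x"
  shows "sq_integrable N f" "sq_norm N f \<le> (LINT x|N. g x)"
proof -
  have [measurable]: "f \<in> borel_measurable N" by (rule f)
  have int: "integrable N (\<lambda>x. (cmod (f x))\<^sup>2)"
    by (rule Bochner_Integration.integrable_bound[OF g]) (use le in auto)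
  then show "sq_integrable N f" by (simp add: sq_integrable_def f)
  show "sq_norm N f \<le> (LINT x|N. g x)"
    unfolding sq_norm_def by (rule integral_mono_AE[OF int g le])
qed

lemma sq_integrable_add:
  assumes "sq_integrable N f" "sq_integrable N g"
  shows "sq_integrable N (\<lambda>x. f x + g x)" "sq_norm N (\<lambda>x. f x + g x) \<le> 2 * sq_norm N f + 2 * sq_norm N g"
proof -
  note [measurable] = sq_integrableD(1)[OF assms(1)] sq_integrableD(1)[OF assms(2)]
  have int: "integrable N (\<lambda>x. 2 * (cmod (f x))\<^sup>2 + 2 * (cmod (g x))\<^sup>2)"
    by (intro Bochner_Integration.integrable_add integrable_mult_right sq_integrableD(2) assms)
  have m: "(\<lambda>x. f x + g x) \<in> borel_measurable N" by measurable
  note * = sq_integrable_bound[OF m int AE_I2[OF cmod_add_sq_le]]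
  show "sq_integrable N (\<lambda>x. f x + g x)" by (rule *(1))
  show "sq_norm N (\<lambda>x. f x + g x) \<le> 2 * sq_norm N f + 2 * sq_norm N g"
    using *(2) assms by (simp add: sq_norm_def sq_integrable_def)
qed

lemma sq_integrable_cmult:
  assumes "sq_integrable N f"
  shows "sq_integrable N (\<lambda>x. c * f x)"
  using assms by (auto simp: sq_integrable_def norm_mult power_mult_distrib)

lemma sq_norm_cmult: "sq_norm N (\<lambda>x. c * f x) = (cmod c)\<^sup>2 * sq_norm N f"
  by (simp add: sq_norm_def norm_mult power_mult_distrib)

lemma sq_norm_uminus: "sq_norm N (\<lambda>x. - f x) = sq_norm N f"
  by (simp add: sq_norm_def)

lemma sq_norm_minus_commute: "sq_norm N (\<lambda>x. f x - g x) = sq_norm N (\<lambda>x. g x - f x)"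
  by (simp add: sq_norm_def norm_minus_commute)

lemma sq_integrable_diff:
  assumes "sq_integrable N f" "sq_integrable N g"
  shows "sq_integrable N (\<lambda>x. f x - g x)" "sq_norm N (\<lambda>x. f x - g x) \<le> 2 * sq_norm N f + 2 * sq_norm N g"
  using sq_integrable_add[OF assms(1) sq_integrable_cmult[OF assms(2), of "-1"]] sq_norm_cmult[of N "-1" g]
  by simp_all

lemma sq_integrable_zero [simp]: "sq_integrable N (\<lambda>x. 0)"
  by (simp add: sq_integrable_def)

lemma sq_integrable_sum:
  assumes "\<And>i. i \<in> I \<Longrightarrow> sq_integrable N (f i)"
  shows "sq_integrable N (\<lambda>x. \<Sum>i\<in>I. f i x)"
  using assms by (induction I rule: infinite_finite_induct) (auto intro!: sq_integrable_add)

lemma sq_norm_cong_AE: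
  assumes "f \<in> borel_measurable N" "g \<in> borel_measurable N" "AE x in N. f x = g x"
  shows "sq_norm N f = sq_norm N g"
  unfolding sq_norm_def using assms by (intro integral_cong_AE) auto

lemma sq_integrable_cong_AE:
  assumes "sq_integrable N f" "g \<in> borel_measurable N" "AE x in N. f x = g x"
  shows "sq_integrable N g"
  using assms by (intro sq_integrable_bound[of g N "\<lambda>x. (cmod (f x))\<^sup>2"]) auto

lemma sq_norm_eq_0_imp_AE:
  assumes "sq_integrable N f" "sq_norm N f = 0"
  shows "AE x in N. f x = 0"
  using integral_nonneg_eq_0_iff_AE[of N "\<lambda>x. (cmod (f x))\<^sup>2"] assms
  by (auto simp: sq_norm_def sq_integrable_def)

text \<open>The quadratic \<open>\<integral> (w - r \<bar>f\<bar>)\<^sup>2\<close> in \<open>r\<close> is nonnegative; its discriminant gives the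
inequality.\<close>

lemma schwarz_integral:
  fixes w :: "'a \<Rightarrow> real"
  assumes f: "sq_integrable N f" and w: "w \<in> borel_measurable N" "integrable N (\<lambda>x. (w x)\<^sup>2)"
  shows "integrable N (\<lambda>x. w x * cmod (f x))"
    and "(LINT x|N. w x * cmod (f x))\<^sup>2 \<le> (LINT x|N. (w x)\<^sup>2) * sq_norm N f"
proof -
  note [measurable] = w(1) sq_integrableD(1)[OF f]
  have f2: "integrable N (\<lambda>x. (cmod (f x))\<^sup>2)" using f by auto
  have amgm: "\<bar>a * b\<bar> \<le> a\<^sup>2 + b\<^sup>2" for a b :: real
  proof -
    have "0 \<le> (\<bar>a\<bar> - \<bar>b\<bar>)\<^sup>2 + \<bar>a\<bar> * \<bar>b\<bar>" by simp
    also have "\<dots> = a\<^sup>2 + b\<^sup>2 - \<bar>a * b\<bar>" by (simp add: power2_diff abs_mult)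
    finally show ?thesis by simp
  qed
  show wf: "integrable N (\<lambda>x. w x * cmod (f x))"
    by (rule Bochner_Integration.integrable_bound[OF Bochner_Integration.integrable_add[OF w(2) f2]])
       (use amgm in auto)
  define A where "A = (LINT x|N. (w x)\<^sup>2)"
  define B where "B = sq_norm N f"
  define X where "X = (LINT x|N. w x * cmod (f x))"
  have AB: "0 \<le> A" "0 \<le> B" by (simp_all add: A_def B_def)
  have quad: "0 \<le> A - 2 * r * X + r\<^sup>2 * B" for r
  proof -
    have "0 \<le> (LINT x|N. (w x - r * cmod (f x))\<^sup>2)" by simp
    also have "\<dots> = (LINT x|N. (w x)\<^sup>2 - 2 * r * (w x * cmod (f x)) + r\<^sup>2 * (cmod (f x))\<^sup>2)"
      by (rule Bochner_Integration.integral_cong) (auto simp: power2_eq_square algebra_simps)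
    also have "\<dots> = A - 2 * r * X + r\<^sup>2 * B"
      using w(2) f2 wf by (simp add: A_def B_def X_def sq_norm_def)
    finally show ?thesis .
  qed
  have "X\<^sup>2 \<le> A * B"
  proof (cases "B = 0")
    case True
    have "X = 0"
    proof (rule ccontr)
      assume "X \<noteq> 0"
      with quad[of "(A + 1) / (2 * X)"] True show False by simp
    qed
    with True show ?thesis by simp
  next
    case False
    with AB have "B > 0" by simp
    with quad[of "X / B"] show ?thesis by (simp add: field_simps power2_eq_square)
  qed
  then show "(LINT x|N. w x * cmod (f x))\<^sup>2 \<le> (LINT x|N. (w x)\<^sup>2) * sq_norm N f"
    by (simp add: A_def B_def X_def)
qed

lemma borel_measurable_cnj [measurable]: "cnj \<in> borel_measurable borel"
  by (intro borel_measurable_continuous_onI continuous_intros)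

lemma sq_integrable_mult_cnj:
  assumes "sq_integrable N f" "sq_integrable N g"
  shows "integrable N (\<lambda>x. f x * cnj (g x))"
proof -
  note [measurable] = sq_integrableD(1)[OF assms(1)] sq_integrableD(1)[OF assms(2)]
  have "integrable N (\<lambda>x. cmod (f x) * cmod (g x))"
    by (rule schwarz_integral(1)[OF assms(2)]) (use assms(1) in auto)
  then show ?thesis
    by (rule Bochner_Integration.integrable_bound) (auto simp: norm_mult)
qed

text \<open>Fatou's lemma in the form in which it upgrades pointwise convergence to \<open>L\<^sup>2\<close> bounds.\<close>

lemma sq_norm_fatou:
  assumes w: "\<And>m. sq_integrable N (w m)" and v: "v \<in> borel_measurable N"
    and lim: "AE x in N. (\<lambda>m. w m x) \<longlonglongrightarrow> v x"
    and le: "\<forall>\<^sub>F m in sequentially. sq_norm N (w m) \<le> e"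
  shows "sq_integrable N v" "sq_norm N v \<le> e"
proof -
  have [measurable]: "\<And>m. w m \<in> borel_measurable N" "v \<in> borel_measurable N"
    using w v by auto
  obtain m where "sq_norm N (w m) \<le> e" using le by (meson eventually_sequentially le_refl)
  then have e: "0 \<le> e" using sq_norm_nonneg[of N "w m"] by linarith
  have "(\<integral>\<^sup>+x. ennreal ((cmod (v x))\<^sup>2) \<partial>N) = (\<integral>\<^sup>+x. liminf (\<lambda>m. ennreal ((cmod (w m x))\<^sup>2)) \<partial>N)"
  proof (intro nn_integral_cong_AE, use lim in eventually_elim)
    fix x assume "(\<lambda>m. w m x) \<longlonglongrightarrow> v x"
    then have "(\<lambda>m. ennreal ((cmod (w m x))\<^sup>2)) \<longlonglongrightarrow> ennreal ((cmod (v x))\<^sup>2)"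
      by (intro tendsto_ennrealI tendsto_power tendsto_norm)
    from lim_imp_Liminf[OF _ this]
    show "ennreal ((cmod (v x))\<^sup>2) = liminf (\<lambda>m. ennreal ((cmod (w m x))\<^sup>2))" by simp
  qed
  also have "\<dots> \<le> liminf (\<lambda>m. \<integral>\<^sup>+x. ennreal ((cmod (w m x))\<^sup>2) \<partial>N)"
    by (intro nn_integral_liminf) auto
  also have "\<dots> = liminf (\<lambda>m. ennreal (sq_norm N (w m)))"
    using w by (simp add: sq_norm_def nn_integral_eq_integral sq_integrable_def)
  also have "\<dots> \<le> ennreal e"
  proof -
    have "liminf (\<lambda>m. ennreal (sq_norm N (w m))) \<le> liminf (\<lambda>m. ennreal e)"
      by (rule Liminf_mono, use le in eventually_elim) (rule ennreal_leI)
    then show ?thesis by (simp add: Liminf_const)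
  qed
  finally have nn: "(\<integral>\<^sup>+x. ennreal ((cmod (v x))\<^sup>2) \<partial>N) \<le> ennreal e" .
  then have "integrable N (\<lambda>x. (cmod (v x))\<^sup>2)"
    by (intro integrableI_bounded) (auto intro: le_less_trans)
  then show sq: "sq_integrable N v" using v by (simp add: sq_integrable_def)
  show "sq_norm N v \<le> e"
    using nn sq e by (simp add: sq_norm_def nn_integral_eq_integral sq_integrable_def)
qed

text \<open>The weight \<open>w\<close> reduces the claim to the fact that a Cauchy sequence in \<open>L\<^sup>1\<close> has a
subsequence that is Cauchy almost everywhere: by the Schwarz inequality \<open>w u\<^sub>n\<close> is Cauchy in \<open>L\<^sup>1\<close>, and dividing by \<open>w\<close>
recovers the pointwise limit of \<open>u\<^sub>n\<close>. Fatou's lemma turns pointwise convergence of a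
subsequence into \<open>L\<^sup>2\<close> convergence of the sequence.\<close>

lemma L2_complete:
  fixes u :: "nat \<Rightarrow> 'a \<Rightarrow> complex" and w :: "'a \<Rightarrow> real"
  assumes w: "w \<in> borel_measurable N" "integrable N (\<lambda>x. (w x)\<^sup>2)" "\<And>x. w x > 0"
    and u: "\<And>n. sq_integrable N (u n)"
    and cauchy: "\<And>e. e > 0 \<Longrightarrow> \<exists>K. \<forall>m\<ge>K. \<forall>n\<ge>K. sq_norm N (\<lambda>x. u m x - u n x) < e"
  obtains f where "sq_integrable N f" "(\<lambda>n. sq_norm N (\<lambda>x. u n x - f x)) \<longlonglongrightarrow> 0"
proof -
  note [measurable] = w(1) sq_integrableD(1)[OF u]
  define W where "W = (LINT x|N. (w x)\<^sup>2)"
  have W: "W \<ge> 0" by (simp add: W_def)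
  have int: "integrable N (\<lambda>x. complex_of_real (w x) * u n x)" for n
    by (rule Bochner_Integration.integrable_bound[OF schwarz_integral(1)[OF u[of n] w(1,2)]])
       (auto simp: norm_mult abs_mult)
  have "\<exists>K. \<forall>i\<ge>K. \<forall>j\<ge>K.
      (LINT x|N. norm (complex_of_real (w x) * u i x - complex_of_real (w x) * u j x)) < e"
    if e: "e > 0" for e
  proof -
    from cauchy[of "e\<^sup>2 / (W + 1)"] e W
    obtain K where K: "\<And>i j. i \<ge> K \<Longrightarrow> j \<ge> K \<Longrightarrow> sq_norm N (\<lambda>x. u i x - u j x) < e\<^sup>2 / (W + 1)"
      by auto
    have "(LINT x|N. norm (complex_of_real (w x) * u i x - complex_of_real (w x) * u j x)) < e"
      if ij: "i \<ge> K" "j \<ge> K" for i j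
    proof -
      let ?I = "LINT x|N. w x * cmod (u i x - u j x)"
      have eq: "(LINT x|N. norm (complex_of_real (w x) * u i x - complex_of_real (w x) * u j x)) = ?I"
        using w(3) by (simp add: norm_mult less_imp_le flip: right_diff_distrib)
      have "?I\<^sup>2 \<le> W * sq_norm N (\<lambda>x. u i x - u j x)"
        unfolding W_def by (rule schwarz_integral(2)[OF sq_integrable_diff(1)[OF u u] w(1,2)])
      also have "\<dots> \<le> W * (e\<^sup>2 / (W + 1))"
        using K[OF ij] W by (intro mult_left_mono) auto
      also have "\<dots> < e\<^sup>2" using W e by (simp add: field_simps)
      finally have "?I < e" using e by (simp add: power2_less_imp_less)
      then show ?thesis by (simp add: eq)
    qed
    then show ?thesis by blast
  qed
  from cauchy_L1_AE_cauchy_subseq[OF int this]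
  obtain r where r: "strict_mono r"
    and ae: "AE x in N. Cauchy (\<lambda>i. complex_of_real (w x) * u (r i) x)" by blast
  define f where "f = (\<lambda>x. lim (\<lambda>i. u (r i) x))"
  have f[measurable]: "f \<in> borel_measurable N" unfolding f_def by measurable
  have lim: "AE x in N. (\<lambda>i. u (r i) x) \<longlonglongrightarrow> f x"
    using ae
  proof eventually_elim
    fix x assume "Cauchy (\<lambda>i. complex_of_real (w x) * u (r i) x)"
    then have "convergent (\<lambda>i. complex_of_real (w x) * u (r i) x)" by (rule Cauchy_convergent)
    then obtain y where "(\<lambda>i. complex_of_real (w x) * u (r i) x) \<longlonglongrightarrow> y" by (auto simp: convergent_def)
    from tendsto_mult_left[OF this, of "inverse (complex_of_real (w x))"]
    have "(\<lambda>i. u (r i) x) \<longlonglongrightarrow> inverse (complex_of_real (w x)) * y"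
      using w(3)[of x] by (simp add: mult.assoc[symmetric])
    then show "(\<lambda>i. u (r i) x) \<longlonglongrightarrow> f x" unfolding f_def by (simp add: limI)
  qed
  have close: "\<exists>K. \<forall>n\<ge>K. sq_integrable N (\<lambda>x. f x - u n x) \<and> sq_norm N (\<lambda>x. f x - u n x) \<le> e" if "e > 0" for e
  proof -
    from cauchy[OF that] obtain K where
      K: "\<And>i j. i \<ge> K \<Longrightarrow> j \<ge> K \<Longrightarrow> sq_norm N (\<lambda>x. u i x - u j x) < e" by blast
    have "sq_integrable N (\<lambda>x. f x - u n x) \<and> sq_norm N (\<lambda>x. f x - u n x) \<le> e" if "n \<ge> K" for n
    proof -
      have ev: "\<forall>\<^sub>F i in sequentially. sq_norm N (\<lambda>x. u (r i) x - u n x) \<le> e"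
        using eventually_ge_at_top[of K]
      proof eventually_elim
        fix i assume "K \<le> i"
        then have "K \<le> r i" using seq_suble[OF r, of i] by linarith
        from K[OF this \<open>n \<ge> K\<close>] show "sq_norm N (\<lambda>x. u (r i) x - u n x) \<le> e" by simp
      qed
      have ae: "AE x in N. (\<lambda>i. u (r i) x - u n x) \<longlonglongrightarrow> f x - u n x"
        using lim by eventually_elim (intro tendsto_intros)
      have meas: "(\<lambda>x. f x - u n x) \<in> borel_measurable N" by measurable
      have sq: "sq_integrable N (\<lambda>x. u (r i) x - u n x)" for i
        by (rule sq_integrable_diff(1)[OF u u])
      show ?thesis
        by (intro conjI sq_norm_fatou[where w="\<lambda>i x. u (r i) x - u n x", OF sq meas ae ev])
    qed
    then show ?thesis by blast
  qed
  from close[of 1] obtain K where "sq_integrable N (\<lambda>x. f x - u K x)" by auto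
  from sq_integrable_add(1)[OF this u[of K]] have "sq_integrable N f" by simp
  moreover have "(\<lambda>n. sq_norm N (\<lambda>x. u n x - f x)) \<longlonglongrightarrow> 0"
  proof (rule LIMSEQ_I)
    fix e :: real assume "e > 0"
    with close[of "e/2"] obtain K where "\<And>n. n \<ge> K \<Longrightarrow> sq_norm N (\<lambda>x. f x - u n x) \<le> e / 2" by auto
    then show "\<exists>K. \<forall>n\<ge>K. norm (sq_norm N (\<lambda>x. u n x - f x) - 0) < e"
      using \<open>e > 0\<close> by (intro exI[of _ K]) (force simp: sq_norm_minus_commute[of N _ f])
  qed
  ultimately show ?thesis by (rule that)
qed

lemma sq_norm_tendsto_0:
  assumes u: "\<And>n. u n \<in> borel_measurable N" and g: "integrable N g"
    and lim: "AE x in N. (\<lambda>n. u n x) \<longlonglongrightarrow> 0" and le: "\<And>n. AE x in N. (cmod (u n x))\<^sup>2 \<le> g x"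
  shows "(\<lambda>n. sq_norm N (u n)) \<longlonglongrightarrow> 0"
proof -
  have "(\<lambda>n. LINT x|N. (cmod (u n x))\<^sup>2) \<longlonglongrightarrow> (LINT x|N. 0)"
  proof (rule integral_dominated_convergence[OF _ _ g])
    show "AE x in N. (\<lambda>n. (cmod (u n x))\<^sup>2) \<longlonglongrightarrow> 0"
      using lim by eventually_elim (auto intro!: tendsto_eq_intros)
    show "\<And>n. (\<lambda>x. (cmod (u n x))\<^sup>2) \<in> borel_measurable N" using u by auto
    show "\<And>n. AE x in N. norm ((cmod (u n x))\<^sup>2) \<le> g x" using le by simp
  qed simp
  then show ?thesis by (simp add: sq_norm_def)
qed

section \<open>Density of test functions in \<open>L\<^sup>2\<close>\<close>

lemma smooth_compact_support_bounded:
  assumes "smooth u" "\<forall>t. t \<notin> {a..b} \<longrightarrow> u t = 0"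
  obtains B where "B \<ge> 0" "\<And>t. cmod (u t) \<le> B"
proof -
  have "bounded (u ` {a..b})"
    using smooth_continuous[OF assms(1)]
    by (intro compact_imp_bounded compact_continuous_image) (auto intro: continuous_on_subset)
  then obtain B where "\<forall>x\<in>u ` {a..b}. cmod x \<le> B" unfolding bounded_iff ..
  then have "\<And>t. t \<in> {a..b} \<Longrightarrow> cmod (u t) \<le> B" by blast
  then have "cmod (u t) \<le> max B 0" for t using assms(2) by (cases "t \<in> {a..b}") (force simp: le_max_iff_disj)+
  then show ?thesis by (intro that[of "max B 0"]) auto
qed

lemma smooth_borel: "smooth u \<Longrightarrow> u \<in> borel_measurable borel"
  by (intro borel_measurable_continuous_onI smooth_continuous)

lemma integrable_indicator_interval: "integrable lborel (\<lambda>t. c * indicator {a..b::real} t :: real)"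
  by (intro integrable_mult_right integrable_real_indicator) (auto simp: emeasure_lborel_Icc_eq)

lemma smooth_compact_support_sq_integrable:
  assumes "smooth u" "\<forall>t. t \<notin> {a..b} \<longrightarrow> u t = 0"
  shows "sq_integrable lborel u"
proof -
  obtain B where B: "B \<ge> 0" "\<And>t. cmod (u t) \<le> B"
    using smooth_compact_support_bounded[OF assms] by blast
  show ?thesis
  proof (rule sq_integrable_bound(1)[OF _ integrable_indicator_interval[of "B\<^sup>2" a b]])
    show "AE t in lborel. (cmod (u t))\<^sup>2 \<le> B\<^sup>2 * indicator {a..b} t"
      using B assms(2) by (auto simp: indicator_def intro!: AE_I2 power_mono)
  qed (use smooth_borel[OF assms(1)] in simp)
qed

text \<open>The functions that are \<open>L\<^sup>2\<close> limits of smooth functions supported in \<open>[a, b]\<close>. Fixing the support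
makes this class a closed linear subspace.\<close>

definition smooth_approx :: "real \<Rightarrow> real \<Rightarrow> (real \<Rightarrow> complex) \<Rightarrow> bool" where
  "smooth_approx a b f \<longleftrightarrow> sq_integrable lborel f \<and>
     (\<forall>e>0. \<exists>u. smooth u \<and> (\<forall>t. t \<notin> {a..b} \<longrightarrow> u t = 0) \<and> sq_norm lborel (\<lambda>t. u t - f t) < e)"

lemma smooth_approxE:
  assumes "smooth_approx a b f" "e > 0"
  obtains u where "smooth u" "\<forall>t. t \<notin> {a..b} \<longrightarrow> u t = 0" "sq_norm lborel (\<lambda>t. u t - f t) < e"
  using assms unfolding smooth_approx_def by blast

lemma smooth_approx_limit:
  assumes f: "sq_integrable lborel f" and F: "\<And>n. smooth_approx a b (F n)"
    and lim: "(\<lambda>n. sq_norm lborel (\<lambda>t. F n t - f t)) \<longlonglongrightarrow> 0"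
  shows "smooth_approx a b f"
  unfolding smooth_approx_def
proof (intro conjI allI impI f)
  fix e :: real assume "e > 0"
  then have "\<forall>\<^sub>F n in sequentially. sq_norm lborel (\<lambda>t. F n t - f t) < e / 4"
    using lim by (intro order_tendstoD(2)) auto
  then obtain n where n: "sq_norm lborel (\<lambda>t. F n t - f t) < e / 4"
    by (meson eventually_sequentially le_refl)
  obtain u where u: "smooth u" "\<forall>t. t \<notin> {a..b} \<longrightarrow> u t = 0"
    "sq_norm lborel (\<lambda>t. u t - F n t) < e / 4"
    using smooth_approxE[OF F[of n], of "e / 4"] \<open>e > 0\<close> by auto
  have Fn: "sq_integrable lborel (F n)" using F[of n] by (simp add: smooth_approx_def)
  have "sq_norm lborel (\<lambda>t. (u t - F n t) + (F n t - f t)) < e"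
    using sq_integrable_add(2)[OF sq_integrable_diff(1)[OF smooth_compact_support_sq_integrable[OF u(1,2)] Fn]
        sq_integrable_diff(1)[OF Fn f]] n u(3) by simp
  then show "\<exists>u. smooth u \<and> (\<forall>t. t \<notin> {a..b} \<longrightarrow> u t = 0) \<and> sq_norm lborel (\<lambda>t. u t - f t) < e"
    using u by auto
qed

lemma smooth_zero: "smooth (\<lambda>t. 0)"
  unfolding smooth_def by (intro exI[of _ "\<lambda>n t. 0"]) auto

lemma smooth_imp_smooth_approx:
  assumes "smooth f" "\<forall>t. t \<notin> {a..b} \<longrightarrow> f t = 0"
  shows "smooth_approx a b f"
  unfolding smooth_approx_def using assms smooth_compact_support_sq_integrable[OF assms]
  by (auto intro!: exI[of _ f] simp: sq_norm_def)

lemma smooth_approx_zero: "smooth_approx a b (\<lambda>t. 0)"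
  by (intro smooth_imp_smooth_approx smooth_zero) auto

lemma smooth_approx_add:
  assumes f: "smooth_approx a b f" and g: "smooth_approx a b g"
  shows "smooth_approx a b (\<lambda>t. f t + g t)"
  unfolding smooth_approx_def
proof (intro conjI allI impI)
  have sq: "sq_integrable lborel f" "sq_integrable lborel g"
    using f g by (auto simp: smooth_approx_def)
  then show "sq_integrable lborel (\<lambda>t. f t + g t)" by (intro sq_integrable_add)
  fix e :: real assume "e > 0"
  obtain u where u: "smooth u" "\<forall>t. t \<notin> {a..b} \<longrightarrow> u t = 0"
    "sq_norm lborel (\<lambda>t. u t - f t) < e / 4"
    using smooth_approxE[OF f, of "e / 4"] \<open>e > 0\<close> by auto
  obtain v where v: "smooth v" "\<forall>t. t \<notin> {a..b} \<longrightarrow> v t = 0"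
    "sq_norm lborel (\<lambda>t. v t - g t) < e / 4"
    using smooth_approxE[OF g, of "e / 4"] \<open>e > 0\<close> by auto
  have "sq_norm lborel (\<lambda>t. (u t - f t) + (v t - g t)) < e"
    using sq_integrable_add(2)[OF sq_integrable_diff(1)[OF smooth_compact_support_sq_integrable[OF u(1,2)] sq(1)]
       sq_integrable_diff(1)[OF smooth_compact_support_sq_integrable[OF v(1,2)] sq(2)]] u(3) v(3) by simp
  then show "\<exists>u. smooth u \<and> (\<forall>t. t \<notin> {a..b} \<longrightarrow> u t = 0) \<and> sq_norm lborel (\<lambda>t. u t - (f t + g t)) < e"
    by (intro exI[of _ "\<lambda>t. u t + v t"]) (use u v in \<open>auto intro!: smooth_add simp: algebra_simps\<close>)
qed

lemma smooth_approx_cmult: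
  assumes f: "smooth_approx a b f"
  shows "smooth_approx a b (\<lambda>t. c * f t)"
  unfolding smooth_approx_def
proof (intro conjI allI impI)
  have sq: "sq_integrable lborel f" using f by (auto simp: smooth_approx_def)
  then show "sq_integrable lborel (\<lambda>t. c * f t)" by (intro sq_integrable_cmult)
  fix e :: real assume "e > 0"
  have pos: "(cmod c)\<^sup>2 + 1 > 0" by (simp add: add_nonneg_pos)
  obtain u where u: "smooth u" "\<forall>t. t \<notin> {a..b} \<longrightarrow> u t = 0"
    "sq_norm lborel (\<lambda>t. u t - f t) < e / ((cmod c)\<^sup>2 + 1)"
    using smooth_approxE[OF f divide_pos_pos[OF \<open>e > 0\<close> pos]] by blast
  have "sq_norm lborel (\<lambda>t. c * (u t - f t)) \<le> ((cmod c)\<^sup>2 + 1) * sq_norm lborel (\<lambda>t. u t - f t)"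
    unfolding sq_norm_cmult by (intro mult_right_mono) auto
  also have "\<dots> < e" using u(3) pos by (simp add: pos_less_divide_eq mult.commute)
  finally show "\<exists>u. smooth u \<and> (\<forall>t. t \<notin> {a..b} \<longrightarrow> u t = 0) \<and> sq_norm lborel (\<lambda>t. u t - c * f t) < e"
    by (intro exI[of _ "\<lambda>t. c * u t"]) (use u in \<open>auto intro!: smooth_cmult simp: algebra_simps\<close>)
qed

lemma smooth_approx_sum:
  "(\<And>i. i \<in> I \<Longrightarrow> smooth_approx a b (f i)) \<Longrightarrow> smooth_approx a b (\<lambda>t. \<Sum>i\<in>I. f i t)"
  by (induction I rule: infinite_finite_induct) (auto intro!: smooth_approx_add smooth_approx_zero)

text \<open>As \<open>r \<rightarrow> \<infinity>\<close> these smooth functions increase to the indicator of \<open>(c, d)\<close>, because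
\<open>exp (- 1 / (r x)) \<rightarrow> 1\<close> for every \<open>x > 0\<close>.\<close>

definition bump :: "real \<Rightarrow> real \<Rightarrow> real \<Rightarrow> real \<Rightarrow> real" where
  "bump c d r t = flat_exp 1 (r * (t - c)) * flat_exp 1 (r * (d - t))"

lemma bump_bounds: "0 \<le> bump c d r t" "bump c d r t \<le> 1"
  by (auto simp: bump_def flat_exp_def intro!: mult_le_one)

lemma bump_pos: "r > 0 \<Longrightarrow> c < t \<Longrightarrow> t < d \<Longrightarrow> bump c d r t > 0"
  by (simp add: bump_def flat_exp_def)

lemma bump_outside:
  assumes "r > 0" "t \<notin> {c<..<d}" shows "bump c d r t = 0"
proof -
  have "\<not> 0 < r * (t - c) \<or> \<not> 0 < r * (d - t)"
    using assms by (auto simp: zero_less_mult_iff)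
  then show ?thesis by (auto simp: bump_def flat_exp_def)
qed

lemma smooth_bump: "smooth (\<lambda>t. complex_of_real (bump c d r t))"
  using smooth_mult[OF smooth_affine[OF smooth_flat_exp[of 1], of r "- r * c"]
     smooth_affine[OF smooth_flat_exp[of 1], of "- r" "r * d"]]
  by (simp add: bump_def algebra_simps)

lemma bump_tendsto_indicator:
  "(\<lambda>n. bump c d (real (Suc n)) t) \<longlonglongrightarrow> indicator {c<..<d} t"
proof (cases "t \<in> {c<..<d}")
  case True
  have lim: "(\<lambda>n. exp (- (1 / (real (Suc n) * x)))) \<longlonglongrightarrow> 1" if "x > 0" for x
  proof -
    have "(\<lambda>n. exp (- (inverse (real (Suc n)) * (1 / x)))) \<longlonglongrightarrow> exp (- (0 * (1 / x)))"
      by (intro tendsto_intros LIMSEQ_inverse_real_of_nat)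
    then show ?thesis by (simp add: field_simps)
  qed
  have "(\<lambda>n. exp (- (1 / (real (Suc n) * (t - c)))) * exp (- (1 / (real (Suc n) * (d - t))))) \<longlonglongrightarrow> 1 * 1"
    by (intro tendsto_mult lim) (use True in auto)
  moreover have "bump c d (real (Suc n)) t =
      exp (- (1 / (real (Suc n) * (t - c)))) * exp (- (1 / (real (Suc n) * (d - t))))" for n
    using True by (simp add: bump_def flat_exp_def zero_less_mult_iff)
  ultimately show ?thesis using True by simp
next
  case False
  then show ?thesis using bump_outside[of _ t c d] by simp
qed

lemma smooth_approx_interval:
  assumes "{c<..<d} \<subseteq> {a..b}"
  shows "smooth_approx a b (indicator {c<..<d})"
proof (rule smooth_approx_limit)
  let ?F = "\<lambda>n t. complex_of_real (bump c d (real (Suc n)) t)"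
  show "smooth_approx a b (?F n)" for n
    by (rule smooth_imp_smooth_approx[OF smooth_bump])
       (use assms bump_outside[of "real (Suc n)" _ c d] in \<open>force simp del: of_nat_Suc\<close>)
  have [measurable]: "?F n \<in> borel_measurable borel" for n
    by (rule smooth_borel[OF smooth_bump])
  show "sq_integrable lborel (indicator {c<..<d})"
    by (rule sq_integrable_bound(1)[OF _ integrable_indicator_interval[of 1 c d]])
       (auto simp: indicator_def)
  show "(\<lambda>n. sq_norm lborel (\<lambda>t. ?F n t - indicator {c<..<d} t)) \<longlonglongrightarrow> 0"
  proof (rule sq_norm_tendsto_0[OF _ integrable_indicator_interval[of 1 c d]])
    show "(\<lambda>t. ?F n t - indicator {c<..<d} t) \<in> borel_measurable lborel" for n by measurable
    have "(\<lambda>n. ?F n t - indicator {c<..<d} t) \<longlonglongrightarrow> 0" for t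
      using tendsto_diff[OF tendsto_of_real[OF bump_tendsto_indicator[of c d t]] tendsto_const[of "indicator {c<..<d} t"]]
      by (auto simp: indicator_def of_bool_def)
    then show "AE t in lborel. (\<lambda>n. ?F n t - indicator {c<..<d} t) \<longlonglongrightarrow> 0" by simp
    show "AE t in lborel. (cmod (?F n t - indicator {c<..<d} t))\<^sup>2 \<le> 1 * indicator {c..d} t" for n
    proof (intro AE_I2)
      fix t
      show "(cmod (?F n t - indicator {c<..<d} t))\<^sup>2 \<le> 1 * indicator {c..d} t"
      proof (cases "t \<in> {c<..<d}")
        case True
        have "cmod (?F n t - indicator {c<..<d} t) = 1 - bump c d (real (Suc n)) t"
          using True bump_bounds(2)[of c d "real (Suc n)" t]
          by (simp add: cmod_def)
        then show ?thesis
          using True bump_bounds[of c d "real (Suc n)" t] by (simp add: power_le_one)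
      next
        case False
        then show ?thesis using bump_outside[of "real (Suc n)" t c d] by (simp add: indicator_def)
      qed
    qed
  qed
qed

text \<open>The open half-lines form an intersection-stable generator of the Borel sets, and the sets with the
required property form a Dynkin system since the approximable functions are a closed subspace.\<close>

lemma smooth_approx_indicator:
  assumes "A \<in> sets borel"
  shows "smooth_approx a b (indicator (A \<inter> {a<..<b}))"
proof -
  have sq: "sq_integrable lborel (indicator (A \<inter> {a<..<b}))" if [measurable]: "A \<in> sets borel" for A
    by (rule sq_integrable_bound(1)[OF _ integrable_indicator_interval[of 1 a b]])
       (auto simp: indicator_def)
  have sub: "{a<..<b} \<subseteq> {a..b}" by auto
  have gen: "sets (borel :: real measure) = sigma_sets UNIV (range lessThan)"
    by (simp add: borel_Iio)
  have stable: "Int_stable (range (lessThan :: real \<Rightarrow> _))"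
  proof (rule Int_stableI_image)
    show "\<exists>c\<in>UNIV. {..<a} \<inter> {..<b} = {..<c}" for a b :: real
      by (intro bexI[of _ "min a b"]) auto
  qed
  have mem: "A \<in> sigma_sets UNIV (range lessThan)" using assms gen by simp
  from stable subset_UNIV[of "range lessThan", folded Pow_UNIV] mem show ?thesis
  proof (induction rule: sigma_sets_induct_disjoint)
    case (basic A)
    then obtain x where "A = {..<x}" by auto
    then have "A \<inter> {a<..<b} = {a<..<min x b}" by auto
    moreover have "{a<..<min x b} \<subseteq> {a..b}" by auto
    ultimately show ?case by (metis smooth_approx_interval)
  next
    case empty
    then show ?case using smooth_approx_zero[of a b] by (simp add: indicator_def)
  next
    case (compl A)
    have "(\<lambda>t. indicator {a<..<b} t + (-1) * indicator (A \<inter> {a<..<b}) t :: complex) =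
        indicator ((UNIV - A) \<inter> {a<..<b})"
      by (auto simp: indicator_def)
    then show ?case
      using smooth_approx_add[OF smooth_approx_interval[OF sub] smooth_approx_cmult[OF compl(2), of "-1"]]
      by auto
  next
    case (union A)
    have meas [measurable]: "A i \<in> sets borel" for i using union(2) gen by auto
    have eq: "(\<Sum>i<n. indicator (A i \<inter> {a<..<b}) t :: complex) = indicator ((\<Union>i<n. A i) \<inter> {a<..<b}) t" for n t
    proof -
      have "(\<Sum>i<n. indicator (A i \<inter> {a<..<b}) t :: complex) = indicator (\<Union>i<n. A i \<inter> {a<..<b}) t"
        by (rule indicator_UN_disjoint[symmetric])
           (use union(1) in \<open>auto simp: disjoint_family_on_def\<close>)
      then show ?thesis by (simp add: Int_UN_distrib2)
    qed
    show ?case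
    proof (rule smooth_approx_limit[OF sq])
      show "smooth_approx a b (\<lambda>t. \<Sum>i<n. indicator (A i \<inter> {a<..<b}) t)" for n
        by (intro smooth_approx_sum union.IH)
      show "(\<lambda>n. sq_norm lborel (\<lambda>t. (\<Sum>i<n. indicator (A i \<inter> {a<..<b}) t) -
          indicator ((\<Union>i. A i) \<inter> {a<..<b}) t)) \<longlonglongrightarrow> 0"
        unfolding eq
      proof (rule sq_norm_tendsto_0[OF _ integrable_indicator_interval[of 1 a b]])
        show "(\<lambda>t. indicator ((\<Union>i<n. A i) \<inter> {a<..<b}) t - indicator ((\<Union>i. A i) \<inter> {a<..<b}) t :: complex)
            \<in> borel_measurable lborel" for n by measurable
        show "AE t in lborel. (\<lambda>n. indicator ((\<Union>i<n. A i) \<inter> {a<..<b}) t -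
            indicator ((\<Union>i. A i) \<inter> {a<..<b}) t :: complex) \<longlonglongrightarrow> 0"
        proof (intro AE_I2)
          fix t
          have "\<forall>\<^sub>F n in sequentially. (indicator ((\<Union>i<n. A i) \<inter> {a<..<b}) t -
            indicator ((\<Union>i. A i) \<inter> {a<..<b}) t :: complex) = 0"
          proof (cases "t \<in> (\<Union>i. A i)")
            case True
            then obtain i where "t \<in> A i" by auto
            then show ?thesis
              by (intro eventually_mono[OF eventually_gt_at_top[of i]]) (auto simp: indicator_def)
          qed (auto simp: indicator_def)
          then show "(\<lambda>n. indicator ((\<Union>i<n. A i) \<inter> {a<..<b}) t -
            indicator ((\<Union>i. A i) \<inter> {a<..<b}) t :: complex) \<longlonglongrightarrow> 0"
            by (rule tendsto_eventually)
        qed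
        show "AE t in lborel. (cmod (indicator ((\<Union>i<n. A i) \<inter> {a<..<b}) t -
            indicator ((\<Union>i. A i) \<inter> {a<..<b}) t))\<^sup>2 \<le> 1 * indicator {a..b} t" for n
          by (auto simp: indicator_def)
      qed
    qed measurable
  qed
qed

text \<open>The simple functions that approximate \<open>f\<close> are bounded by \<open>2 \<bar>f\<bar>\<close>. Hence they vanish outside
\<open>(a, b)\<close>, are combinations of indicators of subsets of it, and converge to \<open>f\<close> in \<open>L\<^sup>2\<close>.\<close>

lemma smooth_approx_sq_integrable:
  assumes f: "sq_integrable lborel f" and supp: "\<And>t. t \<notin> {a<..<b} \<Longrightarrow> f t = 0"
  shows "smooth_approx a b f"
proof -
  have meas: "f \<in> borel_measurable lborel" using f by auto
  from borel_measurable_implies_sequence_metric[OF this, of 0]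
  obtain F where F: "\<And>i. simple_function lborel (F i)" "\<And>t. (\<lambda>i. F i t) \<longlonglongrightarrow> f t"
    "\<And>i t. cmod (F i t) \<le> 2 * cmod (f t)" by auto
  have supp': "F i t = 0" if "t \<notin> {a<..<b}" for i t using F(3)[of i t] supp[OF that] by simp
  show ?thesis
  proof (rule smooth_approx_limit[OF f])
    fix i
    have fin: "finite (range (F i))" using F(1)[of i] by (simp add: simple_function_def)
    have sets: "F i -` {y} \<in> sets borel" for y
      using simple_functionD(2)[OF F(1)[of i], of "{y}"] by simp
    have "F i t = (\<Sum>y\<in>range (F i). y * indicator (F i -` {y} \<inter> {a<..<b}) t)" for t
    proof (cases "t \<in> {a<..<b}")
      case True
      have "(\<Sum>y\<in>range (F i). y * indicator (F i -` {y} \<inter> {a<..<b}) t) =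
          (\<Sum>y\<in>range (F i). if y = F i t then y else 0)"
        by (intro sum.cong) (use True in \<open>auto simp: indicator_def\<close>)
      then show ?thesis using fin by simp
    qed (simp add: supp')
    then have "F i = (\<lambda>t. \<Sum>y\<in>range (F i). y * indicator (F i -` {y} \<inter> {a<..<b}) t)" by blast
    moreover have "smooth_approx a b (\<lambda>t. \<Sum>y\<in>range (F i). y * indicator (F i -` {y} \<inter> {a<..<b}) t)"
      by (intro smooth_approx_sum smooth_approx_cmult smooth_approx_indicator sets)
    ultimately show "smooth_approx a b (F i)" by simp
  next
    have [measurable]: "F i \<in> borel_measurable borel" "f \<in> borel_measurable borel" for i
      using borel_measurable_simple_function[OF F(1)[of i]] meas by simp_all
    show "(\<lambda>n. sq_norm lborel (\<lambda>t. F n t - f t)) \<longlonglongrightarrow> 0"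
    proof (rule sq_norm_tendsto_0)
      show "integrable lborel (\<lambda>t. 9 * (cmod (f t))\<^sup>2)" using f by auto
      show "AE t in lborel. (\<lambda>n. F n t - f t) \<longlonglongrightarrow> 0"
        using F(2) by (auto intro!: AE_I2 simp: LIM_zero_iff)
      show "AE t in lborel. (cmod (F n t - f t))\<^sup>2 \<le> 9 * (cmod (f t))\<^sup>2" for n
      proof (intro AE_I2)
        fix t
        have "cmod (F n t - f t) \<le> 3 * cmod (f t)"
          using norm_triangle_ineq4[of "F n t" "f t"] F(3)[of n t] by linarith
        from power_mono[OF this, of 2] show "(cmod (F n t - f t))\<^sup>2 \<le> 9 * (cmod (f t))\<^sup>2"
          by (simp add: power_mult_distrib)
      qed
    qed measurable
  qed
qed

lemma test_functions_dense:
  fixes f :: "real \<Rightarrow> complex"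
  assumes f: "sq_integrable lborel f" and supp: "\<And>t. t \<le> c \<Longrightarrow> f t = 0" and e: "e > 0"
  obtains u a b where "smooth u" "c < a" "a < b" "\<forall>t. t \<notin> {a..b} \<longrightarrow> u t = 0"
    "sq_norm lborel (\<lambda>t. u t - f t) < e"
proof -
  \<comment> \<open>Truncating to these intervals keeps the supports of the approximants inside \<open>(c, \<infinity>)\<close>.\<close>
  let ?I = "\<lambda>n. {c + 1 / real (Suc n)<..<c + 1 + real (Suc n)}"
  define F where "F = (\<lambda>n t. indicator (?I n) t * f t)"
  have [measurable]: "f \<in> borel_measurable borel" using f by auto
  have int: "integrable lborel (\<lambda>t. (cmod (f t))\<^sup>2)" using f by auto
  have Fsq: "sq_integrable lborel (F n)" for n
    unfolding F_def
    by (rule sq_integrable_bound(1)[OF _ int]) (auto simp: indicator_def norm_mult)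
  have "(\<lambda>n. sq_norm lborel (\<lambda>t. F n t - f t)) \<longlonglongrightarrow> 0"
  proof (rule sq_norm_tendsto_0[OF _ int])
    show "(\<lambda>t. F n t - f t) \<in> borel_measurable lborel" for n unfolding F_def by measurable
    show "AE t in lborel. (\<lambda>n. F n t - f t) \<longlonglongrightarrow> 0"
    proof (intro AE_I2 tendsto_eventually)
      fix t
      show "\<forall>\<^sub>F n in sequentially. F n t - f t = 0"
      proof (cases "t \<le> c")
        case False
        have "\<forall>\<^sub>F n in sequentially. 1 / real (Suc n) < t - c"
          using order_tendstoD(2)[OF LIMSEQ_inverse_real_of_nat, of "t - c"] False
          by (simp add: inverse_eq_divide)
        moreover have "\<forall>\<^sub>F n in sequentially. t - c < real (Suc n)"
          using filterlim_compose[OF filterlim_real_sequentially filterlim_Suc]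
          by (simp add: filterlim_at_top_dense)
        ultimately show ?thesis
          by eventually_elim (auto simp: F_def indicator_def)
      qed (simp add: F_def supp)
    qed
    show "AE t in lborel. (cmod (F n t - f t))\<^sup>2 \<le> (cmod (f t))\<^sup>2" for n
      by (auto simp: F_def indicator_def)
  qed
  then have "\<forall>\<^sub>F n in sequentially. sq_norm lborel (\<lambda>t. F n t - f t) < e / 4"
    using e by (intro order_tendstoD(2)) auto
  then obtain n where n: "sq_norm lborel (\<lambda>t. F n t - f t) < e / 4"
    by (meson eventually_sequentially le_refl)
  let ?a = "c + 1 / real (Suc n)" and ?b = "c + 1 + real (Suc n)"
  have ab: "c < ?a" "?a < ?b"
  proof -
    have "1 / real (Suc n) \<le> 1" by simp
    then show "?a < ?b" using of_nat_0_less_iff[of "Suc n"] by linarith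
  qed simp
  have "smooth_approx ?a ?b (F n)"
    by (rule smooth_approx_sq_integrable[OF Fsq]) (auto simp: F_def)
  then obtain u where u: "smooth u" "\<forall>t. t \<notin> {?a..?b} \<longrightarrow> u t = 0"
    "sq_norm lborel (\<lambda>t. u t - F n t) < e / 4"
    using e by (auto elim!: smooth_approxE[of _ _ _ "e / 4"])
  have "sq_norm lborel (\<lambda>t. (u t - F n t) + (F n t - f t)) < e"
    using sq_integrable_add(2)[OF sq_integrable_diff(1)[OF smooth_compact_support_sq_integrable[OF u(1,2)] Fsq[of n]]
       sq_integrable_diff(1)[OF Fsq[of n] f]] u(3) n by simp
  with that[OF u(1) ab u(2)] show ?thesis by simp
qed

section \<open>Translations and averages of translates\<close>

lemma sq_integrable_shift:
  assumes "sq_integrable lborel f"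
  shows "sq_integrable lborel (\<lambda>t. f (t - a :: real))"
proof -
  have [measurable]: "f \<in> borel_measurable borel" using assms by auto
  have "(\<lambda>t. f (t - a)) \<in> borel_measurable lborel" by measurable
  then show ?thesis
    using lborel_integrable_real_affine[of "\<lambda>t. (cmod (f t))\<^sup>2" 1 "-a"] assms
    by (auto simp: sq_integrable_def)
qed

lemma sq_norm_shift: "sq_norm lborel (\<lambda>t. f (t - a :: real)) = sq_norm lborel f"
  using lborel_integral_real_affine[of 1 "\<lambda>t. (cmod (f t))\<^sup>2" "-a"] by (simp add: sq_norm_def)

text \<open>Continuity of translation in \<open>L\<^sup>2\<close>: evident for a test function by dominated convergence, and
translations are isometries, so it passes to limits.\<close>

lemma sq_norm_shift_tendsto:
  fixes f :: "real \<Rightarrow> complex"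
  assumes f: "sq_integrable lborel f" and supp: "\<And>t. t \<le> 0 \<Longrightarrow> f t = 0"
    and a: "a \<longlonglongrightarrow> 0" "\<And>n. a n \<in> {0..1}"
  shows "(\<lambda>n. sq_norm lborel (\<lambda>t. f (t - a n) - f t)) \<longlonglongrightarrow> 0"
proof (rule LIMSEQ_I)
  fix e :: real assume "e > 0"
  \<comment> \<open>The final estimate is \<open>6 \<parallel>u - f\<parallel>\<^sup>2 + 4 \<parallel>u (\<sqdot> - a\<^sub>n) - u\<parallel>\<^sup>2\<close>, so \<open>e / 24\<close> for each of the two suffices.\<close>
  obtain u p q where u: "smooth u" "0 < p" "p < q" "\<forall>t. t \<notin> {p..q} \<longrightarrow> u t = 0"
    "sq_norm lborel (\<lambda>t. u t - f t) < e / 24"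
    using test_functions_dense[OF f supp, of 0 "e / 24"] \<open>e > 0\<close> by auto
  note usq = smooth_compact_support_sq_integrable[OF u(1,4)]
  obtain B where B: "B \<ge> 0" "\<And>t. cmod (u t) \<le> B"
    using smooth_compact_support_bounded[OF u(1,4)] by blast
  have [measurable]: "u \<in> borel_measurable borel" by (rule smooth_borel[OF u(1)])
  have "(\<lambda>n. sq_norm lborel (\<lambda>t. u (t - a n) - u t)) \<longlonglongrightarrow> 0"
  proof (rule sq_norm_tendsto_0[OF _ integrable_indicator_interval[of "(2 * B)\<^sup>2" p "q + 1"]])
    show "(\<lambda>t. u (t - a n) - u t) \<in> borel_measurable lborel" for n by measurable
    show "AE t in lborel. (\<lambda>n. u (t - a n) - u t) \<longlonglongrightarrow> 0"
    proof (intro AE_I2)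
      fix t
      have "(\<lambda>n. t - a n) \<longlonglongrightarrow> t - 0" by (intro tendsto_intros a)
      then have "(\<lambda>n. u (t - a n)) \<longlonglongrightarrow> u t"
        using continuous_on_tendsto_compose[OF smooth_continuous[OF u(1)], of "\<lambda>n. t - a n" t] by simp
      then show "(\<lambda>n. u (t - a n) - u t) \<longlonglongrightarrow> 0" by (rule LIM_zero)
    qed
    show "AE t in lborel. (cmod (u (t - a n) - u t))\<^sup>2 \<le> (2 * B)\<^sup>2 * indicator {p..q + 1} t" for n
    proof (intro AE_I2)
      fix t
      show "(cmod (u (t - a n) - u t))\<^sup>2 \<le> (2 * B)\<^sup>2 * indicator {p..q + 1} t"
      proof (cases "t \<in> {p..q+1}")
        case True
        have "cmod (u (t - a n) - u t) \<le> 2 * B"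
          using norm_triangle_ineq4[of "u (t - a n)" "u t"] B(2)[of t] B(2)[of "t - a n"] by linarith
        from power_mono[OF this, of 2] True show ?thesis by simp
      next
        case False
        then have "u (t - a n) = 0" "u t = 0" using a(2)[of n] u(4) by auto
        then show ?thesis by simp
      qed
    qed
  qed
  then have "\<forall>\<^sub>F n in sequentially. sq_norm lborel (\<lambda>t. u (t - a n) - u t) < e / 24"
    using \<open>e > 0\<close> by (intro order_tendstoD(2)) auto
  then obtain K where K: "\<And>n. n \<ge> K \<Longrightarrow> sq_norm lborel (\<lambda>t. u (t - a n) - u t) < e / 24"
    by (auto simp: eventually_sequentially)
  have "sq_norm lborel (\<lambda>t. f (t - a n) - f t) < e" if "n \<ge> K" for n
  proof -
    note fu = sq_integrable_diff(1)[OF f usq]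
    have "sq_norm lborel (\<lambda>t. (f (t - a n) - u (t - a n)) + ((u (t - a n) - u t) + (u t - f t)))
       \<le> 2 * sq_norm lborel (\<lambda>t. f (t - a n) - u (t - a n)) +
          2 * sq_norm lborel (\<lambda>t. (u (t - a n) - u t) + (u t - f t))"
      by (intro sq_integrable_add sq_integrable_diff sq_integrable_shift f usq)
    also have "\<dots> \<le> 2 * sq_norm lborel (\<lambda>t. f (t - a n) - u (t - a n)) +
          2 * (2 * sq_norm lborel (\<lambda>t. u (t - a n) - u t) + 2 * sq_norm lborel (\<lambda>t. u t - f t))"
      by (intro add_mono mult_left_mono sq_integrable_add(2) sq_integrable_diff(1) sq_integrable_shift f usq) auto
    also have "\<dots> < e"
      using \<open>e > 0\<close> u(5) K[OF that] sq_norm_shift[of "\<lambda>t. f t - u t" "a n"] sq_norm_minus_commute[of lborel f u]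
      by simp
    finally show ?thesis by simp
  qed
  then show "\<exists>K. \<forall>n\<ge>K. norm (sq_norm lborel (\<lambda>t. f (t - a n) - f t) - 0) < e" by auto
qed

text \<open>The average of the translates by \<open>j, 2 j, \<dots>, j \<cdot> j\<close>. Tying the spacing to the number of
translates makes one parameter suffice: functions concentrated on \<open>(0, j]\<close> have disjoint
translates, and every function is concentrated there in the limit.\<close>

definition shift_avg :: "nat \<Rightarrow> (real \<Rightarrow> complex) \<Rightarrow> real \<Rightarrow> complex" where
  "shift_avg j f t = complex_of_real (1 / real j) * (\<Sum>k=1..j. f (t - real k * real j))"

lemma sq_integrable_shift_avg:
  assumes "sq_integrable lborel f"
  shows "sq_integrable lborel (shift_avg j f)"
  unfolding shift_avg_def by (intro sq_integrable_cmult sq_integrable_sum sq_integrable_shift assms)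

lemma sq_norm_shift_avg:
  "sq_norm lborel (shift_avg j f) = sq_norm lborel (\<lambda>t. \<Sum>k=1..j. f (t - real k * real j)) / (real j)\<^sup>2"
  unfolding shift_avg_def[abs_def] sq_norm_cmult by (simp add: norm_divide power_divide)

text \<open>The pointwise hypothesis holds with \<open>C = card I\<close> in general, and with \<open>C = 1\<close> when the translates
have disjoint supports. These are the two uses below.\<close>

lemma sq_norm_sum_shift_le:
  fixes f :: "real \<Rightarrow> complex"
  assumes f: "sq_integrable lborel f" and
    le: "\<And>t. (cmod (\<Sum>k\<in>I. f (t - x k)))\<^sup>2 \<le> C * (\<Sum>k\<in>I. (cmod (f (t - x k)))\<^sup>2)"
  shows "sq_norm lborel (\<lambda>t. \<Sum>k\<in>I. f (t - x k)) \<le> C * (real (card I) * sq_norm lborel f)"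
proof -
  have sq: "sq_integrable lborel (\<lambda>t. f (t - x k))" for k by (rule sq_integrable_shift[OF f])
  have "sq_norm lborel (\<lambda>t. \<Sum>k\<in>I. f (t - x k)) \<le> (LINT t|lborel. C * (\<Sum>k\<in>I. (cmod (f (t - x k)))\<^sup>2))"
  proof (rule sq_integrable_bound(2))
    show "(\<lambda>t. \<Sum>k\<in>I. f (t - x k)) \<in> borel_measurable lborel"
      by (intro sq_integrableD(1) sq_integrable_sum sq)
    show "integrable lborel (\<lambda>t. C * (\<Sum>k\<in>I. (cmod (f (t - x k)))\<^sup>2))"
      by (intro integrable_mult_right Bochner_Integration.integrable_sum sq_integrableD(2)[OF sq])
  qed (use le in simp)
  also have "\<dots> = C * (\<Sum>k\<in>I. sq_norm lborel (\<lambda>t. f (t - x k)))"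
    using sq by (simp add: sq_norm_def sq_integrable_def)
  also have "\<dots> = C * (real (card I) * sq_norm lborel f)"
    by (simp add: sq_norm_shift)
  finally show ?thesis .
qed

lemma sq_norm_shift_avg_le:
  assumes "sq_integrable lborel f"
  shows "sq_norm lborel (shift_avg j f) \<le> sq_norm lborel f"
proof -
  have "sq_norm lborel (\<lambda>t. \<Sum>k=1..j. f (t - real k * real j)) \<le> real j * (real (card {1..j}) * sq_norm lborel f)"
  proof (rule sq_norm_sum_shift_le[OF assms])
    fix t
    have "(cmod (\<Sum>k=1..j. f (t - real k * real j)))\<^sup>2 \<le> (\<Sum>k=1..j. cmod (f (t - real k * real j)))\<^sup>2"
      by (intro power_mono norm_sum) auto
    also have "\<dots> \<le> real j * (\<Sum>k=1..j. (cmod (f (t - real k * real j)))\<^sup>2)"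
      using sum_squared_le_sum_of_squares[of "\<lambda>k. cmod (f (t - real k * real j))" "{1..j}"]
      by (simp add: mult.commute)
    finally show "(cmod (\<Sum>k=1..j. f (t - real k * real j)))\<^sup>2 \<le>
      real j * (\<Sum>k=1..j. (cmod (f (t - real k * real j)))\<^sup>2)" .
  qed
  then show ?thesis
    by (cases "j = 0") (simp_all add: sq_norm_shift_avg field_simps power2_eq_square)
qed

text \<open>The translates have disjoint supports, hence are orthogonal, and the average of \<open>j\<close> orthogonal
vectors of equal length gains the factor \<open>1 / j\<close>.\<close>

lemma sq_norm_shift_avg_short_support:
  assumes f: "sq_integrable lborel f" and supp: "\<And>t. t \<notin> {0<..real j} \<Longrightarrow> f t = 0" and j: "j > 0"
  shows "sq_norm lborel (shift_avg j f) \<le> sq_norm lborel f / real j"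
proof -
  have "sq_norm lborel (\<lambda>t. \<Sum>k=1..j. f (t - real k * real j)) \<le> 1 * (real (card {1..j}) * sq_norm lborel f)"
  proof (rule sq_norm_sum_shift_le[OF f])
    fix t
    let ?x = "\<lambda>k. f (t - real k * real j)"
    have uniq: "k = l" if kl: "?x k \<noteq> 0" "?x l \<noteq> 0" for k l
    proof -
      have "real k * real j < t" "t \<le> real (Suc k) * real j" "real l * real j < t" "t \<le> real (Suc l) * real j"
        using kl supp[of "t - real k * real j"] supp[of "t - real l * real j"] by (auto simp: algebra_simps) 
      then have "real k * real j < real (Suc l) * real j" "real l * real j < real (Suc k) * real j"
        by linarith+
      then have "real k < real (Suc l)" "real l < real (Suc k)"
        using j by (auto simp only: mult_less_cancel_right)
      then show ?thesis by linarith
    qed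
    show "(cmod (\<Sum>k=1..j. ?x k))\<^sup>2 \<le> 1 * (\<Sum>k=1..j. (cmod (?x k))\<^sup>2)"
    proof (cases "\<exists>l\<in>{1..j}. ?x l \<noteq> 0")
      case True
      then obtain l where l: "l \<in> {1..j}" "?x l \<noteq> 0" by blast
      have "(\<Sum>k=1..j. ?x k) = (\<Sum>k\<in>{l}. ?x k)"
        by (rule sum.mono_neutral_right) (use l uniq in auto)
      then have "(cmod (\<Sum>k=1..j. ?x k))\<^sup>2 = (cmod (?x l))\<^sup>2" by simp
      also have "\<dots> \<le> (\<Sum>k=1..j. (cmod (?x k))\<^sup>2)"
        using l by (intro member_le_sum) auto
      finally show ?thesis by simp
    qed simp
  qed
  then show ?thesis
    using j by (simp add: sq_norm_shift_avg field_simps power2_eq_square)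
qed

lemma shift_avg_diff: "shift_avg j (\<lambda>t. f t - g t) t = shift_avg j f t - shift_avg j g t"
  by (simp add: shift_avg_def sum_subtractf right_diff_distrib)

text \<open>Split \<open>f\<close> at \<open>j\<close>: the average of the head is small by orthogonality, the tail is small itself.\<close>

lemma sq_norm_shift_avg_tendsto:
  assumes f: "sq_integrable lborel f" and supp: "\<And>t. t \<le> 0 \<Longrightarrow> f t = 0"
  shows "(\<lambda>j. sq_norm lborel (shift_avg j f)) \<longlonglongrightarrow> 0"
proof -
  have [measurable]: "f \<in> borel_measurable borel" using f by auto
  have int: "integrable lborel (\<lambda>t. (cmod (f t))\<^sup>2)" using f by auto
  define r where "r = (\<lambda>(j::nat) t. indicator {real j<..} t * f t)"
  have [measurable]: "r j \<in> borel_measurable borel" for j unfolding r_def by measurable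
  have r: "sq_integrable lborel (r j)" for j
    by (rule sq_integrable_bound(1)[OF _ int]) (auto simp: r_def indicator_def)
  have r0: "(\<lambda>j. sq_norm lborel (r j)) \<longlonglongrightarrow> 0"
  proof (rule sq_norm_tendsto_0[OF _ int])
    show "AE t in lborel. (\<lambda>j. r j t) \<longlonglongrightarrow> 0"
    proof (intro AE_I2 tendsto_eventually)
      fix t
      have "\<forall>\<^sub>F j in sequentially. t \<le> real j"
        using filterlim_real_sequentially by (simp add: filterlim_at_top)
      then show "\<forall>\<^sub>F j in sequentially. r j t = 0"
        by eventually_elim (auto simp: r_def)
    qed
  qed (auto simp: r_def indicator_def)
  have le: "sq_norm lborel (shift_avg j f) \<le> 2 * (sq_norm lborel f / real j) + 2 * sq_norm lborel (r j)" if j: "j > 0" for j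
  proof -
    let ?g = "\<lambda>t. f t - r j t"
    have g: "sq_integrable lborel ?g" by (intro sq_integrable_diff f r)
    have "sq_norm lborel ?g \<le> sq_norm lborel f"
      unfolding sq_norm_def[of _ f] by (rule sq_integrable_bound(2)[OF _ int]) (auto simp: r_def indicator_def)
    then have gf: "sq_norm lborel ?g / real j \<le> sq_norm lborel f / real j"
      by (intro divide_right_mono) auto
    have "sq_norm lborel (shift_avg j ?g) \<le> sq_norm lborel ?g / real j"
      by (rule sq_norm_shift_avg_short_support[OF g _ j]) (auto simp: r_def indicator_def supp)
    moreover have "sq_norm lborel (\<lambda>t. shift_avg j ?g t + shift_avg j (r j) t) \<le>
        2 * sq_norm lborel (shift_avg j ?g) + 2 * sq_norm lborel (shift_avg j (r j))"
      by (intro sq_integrable_add(2) sq_integrable_shift_avg g r)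
    moreover have "sq_norm lborel (shift_avg j (r j)) \<le> sq_norm lborel (r j)"
      by (rule sq_norm_shift_avg_le[OF r])
    moreover have "shift_avg j f = (\<lambda>t. shift_avg j ?g t + shift_avg j (r j) t)"
      by (simp add: shift_avg_diff)
    ultimately show ?thesis using gf by simp
  qed
  have lim: "(\<lambda>j. 2 * (sq_norm lborel f / real j) + 2 * sq_norm lborel (r j)) \<longlonglongrightarrow> 2 * 0 + 2 * 0"
    by (intro tendsto_intros r0 lim_const_over_n)
  show ?thesis
    by (rule tendsto_sandwich[OF _ _ tendsto_const])
       (use lim le in \<open>auto intro!: eventually_mono[OF eventually_gt_at_top[of 0]]\<close>)
qed

section \<open>Nonnegative forms\<close>

definition linear_subspace :: "(real \<Rightarrow> complex) set \<Rightarrow> bool" where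
  "linear_subspace D \<longleftrightarrow> (\<lambda>t. 0) \<in> D \<and> (\<forall>f\<in>D. \<forall>g\<in>D. (\<lambda>t. f t + g t) \<in> D) \<and>
     (\<forall>c. \<forall>f\<in>D. (\<lambda>t. c * f t) \<in> D)"

lemma linear_subspaceD:
  assumes "linear_subspace D"
  shows "(\<lambda>t. 0) \<in> D" "f \<in> D \<Longrightarrow> g \<in> D \<Longrightarrow> (\<lambda>t. f t + g t) \<in> D" "f \<in> D \<Longrightarrow> (\<lambda>t. c * f t) \<in> D"
  using assms by (simp_all add: linear_subspace_def)

lemma linear_subspace_diff:
  assumes "linear_subspace D" "f \<in> D" "g \<in> D"
  shows "(\<lambda>t. f t - g t) \<in> D"
  using linear_subspaceD(2)[OF assms(1,2) linear_subspaceD(3)[OF assms(1,3), of "-1"]] by simp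

lemma nonneg_formD:
  assumes "nonneg_form D a"
  shows "D \<subseteq> L2" "linear_subspace D"
    "\<forall>f\<in>D. \<forall>g\<in>D. \<forall>u\<in>D. a (\<lambda>t. f t + g t) u = a f u + a g u"
    "\<forall>c. \<forall>f\<in>D. \<forall>u\<in>D. a (\<lambda>t. c * f t) u = c * a f u"
    "\<forall>f\<in>D. \<forall>g\<in>D. a g f = cnj (a f g)"
    "\<forall>f\<in>D. 0 \<le> Re (a f f)"
    "\<forall>f\<in>D. \<forall>g\<in>D. (AE t in halfline. f t = 0) \<longrightarrow> a f g = 0"
  using assms unfolding nonneg_form_def linear_subspace_def 
  by - ((elim conjE, ((intro conjI)?; assumption))+)

lemma nonneg_form_cong:
  assumes a: "nonneg_form D a" and eq: "\<And>f g. f \<in> D \<Longrightarrow> g \<in> D \<Longrightarrow> b f g = a f g"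
  shows "nonneg_form D b"
  unfolding nonneg_form_def
proof (intro conjI ballI allI impI)
  note D = linear_subspaceD[OF nonneg_formD(2)[OF a]]
  show "D \<subseteq> L2" by (rule nonneg_formD(1)[OF a])
  show "(\<lambda>t. 0) \<in> D" by (rule D(1))
  fix f g assume fg: "f \<in> D" "g \<in> D"
  show sum: "(\<lambda>t. f t + g t) \<in> D" by (rule D(2)[OF fg])
  show mult: "(\<lambda>t. c * f t) \<in> D" for c by (rule D(3)[OF fg(1)])
  show "b (\<lambda>t. f t + g t) u = b f u + b g u" if "u \<in> D" for u
    unfolding eq[OF sum that] eq[OF fg(1) that] eq[OF fg(2) that]
    using nonneg_formD(3)[OF a, rule_format, OF fg that] .
  show "b (\<lambda>t. c * f t) g = c * b f g" for c
    unfolding eq[OF mult fg(2)] eq[OF fg] using nonneg_formD(4)[OF a, rule_format, OF fg] .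
  show "b g f = cnj (b f g)"
    unfolding eq[OF fg] eq[OF fg(2,1)] using nonneg_formD(5)[OF a, rule_format, OF fg] .
  show "0 \<le> Re (b f f)"
    unfolding eq[OF fg(1,1)] using nonneg_formD(6)[OF a, rule_format, OF fg(1)] .
  show "b f g = 0" if "AE t in halfline. f t = 0"
    unfolding eq[OF fg] using nonneg_formD(7)[OF a, rule_format, OF fg that] .
qed

text \<open>By Hermitian symmetry a null function is orthogonal to everything from either side, so the cross
terms vanish.\<close>

lemma nonneg_form_diff_null:
  assumes a: "nonneg_form D a" and f: "f \<in> D" "AE t in halfline. f t = 0" and g: "g \<in> D"
  shows "a (\<lambda>t. g t - f t) (\<lambda>t. g t - f t) = a g g"
proof -
  note D = linear_subspaceD[OF nonneg_formD(2)[OF a]]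
    and add = nonneg_formD(3)[OF a, rule_format] and herm = nonneg_formD(5)[OF a, rule_format]
    and null = nonneg_formD(7)[OF a, rule_format]
  have n: "(\<lambda>t. (-1) * f t) \<in> D" "AE t in halfline. (-1) * f t = 0"
    using D(3)[OF f(1), of "-1"] f(2) by auto
  let ?d = "\<lambda>t. g t + (-1) * f t"
  have d: "?d \<in> D" by (rule D(2)[OF g n(1)])
  have "a ?d u = a g u" if "u \<in> D" for u
    using add[OF g n(1) that] null[OF n(1) that n(2)] by simp
  then have "a ?d ?d = a g g"
    using d g herm[OF g d] herm[OF g g] by simp
  then show ?thesis by simp
qed

section \<open>The Laplace transform on the half-line\<close>

lemma L2_iff: "f \<in> L2 \<longleftrightarrow> sq_integrable halfline f"
  by (simp add: L2_def sq_integrable_def)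

lemma halfline_lborel:
  fixes g :: "real \<Rightarrow> 'b :: {banach, second_countable_topology}"
  assumes "\<forall>t\<le>0. g t = 0"
  shows "integral\<^sup>L halfline g = integral\<^sup>L lborel g"
    and "integrable halfline g \<longleftrightarrow> integrable lborel g"
    and "g \<in> borel_measurable halfline \<longleftrightarrow> g \<in> borel_measurable borel"
proof -
  have "(\<lambda>t. indicator {0<..} t *\<^sub>R g t) = g"
    using assms by (auto simp: indicator_def fun_eq_iff not_less)
  then show "integral\<^sup>L halfline g = integral\<^sup>L lborel g"
    "integrable halfline g \<longleftrightarrow> integrable lborel g"
    "g \<in> borel_measurable halfline \<longleftrightarrow> g \<in> borel_measurable borel"
    by (simp_all add: integral_restrict_space integrable_restrict_space borel_measurable_restrict_space_iff)
qed

lemma sq_integrable_halfline: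
  assumes "\<forall>t\<le>0. f t = 0"
  shows "sq_integrable halfline f \<longleftrightarrow> sq_integrable lborel f" "sq_norm halfline f = sq_norm lborel f"
  using assms halfline_lborel[of f] halfline_lborel[of "\<lambda>t. (cmod (f t))\<^sup>2"]
  by (simp_all add: sq_integrable_def sq_norm_def)

lemma laplace_lborel:
  assumes "\<forall>t\<le>0. f t = 0"
  shows "laplace f l = (LINT t|lborel. complex_of_real (exp (- t * l)) * f t)"
  unfolding laplace_def using assms by (intro halfline_lborel) auto

lemma laplace_cong: "(\<And>t. t > 0 \<Longrightarrow> f t = g t) \<Longrightarrow> laplace f l = laplace g l"
  unfolding laplace_def by (intro Bochner_Integration.integral_cong) (auto simp: space_restrict_space)

lemma sq_norm_halfline_cong: "(\<And>t. t > 0 \<Longrightarrow> f t = g t) \<Longrightarrow> sq_norm halfline f = sq_norm halfline g"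
  unfolding sq_norm_def by (intro Bochner_Integration.integral_cong) (auto simp: space_restrict_space)

lemma sq_integrable_halfline_cong:
  assumes "\<And>t. t > 0 \<Longrightarrow> f t = g t"
  shows "sq_integrable halfline f \<longleftrightarrow> sq_integrable halfline g"
  unfolding sq_integrable_def using assms
  by (intro arg_cong2[of _ _ _ _ conj] measurable_cong Bochner_Integration.integrable_cong)
     (auto simp: space_restrict_space)

lemma borel_measurable_halfline: "f \<in> borel_measurable borel \<Longrightarrow> f \<in> borel_measurable halfline"
  by (intro measurable_restrict_space1) auto

lemma sigma_finite_halfline: "sigma_finite_measure halfline"
  by (rule sigma_finite_measure_restrict_space) (auto simp: lborel.sigma_finite_measure_axioms)

lemma ident_measurable_halfline [measurable]: "(\<lambda>t. t) \<in> borel_measurable halfline"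
  by (rule borel_measurable_halfline) simp

lemma exp_sq_integrable_halfline:
  assumes "l > 0"
  shows "integrable halfline (\<lambda>t. (exp (- t * l))\<^sup>2)" "(LINT t|halfline. (exp (- t * l))\<^sup>2) = 1 / (2 * l)"
proof -
  have nn: "(\<integral>\<^sup>+t. ennreal ((exp (- t * l))\<^sup>2) \<partial>halfline) = ennreal (1 / (2 * l))"
  proof -
    have "(\<integral>\<^sup>+t. ennreal ((exp (- t * l))\<^sup>2) \<partial>halfline) =
        (\<integral>\<^sup>+t. ennreal ((exp (- t * l))\<^sup>2) * indicator {0<..} t \<partial>lborel)"
      by (simp add: nn_integral_restrict_space)
    also have "\<dots> = (\<integral>\<^sup>+t. ennreal (exp (- (2 * l) * t)) * indicator {0..} t \<partial>lborel)"
      by (intro nn_integral_cong_AE eventually_mono[OF AE_lborel_singleton[of 0]])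
         (auto simp: indicator_def simp flip: exp_double intro!: arg_cong[of _ _ exp])
    also have "\<dots> = ennreal (0 - (- exp (- (2 * l) * 0) / (2 * l)))"
    proof (rule nn_integral_FTC_atLeast)
      show "((\<lambda>t. - exp (- (2 * l) * t) / (2 * l)) has_real_derivative exp (- (2 * l) * t)) (at t)" for t
        using assms by (auto intro!: derivative_eq_intros)
      have "LIM t at_top. - (2 * l) * t :> at_bot"
        using assms by (intro filterlim_tendsto_neg_mult_at_bot[OF tendsto_const] filterlim_ident) auto
      from tendsto_divide[OF tendsto_minus[OF filterlim_compose[OF exp_at_bot this]] tendsto_const[of "2 * l"]] assms
      show "((\<lambda>t. - exp (- (2 * l) * t) / (2 * l)) \<longlongrightarrow> 0) at_top" by simp
    qed auto
    finally show ?thesis by simp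
  qed
  have m: "(\<lambda>t. (exp (- t * l))\<^sup>2) \<in> borel_measurable halfline"
    by (rule borel_measurable_halfline) measurable
  show int: "integrable halfline (\<lambda>t. (exp (- t * l))\<^sup>2)"
    by (rule integrableI_bounded[OF m]) (use nn in simp)
  show "(LINT t|halfline. (exp (- t * l))\<^sup>2) = 1 / (2 * l)"
    using nn nn_integral_eq_integral[OF int] assms by (simp add: ennreal_inj)
qed

lemma exp_borel_halfline [measurable]: "(\<lambda>t::real. exp (- t * l)) \<in> borel_measurable halfline"
  by (rule borel_measurable_halfline) measurable

lemma laplace_integrable:
  assumes f: "sq_integrable halfline f" and l: "l > 0"
  shows "integrable halfline (\<lambda>t. complex_of_real (exp (- t * l)) * f t)"
proof (rule Bochner_Integration.integrable_bound[OF schwarz_integral(1)[OF f exp_borel_halfline exp_sq_integrable_halfline(1)[OF l]]])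
  have [measurable]: "f \<in> borel_measurable halfline" using f by auto
  show "(\<lambda>t. complex_of_real (exp (- t * l)) * f t) \<in> borel_measurable halfline" by measurable
qed (auto simp: norm_mult)

lemma laplace_bound:
  assumes f: "sq_integrable halfline f" and l: "l > 0"
  shows "(cmod (laplace f l))\<^sup>2 \<le> sq_norm halfline f / (2 * l)"
proof -
  have "cmod (laplace f l) \<le> (LINT t|halfline. exp (- t * l) * cmod (f t))"
    unfolding laplace_def
    by (rule order_trans[OF integral_norm_bound]) (simp add: norm_mult)
  then have "(cmod (laplace f l))\<^sup>2 \<le> (LINT t|halfline. exp (- t * l) * cmod (f t))\<^sup>2"
    by (intro power_mono) auto
  also have "\<dots> \<le> 1 / (2 * l) * sq_norm halfline f"
    using schwarz_integral(2)[OF f exp_borel_halfline exp_sq_integrable_halfline(1)[OF l]] exp_sq_integrable_halfline(2)[OF l] by simp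
  finally show ?thesis by simp
qed

lemma laplace_add:
  assumes "sq_integrable halfline f" "sq_integrable halfline g" "l > 0"
  shows "laplace (\<lambda>t. f t + g t) l = laplace f l + laplace g l"
  unfolding laplace_def using laplace_integrable[OF assms(1,3)] laplace_integrable[OF assms(2,3)]
  by (simp add: distrib_left)

lemma laplace_cmult: "laplace (\<lambda>t. c * f t) l = c * laplace f l"
  unfolding laplace_def by (simp add: mult.left_commute[of _ c])

lemma laplace_diff:
  assumes "sq_integrable halfline f" "sq_integrable halfline g" "l > 0"
  shows "laplace (\<lambda>t. f t - g t) l = laplace f l - laplace g l"
  using laplace_add[OF assms(1) sq_integrable_cmult[OF assms(2), of "-1"] assms(3)] laplace_cmult[of "-1" g l]
  by simp

lemma laplace_sum:
  assumes "\<And>i. i \<in> I \<Longrightarrow> sq_integrable halfline (f i)" "l > 0"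
  shows "laplace (\<lambda>t. \<Sum>i\<in>I. f i t) l = (\<Sum>i\<in>I. laplace (f i) l)"
  using assms(1)
proof (induction I rule: infinite_finite_induct)
  case (insert x F)
  then show ?case
    using laplace_add[OF insert.prems[of x] sq_integrable_sum[of F halfline f] assms(2)] by simp
qed (simp_all add: laplace_def)

lemma laplace_shift:
  assumes supp: "\<forall>t\<le>0. f t = 0" and a: "a \<ge> 0"
  shows "laplace (\<lambda>t. f (t - a)) l = complex_of_real (exp (- a * l)) * laplace f l"
proof -
  have "laplace (\<lambda>t. f (t - a)) l = (LINT t|lborel. complex_of_real (exp (- t * l)) * f (t - a))"
    using supp a by (intro laplace_lborel) auto
  also have "\<dots> = (LINT t|lborel. complex_of_real (exp (- (t + a) * l)) * f t)"
    using lborel_integral_real_affine[of 1 "\<lambda>t. complex_of_real (exp (- t * l)) * f (t - a)" a]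
    by (simp add: add.commute)
  also have "\<dots> = (LINT t|lborel. complex_of_real (exp (- a * l)) * (complex_of_real (exp (- t * l)) * f t))"
    by (intro Bochner_Integration.integral_cong)
       (simp_all add: distrib_right exp_diff exp_add field_simps exp_minus)
  also have "\<dots> = complex_of_real (exp (- a * l)) * laplace f l"
    by (simp add: laplace_lborel[OF supp])
  finally show ?thesis .
qed

text \<open>A function that vanishes up to \<open>e\<close> is a translate by \<open>e\<close>, so its transform carries a factor
\<open>exp (- e l)\<close>.\<close>

lemma laplace_bound_supp:
  assumes f: "sq_integrable halfline f" and e: "e \<ge> 0" and supp: "\<forall>t\<le>e. f t = 0" and l: "l > 0"
  shows "(cmod (laplace f l))\<^sup>2 \<le> exp (- (2 * e) * l) * (sq_norm halfline f / (2 * l))"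
proof -
  \<comment> \<open>Written as a translation by \<open>- e\<close> in order to match the lemmas on translates.\<close>
  define g where "g = (\<lambda>t. f (t - (- e)))"
  have f0: "\<forall>t\<le>0. f t = 0" using supp e by auto
  have g0: "\<forall>t\<le>0. g t = 0" using supp by (auto simp: g_def)
  have fl: "sq_integrable lborel f" using f sq_integrable_halfline[OF f0] by simp
  have g: "sq_integrable halfline g"
    using sq_integrable_shift[OF fl, of "- e"] sq_integrable_halfline[OF g0] by (simp add: g_def)
  have gn: "sq_norm halfline g = sq_norm halfline f"
    using sq_norm_shift[of f "-e"] sq_integrable_halfline(2)[OF g0] sq_integrable_halfline(2)[OF f0]
    by (simp add: g_def)
  have "laplace f l = complex_of_real (exp (- e * l)) * laplace g l"
    using laplace_shift[OF g0 e, of l] by (simp add: g_def)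
  then have "(cmod (laplace f l))\<^sup>2 = (exp (- e * l))\<^sup>2 * (cmod (laplace g l))\<^sup>2"
    by (simp add: norm_mult power_mult_distrib)
  also have "(exp (- e * l))\<^sup>2 = exp (- (2 * e) * l)" by (simp flip: exp_double)
  also have "\<dots> * (cmod (laplace g l))\<^sup>2 \<le> \<dots> * (sq_norm halfline f / (2 * l))"
    using laplace_bound[OF g l] by (intro mult_left_mono) (auto simp: gn)
  finally show ?thesis .
qed

text \<open>The multiplier by which \<open>shift_avg j\<close> acts on Laplace transforms.\<close>

definition avg_symbol :: "nat \<Rightarrow> real \<Rightarrow> real" where
  "avg_symbol j l = (1 / real j) * (\<Sum>k=1..j. exp (- (real k * real j) * l))"

lemma laplace_shift_avg:
  assumes f: "sq_integrable halfline f" and supp: "\<forall>t\<le>0. f t = 0" and l: "l > 0"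
  shows "laplace (shift_avg j f) l = complex_of_real (avg_symbol j l) * laplace f l"
proof -
  have fl: "sq_integrable lborel f" using f sq_integrable_halfline[OF supp] by simp
  have sq: "sq_integrable halfline (\<lambda>t. f (t - real k * real j))" for k
  proof -
    have "0 \<le> real k * real j" by simp
    then have "\<forall>t\<le>0. f (t - real k * real j) = 0" using supp by (smt (verit))
    then show ?thesis by (subst sq_integrable_halfline(1)) (simp_all add: sq_integrable_shift[OF fl])
  qed
  have "laplace (shift_avg j f) l = complex_of_real (1 / real j) * (\<Sum>k=1..j. laplace (\<lambda>t. f (t - real k * real j)) l)"
    unfolding shift_avg_def[abs_def] laplace_cmult by (subst laplace_sum[OF sq l]) simp
  also have "\<dots> = complex_of_real (avg_symbol j l) * laplace f l"
  proof -
    have "laplace (\<lambda>t. f (t - real k * real j)) l =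
        complex_of_real (exp (- (real k * real j) * l)) * laplace f l" for k
      by (rule laplace_shift[OF supp]) simp
    then show ?thesis
      by (simp only: avg_symbol_def sum_distrib_right of_real_mult of_real_sum mult.assoc)
  qed
  finally show ?thesis .
qed

text \<open>The last bound expresses that \<open>1 - avg_symbol j\<close> has a zero at the origin; it comes from
\<open>1 - exp (- x) \<le> x\<close>, as no translation exceeds \<open>j\<^sup>2\<close>.\<close>

lemma avg_symbol_bounds:
  assumes "l \<ge> 0" "j > 0"
  shows "0 \<le> avg_symbol j l" "avg_symbol j l \<le> exp (- l * real j)" "1 - avg_symbol j l \<le> (real j)\<^sup>2 * l"
proof -
  show "0 \<le> avg_symbol j l" unfolding avg_symbol_def by (intro mult_nonneg_nonneg sum_nonneg) auto
  have "(\<Sum>k=1..j. exp (- (real k * real j) * l)) \<le> (\<Sum>k=1..j. exp (- l * real j))"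
  proof (intro sum_mono)
    fix k assume "k \<in> {1..j}"
    then have "1 * (real j * l) \<le> real k * (real j * l)" using assms by (intro mult_right_mono) auto
    then show "exp (- (real k * real j) * l) \<le> exp (- l * real j)" by (simp add: algebra_simps)
  qed
  then show "avg_symbol j l \<le> exp (- l * real j)"
    using assms by (simp add: avg_symbol_def field_simps)
  have "(\<Sum>k=1..j. 1 - (real j)\<^sup>2 * l) \<le> (\<Sum>k=1..j. exp (- (real k * real j) * l))"
  proof (intro sum_mono)
    fix k assume "k \<in> {1..j}"
    then have "real k * (real j * l) \<le> real j * (real j * l)" using assms by (intro mult_right_mono) auto
    moreover have "1 + (- (real k * real j) * l) \<le> exp (- (real k * real j) * l)" by (rule exp_ge_add_one_self)
    ultimately show "1 - (real j)\<^sup>2 * l \<le> exp (- (real k * real j) * l)"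
      by (simp add: algebra_simps power2_eq_square)
  qed
  then have "real j * (1 - (real j)\<^sup>2 * l) \<le> real j * avg_symbol j l"
    using assms by (simp add: avg_symbol_def)
  then show "1 - avg_symbol j l \<le> (real j)\<^sup>2 * l"
    using assms by (simp add: mult_le_cancel_left)
qed

lemma laplace_measurable:
  assumes "f \<in> borel_measurable halfline"
  shows "laplace f \<in> borel_measurable borel"
proof -
  interpret sigma_finite_measure halfline by (rule sigma_finite_halfline)
  note [measurable] = assms
  have "(\<lambda>l. LINT t|halfline. complex_of_real (exp (- t * l)) * f t) \<in> borel_measurable borel"
    by (rule borel_measurable_lebesgue_integral) measurable
  then show ?thesis by (simp add: laplace_def[abs_def])
qed

section \<open>Test functions and compactly supported functions\<close>

lemma compact_subset_halfline:
  assumes "compact K" "K \<subseteq> {0<..}"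
  obtains a b :: real where "0 < a" "a < b" "K \<subseteq> {a..b}"
proof (cases "K = {}")
  case True
  then show ?thesis by (intro that[of 1 2]) auto
next
  case False
  from compact_attains_inf[OF assms(1) this] obtain p where p: "p \<in> K" "\<And>t. t \<in> K \<Longrightarrow> p \<le> t" by blast
  from compact_attains_sup[OF assms(1) False] obtain q where q: "q \<in> K" "\<And>t. t \<in> K \<Longrightarrow> t \<le> q" by blast
  show ?thesis
    by (rule that[of p "q + 1"]) (use p q assms(2) in \<open>fastforce+\<close>)
qed

lemma C0_infinity_iff:
  "f \<in> C0_infinity \<longleftrightarrow> smooth f \<and> (\<exists>a b. 0 < a \<and> a < b \<and> (\<forall>t. t \<notin> {a..b} \<longrightarrow> f t = 0))"
proof -
  have "(\<exists>K. compact K \<and> K \<subseteq> {0<..} \<and> (\<forall>t. t \<notin> K \<longrightarrow> f t = 0)) \<longleftrightarrow>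
      (\<exists>a b. 0 < a \<and> a < b \<and> (\<forall>t. t \<notin> {a..b} \<longrightarrow> f t = 0))" (is "?L \<longleftrightarrow> ?R")
  proof
    assume ?L
    then obtain K where K: "compact K" "K \<subseteq> {0<..}" "\<forall>t. t \<notin> K \<longrightarrow> f t = 0" by blast
    obtain a b where "0 < a" "a < b" "K \<subseteq> {a..b}" using compact_subset_halfline[OF K(1,2)] by blast
    with K(3) show ?R by (intro exI[of _ a] exI[of _ b]) auto
  next
    assume ?R
    then obtain a b where "0 < a" "a < b" "\<forall>t. t \<notin> {a..b} \<longrightarrow> f t = 0" by blast
    then show ?L by (intro exI[of _ "{a..b}"]) auto
  qed
  then show ?thesis unfolding C0_infinity_def smooth_def by simp
qed

lemma L2_compact_support_iff:
  "f \<in> L2_compact_support \<longleftrightarrow> sq_integrable halfline f \<and>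
     (\<exists>a b. 0 < a \<and> a < b \<and> (AE t in halfline. t \<notin> {a..b} \<longrightarrow> f t = 0))"
proof -
  have "(\<exists>K. compact K \<and> K \<subseteq> {0<..} \<and> (AE t in halfline. t \<notin> K \<longrightarrow> f t = 0)) \<longleftrightarrow>
      (\<exists>a b. 0 < a \<and> a < b \<and> (AE t in halfline. t \<notin> {a..b} \<longrightarrow> f t = 0))" (is "?L \<longleftrightarrow> ?R")
  proof
    assume ?L
    then obtain K where K: "compact K" "K \<subseteq> {0<..}" "AE t in halfline. t \<notin> K \<longrightarrow> f t = 0" by blast
    obtain a b where ab: "0 < a" "a < b" "K \<subseteq> {a..b}" using compact_subset_halfline[OF K(1,2)] by blast
    have "AE t in halfline. t \<notin> {a..b} \<longrightarrow> f t = 0"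
      using K(3) by eventually_elim (use ab in auto)
    with ab show ?R by blast
  next
    assume ?R
    then obtain a b where "0 < a" "a < b" "AE t in halfline. t \<notin> {a..b} \<longrightarrow> f t = 0" by blast
    then show ?L by (intro exI[of _ "{a..b}"]) auto
  qed
  then show ?thesis unfolding L2_compact_support_def L2_iff[symmetric] by simp
qed

lemma C0_infinity_sq_integrable: "f \<in> C0_infinity \<Longrightarrow> sq_integrable halfline f"
proof -
  assume "f \<in> C0_infinity"
  then obtain a b where f: "smooth f" "0 < a" "a < b" "\<forall>t. t \<notin> {a..b} \<longrightarrow> f t = 0"
    by (auto simp: C0_infinity_iff)
  have f0: "\<forall>t\<le>0. f t = 0" using f by auto
  show ?thesis
    using smooth_compact_support_sq_integrable[OF f(1,4)] sq_integrable_halfline(1)[OF f0] by simp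
qed

lemma C0_infinity_subset: "C0_infinity \<subseteq> L2_compact_support"
proof
  fix f assume f: "f \<in> C0_infinity"
  then obtain a b where "0 < a" "a < b" "\<forall>t. t \<notin> {a..b} \<longrightarrow> f t = 0"
    by (auto simp: C0_infinity_iff)
  with C0_infinity_sq_integrable[OF f] show "f \<in> L2_compact_support"
    unfolding L2_compact_support_iff by (intro conjI exI[of _ a] exI[of _ b]) auto
qed

lemma linear_subspace_C0_infinity: "linear_subspace C0_infinity"
  unfolding linear_subspace_def
proof (intro conjI ballI allI)
  show "(\<lambda>t. 0) \<in> C0_infinity"
    unfolding C0_infinity_iff by (intro conjI smooth_zero exI[of _ 1] exI[of _ 2]) auto
  fix f assume "f \<in> C0_infinity"
  then obtain a b where f: "smooth f" "0 < a" "a < b" "\<forall>t. t \<notin> {a..b} \<longrightarrow> f t = 0"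
    by (auto simp: C0_infinity_iff)
  show "(\<lambda>t. c * f t) \<in> C0_infinity" for c
    unfolding C0_infinity_iff using f by (intro conjI smooth_cmult exI[of _ a] exI[of _ b]) auto
  fix g assume "g \<in> C0_infinity"
  then obtain a' b' where g: "smooth g" "0 < a'" "a' < b'" "\<forall>t. t \<notin> {a'..b'} \<longrightarrow> g t = 0"
    by (auto simp: C0_infinity_iff)
  have "f t + g t = 0" if "t \<notin> {min a a'..max b b'}" for t
    using that f(4)[rule_format, of t] g(4)[rule_format, of t] by (auto simp: min_le_iff_disj le_max_iff_disj)
  moreover have "0 < min a a'" "min a a' < max b b'" using f g by auto
  ultimately have "\<exists>a b. 0 < a \<and> a < b \<and> (\<forall>t. t \<notin> {a..b} \<longrightarrow> f t + g t = 0)"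
    by blast
  then show "(\<lambda>t. f t + g t) \<in> C0_infinity"
    unfolding C0_infinity_iff using smooth_add[OF f(1) g(1)] by blast
qed

lemma linear_subspace_L2_compact_support: "linear_subspace L2_compact_support"
  unfolding linear_subspace_def
proof (intro conjI ballI allI)
  show "(\<lambda>t. 0) \<in> L2_compact_support"
    unfolding L2_compact_support_iff by (intro conjI sq_integrable_zero exI[of _ 1] exI[of _ 2]) auto
  fix f assume "f \<in> L2_compact_support"
  then obtain a b where f: "sq_integrable halfline f" "0 < a" "a < b"
    "AE t in halfline. t \<notin> {a..b} \<longrightarrow> f t = 0"
    by (auto simp: L2_compact_support_iff)
  show "(\<lambda>t. c * f t) \<in> L2_compact_support" for c
    unfolding L2_compact_support_iff using f
    by (intro conjI sq_integrable_cmult exI[of _ a] exI[of _ b]) auto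
  fix g assume "g \<in> L2_compact_support"
  then obtain a' b' where g: "sq_integrable halfline g" "0 < a'" "a' < b'"
    "AE t in halfline. t \<notin> {a'..b'} \<longrightarrow> g t = 0"
    by (auto simp: L2_compact_support_iff)
  have "AE t in halfline. t \<notin> {min a a'..max b b'} \<longrightarrow> f t + g t = 0"
    using f(4) g(4) by eventually_elim auto
  then show "(\<lambda>t. f t + g t) \<in> L2_compact_support"
    unfolding L2_compact_support_iff using f g
    by (intro conjI sq_integrable_add exI[of _ "min a a'"] exI[of _ "max b b'"]) auto
qed

lemma C0_infinity_shift:
  assumes "f \<in> C0_infinity" "s \<ge> 0"
  shows "(\<lambda>t. f (t - s)) \<in> C0_infinity"
proof -
  obtain a b where f: "smooth f" "0 < a" "a < b" "\<forall>t. t \<notin> {a..b} \<longrightarrow> f t = 0"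
    using assms(1) by (auto simp: C0_infinity_iff)
  have "smooth (\<lambda>t. f (t - s))" using smooth_affine[OF f(1), of 1 "-s"] by simp
  then show ?thesis
    unfolding C0_infinity_iff using f assms(2)
    by (intro conjI exI[of _ "a + s"] exI[of _ "b + s"]) auto
qed

lemma C0_infinity_shift_avg:
  assumes "f \<in> C0_infinity"
  shows "shift_avg j f \<in> C0_infinity"
proof -
  have sum: "(\<lambda>t. \<Sum>k\<in>I. f (t - real k * real j)) \<in> C0_infinity" if "finite I" for I
    using that
  proof (induction I)
    case empty
    then show ?case using linear_subspace_C0_infinity by (simp add: linear_subspace_def)
  next
    case (insert k I)
    then show ?case using linear_subspace_C0_infinity C0_infinity_shift[OF assms, of "real k * real j"]
      by (simp add: linear_subspace_def)
  qed
  show ?thesis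
    unfolding shift_avg_def[abs_def]
    by (intro linear_subspaceD(3)[OF linear_subspace_C0_infinity] sum) simp
qed

text \<open>Support in \<open>[a, b]\<close> with \<open>0 < a\<close> supplies all that is used about compactly supported functions:
integrability of \<open>f\<close> because \<open>b < \<infinity>\<close>, and exponential decay of the transform because \<open>a > 0\<close>.\<close>

lemma laplace_compact_support:
  assumes "f \<in> L2_compact_support"
  obtains a C where "a > 0" "C \<ge> 0" "integrable halfline f"
    "\<And>l. l \<ge> 0 \<Longrightarrow> integrable halfline (\<lambda>t. complex_of_real (exp (- t * l)) * f t)"
    "\<And>l. l \<ge> 0 \<Longrightarrow> cmod (laplace f l) \<le> exp (- a * l) * C"
    "AE t in halfline. t < a \<longrightarrow> f t = 0"
proof -
  obtain a b where f: "sq_integrable halfline f" "0 < a" "a < b"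
    "AE t in halfline. t \<notin> {a..b} \<longrightarrow> f t = 0"
    using assms by (auto simp: L2_compact_support_iff)
  have [measurable]: "f \<in> borel_measurable halfline" using f(1) by auto
  \<comment> \<open>On the support \<open>1 \<le> exp (b - t)\<close>, so \<open>\<bar>f\<bar>\<close> is dominated by the integrand of the transform at \<open>1\<close>.\<close>
  have i1: "integrable halfline (\<lambda>t. exp b * cmod (complex_of_real (exp (- t * 1)) * f t))"
    using laplace_integrable[OF f(1), of 1] by (intro integrable_mult_right integrable_norm) auto
  have int: "integrable halfline f"
  proof (rule Bochner_Integration.integrable_bound[OF i1])
    show "AE t in halfline. norm (f t) \<le> norm (exp b * cmod (complex_of_real (exp (- t * 1)) * f t))"
      using f(4)
    proof eventually_elim
      fix t assume t: "t \<notin> {a..b} \<longrightarrow> f t = 0"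
      show "norm (f t) \<le> norm (exp b * cmod (complex_of_real (exp (- t * 1)) * f t))"
      proof (cases "t \<in> {a..b}")
        case True
        then have "1 * cmod (f t) \<le> exp (b - t) * cmod (f t)" by (intro mult_right_mono) auto
        then show ?thesis by (simp add: norm_mult mult.assoc[symmetric] flip: exp_add)
      qed (use t in simp)
    qed
  qed simp
  have bound: "AE t in halfline. cmod (complex_of_real (exp (- t * l)) * f t) \<le> exp (- a * l) * cmod (f t)"
    if "l \<ge> 0" for l
    using f(4)
  proof eventually_elim
    fix t assume t: "t \<notin> {a..b} \<longrightarrow> f t = 0"
    show "cmod (complex_of_real (exp (- t * l)) * f t) \<le> exp (- a * l) * cmod (f t)"
    proof (cases "t \<in> {a..b}")
      case True
      with that have "a * l \<le> t * l" by (intro mult_right_mono) auto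
      then show ?thesis by (auto simp: norm_mult intro!: mult_right_mono)
    qed (use t in simp)
  qed
  have intl: "integrable halfline (\<lambda>t. complex_of_real (exp (- t * l)) * f t)" if "l \<ge> 0" for l
  proof (rule Bochner_Integration.integrable_bound[of _ "\<lambda>t. exp (- a * l) * cmod (f t)"])
    show "(\<lambda>t. complex_of_real (exp (- t * l)) * f t) \<in> borel_measurable halfline" by measurable
  qed (use int bound[OF that] in auto)
  show ?thesis
  proof (rule that[OF f(2) _ int intl])
    show "0 \<le> (LINT t|halfline. cmod (f t))" by simp
    show "AE t in halfline. t < a \<longrightarrow> f t = 0" using f(4) by eventually_elim auto
    fix l :: real assume l: "l \<ge> 0"
    have "cmod (laplace f l) \<le> (LINT t|halfline. exp (- a * l) * cmod (f t))"
      unfolding laplace_def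
      using int bound[OF l] integrable_norm[OF intl[OF l]]
      by (intro order_trans[OF integral_norm_bound] integral_mono_AE) auto
    then show "cmod (laplace f l) \<le> exp (- a * l) * (LINT t|halfline. cmod (f t))" by simp
  qed
qed

section \<open>Forms given by a Laplace weight\<close>

text \<open>The measures for which the Hankel kernel \<open>h\<close> is finite at every \<open>t > 0\<close>.\<close>

locale laplace_weight =
  fixes M :: "real measure"
  assumes sets_M: "sets M = sets (restrict_space borel {0..})"
    and finite_on_compact: "\<And>K. compact K \<Longrightarrow> K \<subseteq> {0..} \<Longrightarrow> emeasure M K < \<infinity>"
    and exp_integrable: "\<And>t. t > 0 \<Longrightarrow> integrable M (\<lambda>l. exp (- t * l))"
begin

lemma space_M: "space M = {0..}"
  using sets_eq_imp_space_eq[OF sets_M] by (simp add: space_restrict_space)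

lemma borel_measurable_M: "f \<in> borel_measurable borel \<Longrightarrow> f \<in> borel_measurable M"
  using measurable_cong_sets[OF sets_M refl] measurable_restrict_space1 by blast

lemma sets_M_I: "A \<in> sets borel \<Longrightarrow> A \<subseteq> {0..} \<Longrightarrow> A \<in> sets M"
  by (simp add: sets_M sets_restrict_space_iff)

sublocale sigma_finite_measure M
proof
  show "\<exists>A. countable A \<and> A \<subseteq> sets M \<and> \<Union> A = space M \<and> (\<forall>a\<in>A. emeasure M a \<noteq> \<infinity>)"
  proof (intro exI[of _ "range (\<lambda>n::nat. {0..real n})"] conjI)
    show "\<Union> (range (\<lambda>n::nat. {0..real n})) = space M"
      using real_arch_simple by (auto simp: space_M)
    show "\<forall>a\<in>range (\<lambda>n::nat. {0..real n}). emeasure M a \<noteq> \<infinity>"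
      using finite_on_compact by (auto simp: less_top)
  qed (auto intro: sets_M_I)
qed

lemma laplace_domain_iff:
  "f \<in> laplace_domain M \<longleftrightarrow> sq_integrable halfline f \<and> sq_integrable M (laplace f)"
  unfolding laplace_domain_def L2_iff
  using borel_measurable_M laplace_measurable by (auto simp: sq_integrable_def)

lemma laplace_form_self: "laplace_form M f f = complex_of_real (sq_norm M (laplace f))"
proof -
  have "laplace_form M f f = (LINT l|M. complex_of_real ((cmod (laplace f l))\<^sup>2))"
    unfolding laplace_form_def by (intro Bochner_Integration.integral_cong) (simp_all only: complex_norm_square)
  also have "\<dots> = complex_of_real (sq_norm M (laplace f))"
    unfolding sq_norm_def by (rule integral_complex_of_real)
  finally show ?thesis .
qed

lemma form_norm_laplace_form:
  "form_norm (laplace_form M) f = sqrt (sq_norm M (laplace f) + sq_norm halfline f)"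
  by (simp add: form_norm_def laplace_form_self sq_norm_def[of halfline])

lemma laplace_null:
  assumes "f \<in> borel_measurable halfline" "AE t in halfline. f t = 0"
  shows "laplace f l = 0"
proof -
  have [measurable]: "f \<in> borel_measurable halfline" by fact
  have "laplace f l = (LINT t|halfline. 0)"
    unfolding laplace_def
  proof (rule integral_cong_AE)
    show "(\<lambda>t. complex_of_real (exp (- t * l)) * f t) \<in> borel_measurable halfline" by measurable
  qed (use assms(2) in auto)
  then show ?thesis by simp
qed

text \<open>Requiring convergence of the Laplace integrals at almost every point covers the maximal domain,
where it may fail at \<open>l = 0\<close> but \<open>M\<close> has no atom there, as well as compactly supported
functions, where it holds for all \<open>l\<close> and \<open>M\<close> may have an atom.\<close>

lemma nonneg_form_laplace_form:
  assumes D: "linear_subspace D" "D \<subseteq> laplace_domain M"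
    and ae: "\<And>f. f \<in> D \<Longrightarrow> AE l in M. integrable halfline (\<lambda>t. complex_of_real (exp (- t * l)) * f t)"
  shows "nonneg_form D (laplace_form M)"
  unfolding nonneg_form_def
proof (intro conjI ballI allI impI)
  show "D \<subseteq> L2" using D(2) by (auto simp: L2_iff laplace_domain_iff)
  show "(\<lambda>t. 0) \<in> D" "\<And>f g. f \<in> D \<Longrightarrow> g \<in> D \<Longrightarrow> (\<lambda>t. f t + g t) \<in> D" "\<And>c f. f \<in> D \<Longrightarrow> (\<lambda>t. c * f t) \<in> D"
    using linear_subspaceD[OF D(1)] by auto
  have sq: "sq_integrable halfline f" "sq_integrable M (laplace f)" if "f \<in> D" for f
    using that D(2) by (auto simp: laplace_domain_iff)
  fix f g u assume fgu: "f \<in> D" "g \<in> D" "u \<in> D"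
  have [measurable]: "laplace f \<in> borel_measurable M" "laplace g \<in> borel_measurable M"
    "laplace u \<in> borel_measurable M" "laplace (\<lambda>t. f t + g t) \<in> borel_measurable M"
    using sq(2) fgu linear_subspaceD(2)[OF D(1) fgu(1,2)] by (auto simp: sq_integrable_def)
  have "laplace_form M (\<lambda>t. f t + g t) u =
      (LINT l|M. laplace f l * cnj (laplace u l) + laplace g l * cnj (laplace u l))"
    unfolding laplace_form_def
  proof (rule integral_cong_AE)
    show "AE l in M. laplace (\<lambda>t. f t + g t) l * cnj (laplace u l) =
        laplace f l * cnj (laplace u l) + laplace g l * cnj (laplace u l)"
      using ae[OF fgu(1)] ae[OF fgu(2)]
    proof eventually_elim
      fix l assume "integrable halfline (\<lambda>t. complex_of_real (exp (- t * l)) * f t)"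
        "integrable halfline (\<lambda>t. complex_of_real (exp (- t * l)) * g t)"
      then have "laplace (\<lambda>t. f t + g t) l = laplace f l + laplace g l"
        unfolding laplace_def by (simp add: distrib_left)
      then show "laplace (\<lambda>t. f t + g t) l * cnj (laplace u l) =
        laplace f l * cnj (laplace u l) + laplace g l * cnj (laplace u l)"
        by (simp add: distrib_right)
    qed
  qed measurable
  then show "laplace_form M (\<lambda>t. f t + g t) u = laplace_form M f u + laplace_form M g u"
    using sq_integrable_mult_cnj[OF sq(2) sq(2), OF fgu(1,3)]
      sq_integrable_mult_cnj[OF sq(2) sq(2), OF fgu(2,3)]
    by (simp add: laplace_form_def)
next
  fix c f u assume "f \<in> D" "u \<in> D"
  show "laplace_form M (\<lambda>t. c * f t) u = c * laplace_form M f u"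
    by (simp add: laplace_form_def laplace_cmult mult.assoc)
next
  fix f g assume "f \<in> D" "g \<in> D"
  show "laplace_form M g f = cnj (laplace_form M f g)"
    unfolding laplace_form_def by (subst Bochner_Integration.integral_cnj[symmetric]) (simp add: mult.commute)
next
  fix f assume "f \<in> D"
  show "0 \<le> Re (laplace_form M f f)" by (simp add: laplace_form_self)
next
  fix f g assume "f \<in> D" "g \<in> D" "AE t in halfline. f t = 0"
  then have "laplace f l = 0" for l
    using D(2) laplace_domain_iff by (intro laplace_null) blast+
  then show "laplace_form M f g = 0" by (simp add: laplace_form_def)
qed

lemma AE_pos:
  assumes "emeasure M {0} = 0"
  shows "AE l in M. l > 0"
proof (rule AE_I[OF _ assms])
  show "{l \<in> space M. \<not> 0 < l} \<subseteq> {0}" by (auto simp: space_M)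
qed (auto intro: sets_M_I)

lemma laplace_domain_add:
  assumes M0: "emeasure M {0} = 0" and f: "f \<in> laplace_domain M" and g: "g \<in> laplace_domain M"
  shows "(\<lambda>t. f t + g t) \<in> laplace_domain M"
    "sq_norm M (laplace (\<lambda>t. f t + g t)) \<le> 2 * sq_norm M (laplace f) + 2 * sq_norm M (laplace g)"
proof -
  have fg: "sq_integrable halfline f" "sq_integrable halfline g" "sq_integrable M (laplace f)" "sq_integrable M (laplace g)"
    using f g by (auto simp: laplace_domain_iff)
  have sum: "sq_integrable halfline (\<lambda>t. f t + g t)" by (intro sq_integrable_add fg)
  have meas: "laplace (\<lambda>t. f t + g t) \<in> borel_measurable M"
    using sum by (intro borel_measurable_M laplace_measurable) auto
  have eq: "AE l in M. laplace f l + laplace g l = laplace (\<lambda>t. f t + g t) l"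
    using AE_pos[OF M0] by eventually_elim (simp add: laplace_add[OF fg(1,2)])
  note sumM = sq_integrable_add[OF fg(3,4)]
  show "(\<lambda>t. f t + g t) \<in> laplace_domain M"
    using sum sq_integrable_cong_AE[OF sumM(1) meas eq] by (simp add: laplace_domain_iff)
  show "sq_norm M (laplace (\<lambda>t. f t + g t)) \<le> 2 * sq_norm M (laplace f) + 2 * sq_norm M (laplace g)"
    using sumM(2) sq_norm_cong_AE[OF sq_integrableD(1)[OF sumM(1)] meas eq] by simp
qed

lemma linear_subspace_laplace_domain:
  assumes "emeasure M {0} = 0"
  shows "linear_subspace (laplace_domain M)"
  unfolding linear_subspace_def
proof (intro conjI ballI allI)
  show "(\<lambda>t. 0) \<in> laplace_domain M"
    by (auto simp: laplace_domain_iff laplace_def[abs_def])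
  show "(\<lambda>t. f t + g t) \<in> laplace_domain M" if "f \<in> laplace_domain M" "g \<in> laplace_domain M" for f g
    by (rule laplace_domain_add[OF assms that])
  show "(\<lambda>t. c * f t) \<in> laplace_domain M" if "f \<in> laplace_domain M" for c f
    using that sq_integrable_cmult[of M "laplace f" c] sq_integrable_cmult[of halfline f c]
    by (simp add: laplace_domain_iff laplace_cmult[abs_def])
qed

text \<open>The limit \<open>f\<close> of a Cauchy sequence exists in \<open>L\<^sup>2\<close>, and \<open>L u\<^sub>m \<rightarrow> L f\<close> pointwise on \<open>l > 0\<close>, hence
almost everywhere for \<open>M\<close>. Applying Fatou's lemma in \<open>m\<close> to \<open>L u\<^sub>m - L u\<^sub>n\<close> gives both
\<open>L f \<in> L\<^sup>2(M)\<close> and the convergence there.\<close>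

lemma closed_form_laplace_form:
  assumes M0: "emeasure M {0} = 0"
  shows "closed_form (laplace_domain M) (laplace_form M)"
  unfolding closed_form_def
proof (intro conjI allI impI)
  note sub = linear_subspace_laplace_domain[OF M0]
  show "nonneg_form (laplace_domain M) (laplace_form M)"
  proof (rule nonneg_form_laplace_form[OF sub order_refl])
    fix f assume "f \<in> laplace_domain M"
    then have f: "sq_integrable halfline f" by (simp add: laplace_domain_iff)
    show "AE l in M. integrable halfline (\<lambda>t. complex_of_real (exp (- t * l)) * f t)"
      using AE_pos[OF M0] by eventually_elim (rule laplace_integrable[OF f])
  qed
  fix u :: "nat \<Rightarrow> real \<Rightarrow> complex"
  assume u: "(\<forall>n. u n \<in> laplace_domain M) \<and>
    (\<forall>e>0. \<exists>N. \<forall>m\<ge>N. \<forall>n\<ge>N. form_norm (laplace_form M) (\<lambda>t. u m t - u n t) < e)"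
  then have dom: "\<And>n. u n \<in> laplace_domain M" by blast
  have sq: "sq_integrable halfline (u n)" "sq_integrable M (laplace (u n))" for n
    using dom[of n] by (auto simp: laplace_domain_iff)
  have diff: "(\<lambda>t. u m t - u n t) \<in> laplace_domain M" for m n
    by (rule linear_subspace_diff[OF sub dom dom])
  have cauchy: "\<exists>N. \<forall>m\<ge>N. \<forall>n\<ge>N. sq_norm M (laplace (\<lambda>t. u m t - u n t)) + sq_norm halfline (\<lambda>t. u m t - u n t) < e"
    if "e > 0" for e
  proof -
    from u that have "\<exists>N. \<forall>m\<ge>N. \<forall>n\<ge>N. form_norm (laplace_form M) (\<lambda>t. u m t - u n t) < sqrt e" by simp
    then show ?thesis by (simp add: form_norm_laplace_form)
  qed
  obtain f where f: "sq_integrable halfline f" "(\<lambda>n. sq_norm halfline (\<lambda>t. u n t - f t)) \<longlonglongrightarrow> 0"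
  proof (rule L2_complete[of "\<lambda>t. exp (- t * 1)" halfline u])
    show "(\<lambda>t. exp (- t * 1)) \<in> borel_measurable halfline" by (rule exp_borel_halfline)
    show "integrable halfline (\<lambda>t. (exp (- t * 1))\<^sup>2)" by (rule exp_sq_integrable_halfline) simp
    fix e :: real assume "e > 0"
    then obtain N where N: "\<And>m n. m \<ge> N \<Longrightarrow> n \<ge> N \<Longrightarrow>
        sq_norm M (laplace (\<lambda>t. u m t - u n t)) + sq_norm halfline (\<lambda>t. u m t - u n t) < e"
      using cauchy by blast
    have "sq_norm halfline (\<lambda>t. u m t - u n t) < e" if "m \<ge> N" "n \<ge> N" for m n
      using N[OF that] sq_norm_nonneg[of M "laplace (\<lambda>t. u m t - u n t)"] by linarith
    then show "\<exists>K. \<forall>m\<ge>K. \<forall>n\<ge>K. sq_norm halfline (\<lambda>t. u m t - u n t) < e" by blast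
  qed (use sq in \<open>auto intro: that\<close>)
  have lim: "(\<lambda>m. laplace (\<lambda>t. u m t - u n t) l) \<longlonglongrightarrow> laplace (\<lambda>t. f t - u n t) l" if "l > 0" for l n
  proof -
    have "(\<lambda>m. (cmod (laplace (\<lambda>t. u m t - f t) l))\<^sup>2) \<longlonglongrightarrow> 0"
    proof (rule tendsto_sandwich[OF _ _ tendsto_const])
      show "\<forall>\<^sub>F m in sequentially. (cmod (laplace (\<lambda>t. u m t - f t) l))\<^sup>2 \<le> sq_norm halfline (\<lambda>t. u m t - f t) / (2 * l)"
        by (intro always_eventually allI laplace_bound sq_integrable_diff sq f that)
      show "(\<lambda>m. sq_norm halfline (\<lambda>t. u m t - f t) / (2 * l)) \<longlonglongrightarrow> 0"
        using tendsto_divide[OF f(2) tendsto_const[of "2 * l"]] that by simp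
    qed auto
    then have "(\<lambda>m. cmod (laplace (\<lambda>t. u m t - f t) l)) \<longlonglongrightarrow> 0"
      using tendsto_real_sqrt[of _ 0 sequentially] by fastforce
    then have "(\<lambda>m. laplace (u m) l - laplace f l) \<longlonglongrightarrow> 0"
      by (simp add: tendsto_norm_zero_iff laplace_diff[OF sq(1) f(1) that])
    then have "(\<lambda>m. laplace (u m) l) \<longlonglongrightarrow> laplace f l" by (simp add: LIM_zero_iff)
    then have "(\<lambda>m. laplace (u m) l - laplace (u n) l) \<longlonglongrightarrow> laplace f l - laplace (u n) l"
      by (intro tendsto_intros)
    then show ?thesis by (simp add: laplace_diff[OF sq(1) sq(1) that] laplace_diff[OF f(1) sq(1) that])
  qed
  have close: "\<exists>N. \<forall>n\<ge>N. sq_integrable M (laplace (\<lambda>t. f t - u n t)) \<and> sq_norm M (laplace (\<lambda>t. f t - u n t)) \<le> e"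
    if e: "e > 0" for e
  proof -
    obtain N where N: "\<And>m n. m \<ge> N \<Longrightarrow> n \<ge> N \<Longrightarrow>
        sq_norm M (laplace (\<lambda>t. u m t - u n t)) + sq_norm halfline (\<lambda>t. u m t - u n t) < e"
      using cauchy[OF e] by blast
    have "sq_integrable M (laplace (\<lambda>t. f t - u n t)) \<and> sq_norm M (laplace (\<lambda>t. f t - u n t)) \<le> e" if "n \<ge> N" for n
    proof -
      have s: "sq_integrable M (laplace (\<lambda>t. u m t - u n t))" for m
        using diff[of m n] by (simp add: laplace_domain_iff)
      have m: "laplace (\<lambda>t. f t - u n t) \<in> borel_measurable M"
        using sq_integrable_diff(1)[OF f(1) sq(1)[of n]]
        by (intro borel_measurable_M laplace_measurable) auto
      have a: "AE l in M. (\<lambda>m. laplace (\<lambda>t. u m t - u n t) l) \<longlonglongrightarrow> laplace (\<lambda>t. f t - u n t) l"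
        using AE_pos[OF M0] by eventually_elim (rule lim)
      have ev: "\<forall>\<^sub>F m in sequentially. sq_norm M (laplace (\<lambda>t. u m t - u n t)) \<le> e"
        using eventually_ge_at_top[of N]
      proof eventually_elim
        fix m assume "m \<ge> N"
        from N[OF this that] sq_norm_nonneg[of halfline "\<lambda>t. u m t - u n t"]
        show "sq_norm M (laplace (\<lambda>t. u m t - u n t)) \<le> e" by linarith
      qed
      show ?thesis by (intro conjI sq_norm_fatou[OF s m a ev])
    qed
    then show ?thesis by blast
  qed
  from close[of 1] obtain N where N: "sq_integrable M (laplace (\<lambda>t. f t - u N t))" by auto
  have "(\<lambda>t. f t - u N t) \<in> laplace_domain M"
    using N sq_integrable_diff(1)[OF f(1) sq(1)] by (simp add: laplace_domain_iff)
  from laplace_domain_add(1)[OF M0 this dom[of N]] have fdom: "f \<in> laplace_domain M" by simp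
  have limM: "(\<lambda>n. sq_norm M (laplace (\<lambda>t. u n t - f t))) \<longlonglongrightarrow> 0"
  proof (rule LIMSEQ_I)
    fix e :: real assume "e > 0"
    with close[of "e/2"] obtain N where "\<And>n. n \<ge> N \<Longrightarrow> sq_norm M (laplace (\<lambda>t. f t - u n t)) \<le> e / 2" by auto
    moreover have "sq_norm M (laplace (\<lambda>t. u n t - f t)) = sq_norm M (laplace (\<lambda>t. f t - u n t))" for n
    proof -
      have "laplace (\<lambda>t. u n t - f t) = (\<lambda>l. - laplace (\<lambda>t. f t - u n t) l)"
        using laplace_cmult[of "-1" "\<lambda>t. f t - u n t"] by (intro ext) simp
      then show ?thesis by (simp add: sq_norm_uminus)
    qed
    ultimately show "\<exists>N. \<forall>n\<ge>N. norm (sq_norm M (laplace (\<lambda>t. u n t - f t)) - 0) < e"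
      using \<open>e > 0\<close> by (intro exI[of _ N]) force
  qed
  have "(\<lambda>n. form_norm (laplace_form M) (\<lambda>t. u n t - f t)) \<longlonglongrightarrow> 0"
    unfolding form_norm_laplace_form using tendsto_real_sqrt[OF tendsto_add[OF limM f(2)]] by simp
  with fdom show "\<exists>f\<in>laplace_domain M. (\<lambda>n. form_norm (laplace_form M) (\<lambda>t. u n t - f t)) \<longlonglongrightarrow> 0"
    by blast
qed

section \<open>Test functions form a core\<close>

text \<open>The square of the form norm.\<close>

definition energy :: "(real \<Rightarrow> complex) \<Rightarrow> real" where
  "energy f = sq_norm M (laplace f) + sq_norm halfline f"

lemma energy_add:
  assumes "emeasure M {0} = 0" "f \<in> laplace_domain M" "g \<in> laplace_domain M"
  shows "energy (\<lambda>t. f t + g t) \<le> 2 * energy f + 2 * energy g"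
  using laplace_domain_add(2)[OF assms] sq_integrable_add(2)[of halfline f g] assms(2,3)
  by (auto simp: energy_def laplace_domain_iff)

text \<open>Translation multiplies the transform by \<open>exp (- a\<^sub>n l) \<le> 1\<close>, so dominated convergence applies with
the majorant \<open>\<bar>L f\<bar>\<^sup>2\<close>.\<close>

lemma energy_shift_tendsto:
  assumes M0: "emeasure M {0} = 0" and f: "f \<in> laplace_domain M" and supp: "\<forall>t\<le>0. f t = 0"
    and a: "a \<longlonglongrightarrow> 0" "\<And>n. a n \<in> {0..1}"
  shows "(\<lambda>t. f (t - a n)) \<in> laplace_domain M"
    and "(\<lambda>n. energy (\<lambda>t. f (t - a n) - f t)) \<longlonglongrightarrow> 0"
proof -
  have sq: "sq_integrable halfline f" "sq_integrable M (laplace f)" using f by (auto simp: laplace_domain_iff)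
  have fl: "sq_integrable lborel f" using sq(1) sq_integrable_halfline(1)[OF supp] by simp
  have supp': "\<forall>t\<le>0. f (t - a n) = 0" for n using supp a(2)[of n] by auto
  have shl: "sq_integrable halfline (\<lambda>t. f (t - a n))" for n
    using sq_integrable_halfline(1)[OF supp'[of n]] sq_integrable_shift[OF fl] by simp
  have lap: "laplace (\<lambda>t. f (t - a n)) l = complex_of_real (exp (- a n * l)) * laplace f l" for n l
    using laplace_shift[OF supp, of "a n"] a(2)[of n] by simp
  have intf: "integrable M (\<lambda>l. (cmod (laplace f l))\<^sup>2)" using sq(2) by auto
  have "sq_integrable M (laplace (\<lambda>t. f (t - a n)))" for n
  proof (rule sq_integrable_bound(1)[OF _ intf])
    show "laplace (\<lambda>t. f (t - a n)) \<in> borel_measurable M"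
      using shl[of n] by (intro borel_measurable_M laplace_measurable) auto
    show "AE l in M. (cmod (laplace (\<lambda>t. f (t - a n)) l))\<^sup>2 \<le> (cmod (laplace f l))\<^sup>2"
      using AE_pos[OF M0]
    proof eventually_elim
      fix l :: real assume "l > 0"
      then have "exp (- a n * l) \<le> 1" using a(2)[of n] by simp
      then have "cmod (laplace (\<lambda>t. f (t - a n)) l) \<le> 1 * cmod (laplace f l)"
        unfolding lap norm_mult norm_of_real by (intro mult_right_mono) auto
      then show "(cmod (laplace (\<lambda>t. f (t - a n)) l))\<^sup>2 \<le> (cmod (laplace f l))\<^sup>2"
        by (intro power_mono) auto
    qed
  qed
  then show "(\<lambda>t. f (t - a n)) \<in> laplace_domain M" using shl by (simp add: laplace_domain_iff)
  have lap': "laplace (\<lambda>t. f (t - a n) - f t) l = complex_of_real (exp (- a n * l) - 1) * laplace f l" if "l > 0" for n l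
    using laplace_diff[OF shl[of n] sq(1) that] by (simp add: lap left_diff_distrib)
  have limM: "(\<lambda>n. sq_norm M (laplace (\<lambda>t. f (t - a n) - f t))) \<longlonglongrightarrow> 0"
  proof (rule sq_norm_tendsto_0[OF _ intf])
    show "laplace (\<lambda>t. f (t - a n) - f t) \<in> borel_measurable M" for n
      using sq_integrable_diff(1)[OF shl[of n] sq(1)] by (intro borel_measurable_M laplace_measurable) auto
    show "AE l in M. (\<lambda>n. laplace (\<lambda>t. f (t - a n) - f t) l) \<longlonglongrightarrow> 0"
      using AE_pos[OF M0]
    proof eventually_elim
      fix l :: real assume l: "l > 0"
      have "(\<lambda>n. complex_of_real (exp (- a n * l) - 1) * laplace f l) \<longlonglongrightarrow>
          complex_of_real (exp (- 0 * l) - 1) * laplace f l"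
        by (intro tendsto_intros a)
      then show "(\<lambda>n. laplace (\<lambda>t. f (t - a n) - f t) l) \<longlonglongrightarrow> 0" by (simp add: lap'[OF l])
    qed
    show "AE l in M. (cmod (laplace (\<lambda>t. f (t - a n) - f t) l))\<^sup>2 \<le> (cmod (laplace f l))\<^sup>2" for n
      using AE_pos[OF M0]
    proof eventually_elim
      fix l :: real assume l: "l > 0"
      have "exp (- a n * l) \<le> 1" using l a(2)[of n] by simp
      moreover have "exp (- a n * l) > 0" by simp
      ultimately have "\<bar>exp (- a n * l) - 1\<bar> \<le> 1" by linarith
      then have "\<bar>exp (- a n * l) - 1\<bar>\<^sup>2 \<le> 1" by (intro power_le_one) auto
      then have "\<bar>exp (- a n * l) - 1\<bar>\<^sup>2 * (cmod (laplace f l))\<^sup>2 \<le> 1 * (cmod (laplace f l))\<^sup>2"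
        by (intro mult_right_mono) auto
      then show "(cmod (laplace (\<lambda>t. f (t - a n) - f t) l))\<^sup>2 \<le> (cmod (laplace f l))\<^sup>2"
        unfolding lap'[OF l] norm_mult norm_of_real power_mult_distrib by simp
    qed
  qed
  have "\<forall>t\<le>0. f (t - a n) - f t = 0" for n using supp supp' by simp
  from sq_integrable_halfline(2)[OF this]
  have limL: "(\<lambda>n. sq_norm halfline (\<lambda>t. f (t - a n) - f t)) \<longlonglongrightarrow> 0"
    using sq_norm_shift_tendsto[OF fl _ a] supp by simp
  show "(\<lambda>n. energy (\<lambda>t. f (t - a n) - f t)) \<longlonglongrightarrow> 0"
    unfolding energy_def using tendsto_add[OF limM limL] by simp
qed

lemma shift_avg_halfline:
  assumes f: "sq_integrable halfline f" and supp: "\<forall>t\<le>e. f t = 0" and e: "e \<ge> 0"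
  shows "\<forall>t\<le>e. shift_avg j f t = 0" "sq_integrable halfline (shift_avg j f)"
    "sq_norm halfline (shift_avg j f) = sq_norm lborel (shift_avg j f)"
    "sq_norm lborel f = sq_norm halfline f" "sq_integrable lborel f"
proof -
  have supp0: "\<forall>t\<le>0. f t = 0" using supp e by auto
  show fl: "sq_integrable lborel f" "sq_norm lborel f = sq_norm halfline f"
    using f sq_integrable_halfline[OF supp0] by simp_all
  show avg: "\<forall>t\<le>e. shift_avg j f t = 0"
  proof (intro allI impI)
    fix t assume "t \<le> e"
    have "f (t - real k * real j) = 0" for k
    proof -
      have "0 \<le> real k * real j" by simp
      with \<open>t \<le> e\<close> show ?thesis using supp by (smt (verit))
    qed
    then show "shift_avg j f t = 0" by (simp add: shift_avg_def)
  qed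
  have "\<forall>t\<le>0. shift_avg j f t = 0" using avg e by auto
  from sq_integrable_halfline[OF this] sq_integrable_shift_avg[OF fl(1)]
  show "sq_integrable halfline (shift_avg j f)" "sq_norm halfline (shift_avg j f) = sq_norm lborel (shift_avg j f)"
    by simp_all
qed

text \<open>The multipliers are bounded by \<open>1\<close> and tend to \<open>0\<close> at every \<open>l > 0\<close>.\<close>

lemma energy_shift_avg_tendsto:
  assumes M0: "emeasure M {0} = 0" and f: "f \<in> laplace_domain M" and supp: "\<forall>t\<le>0. f t = 0"
  shows "shift_avg (Suc n) f \<in> laplace_domain M"
    and "(\<lambda>n. energy (shift_avg (Suc n) f)) \<longlonglongrightarrow> 0"
proof -
  have sq: "sq_integrable halfline f" "sq_integrable M (laplace f)" using f by (auto simp: laplace_domain_iff)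
  note avg = shift_avg_halfline[OF sq(1) supp order_refl]
  have intf: "integrable M (\<lambda>l. (cmod (laplace f l))\<^sup>2)" using sq(2) by auto
  have meas: "laplace (shift_avg j f) \<in> borel_measurable M" for j
    using avg(2)[of j] by (intro borel_measurable_M laplace_measurable) auto
  have le: "AE l in M. (cmod (laplace (shift_avg (Suc n) f) l))\<^sup>2 \<le> (cmod (laplace f l))\<^sup>2" for n
    using AE_pos[OF M0]
  proof eventually_elim
    fix l :: real assume l: "l > 0"
    have "exp (- l * real (Suc n)) \<le> 1" using l by simp
    then have "\<bar>avg_symbol (Suc n) l\<bar> \<le> 1" using avg_symbol_bounds(1,2)[of l "Suc n"] l by linarith
    then have "\<bar>avg_symbol (Suc n) l\<bar>\<^sup>2 \<le> 1" by (intro power_le_one) auto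
    then have "\<bar>avg_symbol (Suc n) l\<bar>\<^sup>2 * (cmod (laplace f l))\<^sup>2 \<le> 1 * (cmod (laplace f l))\<^sup>2"
      by (intro mult_right_mono) auto
    then show "(cmod (laplace (shift_avg (Suc n) f) l))\<^sup>2 \<le> (cmod (laplace f l))\<^sup>2"
      unfolding laplace_shift_avg[OF sq(1) supp l] norm_mult norm_of_real power_mult_distrib by simp
  qed
  show "shift_avg (Suc n) f \<in> laplace_domain M"
    using avg(2) sq_integrable_bound(1)[OF meas intf le] by (simp add: laplace_domain_iff)
  have limM: "(\<lambda>n. sq_norm M (laplace (shift_avg (Suc n) f))) \<longlonglongrightarrow> 0"
  proof (rule sq_norm_tendsto_0[OF meas intf _ le])
    show "AE l in M. (\<lambda>n. laplace (shift_avg (Suc n) f) l) \<longlonglongrightarrow> 0"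
      using AE_pos[OF M0]
    proof eventually_elim
      fix l :: real assume l: "l > 0"
      have "(\<lambda>n. avg_symbol (Suc n) l) \<longlonglongrightarrow> 0"
      proof (rule tendsto_sandwich[OF _ _ tendsto_const])
        have "filterlim (\<lambda>n. - l * real (Suc n)) at_bot sequentially"
          using l filterlim_compose[OF filterlim_real_sequentially filterlim_Suc]
          by (intro filterlim_tendsto_neg_mult_at_bot[OF tendsto_const]) auto
        then show "(\<lambda>n. exp (- l * real (Suc n))) \<longlonglongrightarrow> 0"
          by (rule filterlim_compose[OF exp_at_bot])
        show "\<forall>\<^sub>F n in sequentially. 0 \<le> avg_symbol (Suc n) l"
          "\<forall>\<^sub>F n in sequentially. avg_symbol (Suc n) l \<le> exp (- l * real (Suc n))"
          by (intro always_eventually allI avg_symbol_bounds less_imp_le[OF l] zero_less_Suc)+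
      qed
      then have "(\<lambda>n. complex_of_real (avg_symbol (Suc n) l) * laplace f l) \<longlonglongrightarrow> complex_of_real 0 * laplace f l"
        by (intro tendsto_intros)
      then show "(\<lambda>n. laplace (shift_avg (Suc n) f) l) \<longlonglongrightarrow> 0"
        by (simp add: laplace_shift_avg[OF sq(1) supp l])
    qed
  qed
  have "(\<lambda>n. sq_norm lborel (shift_avg (Suc n) f)) \<longlonglongrightarrow> 0"
    using LIMSEQ_Suc[OF sq_norm_shift_avg_tendsto[OF avg(5)]] supp by simp
  with limM show "(\<lambda>n. energy (shift_avg (Suc n) f)) \<longlonglongrightarrow> 0"
    unfolding energy_def avg(3) using tendsto_add by fastforce
qed

text \<open>On functions that vanish up to \<open>e\<close>, the operator \<open>1 - A\<^sub>j\<close> is bounded from \<open>L\<^sup>2\<close> to the form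
norm. Its multiplier \<open>m\<close> satisfies \<open>m\<^sup>2 \<le> m \<le> j\<^sup>2 l\<close>, which cancels the singular factor in
\<open>\<bar>L v l\<bar>\<^sup>2 \<le> exp (- 2 e l) \<parallel>v\<parallel>\<^sup>2 / (2 l)\<close>; the remaining exponential is integrable for \<open>M\<close>.\<close>

lemma energy_minus_shift_avg_bound:
  assumes M0: "emeasure M {0} = 0" and e: "e > 0" and j: "j > 0"
  obtains C where "C \<ge> 0"
    "\<And>v. sq_integrable halfline v \<Longrightarrow> \<forall>t\<le>e. v t = 0 \<Longrightarrow>
      (\<lambda>t. v t - shift_avg j v t) \<in> laplace_domain M \<and> energy (\<lambda>t. v t - shift_avg j v t) \<le> C * sq_norm halfline v"
proof -
  define W where "W = (LINT l|M. exp (- (2 * e) * l))"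
  have intW: "integrable M (\<lambda>l. exp (- (2 * e) * l))" using e by (intro exp_integrable) simp
  have W: "W \<ge> 0" unfolding W_def by simp
  show ?thesis
  proof (rule that[of "(real j)\<^sup>2 / 2 * W + 4"])
    show "(real j)\<^sup>2 / 2 * W + 4 \<ge> 0" using W by simp
    fix v assume v: "sq_integrable halfline v" and supp: "\<forall>t\<le>e. v t = 0"
    have supp0: "\<forall>t\<le>0. v t = 0" using supp e by auto
    note avg = shift_avg_halfline[OF v supp less_imp_le[OF e]]
    let ?w = "\<lambda>t. v t - shift_avg j v t"
    note w = sq_integrable_diff[OF v avg(2)[of j]]
    have wn: "sq_norm halfline ?w \<le> 4 * sq_norm halfline v"
      using w(2) sq_norm_shift_avg_le[OF avg(5), of j] unfolding avg(3,4) by simp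
    have meas: "laplace ?w \<in> borel_measurable M"
      using w(1) by (intro borel_measurable_M laplace_measurable) auto
    have int: "integrable M (\<lambda>l. (real j)\<^sup>2 / 2 * sq_norm halfline v * exp (- (2 * e) * l))"
      by (intro integrable_mult_right intW)
    have le: "AE l in M. (cmod (laplace ?w l))\<^sup>2 \<le> (real j)\<^sup>2 / 2 * sq_norm halfline v * exp (- (2 * e) * l)"
      using AE_pos[OF M0]
    proof eventually_elim
      fix l :: real assume l: "l > 0"
      let ?m = "1 - avg_symbol j l"
      have "exp (- l * real j) \<le> 1" using l by simp
      then have m: "0 \<le> ?m" "?m \<le> 1" "?m \<le> (real j)\<^sup>2 * l"
        using avg_symbol_bounds[of l j] l j by linarith+
      have lap: "laplace ?w l = complex_of_real ?m * laplace v l"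
        using laplace_diff[OF v avg(2)[of j] l] laplace_shift_avg[OF v supp0 l, of j]
        by (simp add: left_diff_distrib)
      have "?m\<^sup>2 \<le> ?m * 1" unfolding power2_eq_square using m by (intro mult_left_mono) auto
      then have m2: "?m\<^sup>2 \<le> (real j)\<^sup>2 * l" using m by simp
      have "(cmod (laplace ?w l))\<^sup>2 = ?m\<^sup>2 * (cmod (laplace v l))\<^sup>2"
        unfolding lap norm_mult norm_of_real power_mult_distrib by simp
      also have "\<dots> \<le> ((real j)\<^sup>2 * l) * (exp (- (2 * e) * l) * (sq_norm halfline v / (2 * l)))"
        using laplace_bound_supp[OF v less_imp_le[OF e] supp l] m2 l by (intro mult_mono) auto
      also have "\<dots> = (real j)\<^sup>2 / 2 * sq_norm halfline v * exp (- (2 * e) * l)"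
        using l by (simp add: field_simps)
      finally show "(cmod (laplace ?w l))\<^sup>2 \<le> (real j)\<^sup>2 / 2 * sq_norm halfline v * exp (- (2 * e) * l)" .
    qed
    note wM = sq_integrable_bound[OF meas int le]
    have "sq_norm M (laplace ?w) \<le> (real j)\<^sup>2 / 2 * W * sq_norm halfline v"
      using wM(2) by (simp add: W_def mult.assoc mult.commute[of "sq_norm halfline v"])
    with wn w(1) wM(1)
    show "?w \<in> laplace_domain M \<and> energy ?w \<le> ((real j)\<^sup>2 / 2 * W + 4) * sq_norm halfline v"
      by (simp add: laplace_domain_iff energy_def distrib_right)
  qed
qed

text \<open>For \<open>g\<close> a small translate of \<open>f\<close> and a test function \<open>u\<close> close to \<open>g\<close> in \<open>L\<^sup>2\<close>, the approximant is
\<open>u - A\<^sub>j u\<close>, where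
\<open>u - A\<^sub>j u - f = ((u - g) - A\<^sub>j (u - g)) - A\<^sub>j g + (g - f)\<close>
and each of the three terms is small: the first by the boundedness of \<open>1 - A\<^sub>j\<close>, the others by
the convergence of averages and of translations.\<close>

lemma C0_infinity_core:
  assumes M0: "emeasure M {0} = 0" and f: "f \<in> laplace_domain M" and \<delta>: "\<delta> > 0"
  shows "\<exists>u\<in>C0_infinity. energy (\<lambda>t. u t - f t) < \<delta>"
proof -
  \<comment> \<open>Values on \<open>t \<le> 0\<close> are irrelevant; replacing them by \<open>0\<close> makes translation act on the half-line.\<close>
  define f0 where "f0 = (\<lambda>t. if t > 0 then f t else 0)"
  have f0_eq: "f0 t = f t" if "t > 0" for t using that by (simp add: f0_def)
  have f0_supp: "\<forall>t\<le>0. f0 t = 0" by (simp add: f0_def)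
  have f0: "f0 \<in> laplace_domain M"
  proof -
    have "laplace f0 = laplace f" by (intro ext laplace_cong f0_eq)
    then show ?thesis using f sq_integrable_halfline_cong[of f0 f, OF f0_eq] by (simp add: laplace_domain_iff)
  qed
  define a where "a = (\<lambda>n. inverse (real (Suc n)))"
  have a: "a \<longlonglongrightarrow> 0" "\<And>n. a n \<in> {0..1}" "\<And>n. a n > 0"
    using LIMSEQ_inverse_real_of_nat by (auto simp: a_def field_simps)
  note shift = energy_shift_tendsto[OF M0 f0 f0_supp a(1,2)]
  have "\<forall>\<^sub>F n in sequentially. energy (\<lambda>t. f0 (t - a n) - f0 t) < \<delta> / 16"
    using \<delta> shift(2) by (intro order_tendstoD(2)) auto
  then obtain n where n: "energy (\<lambda>t. f0 (t - a n) - f0 t) < \<delta> / 16"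
    by (meson eventually_sequentially le_refl)
  define e where "e = a n"
  define g where "g = (\<lambda>t. f0 (t - e))"
  have e: "e > 0" using a(3) by (simp add: e_def)
  have g: "g \<in> laplace_domain M" using shift(1)[of n] by (simp add: g_def e_def)
  have g_supp: "\<forall>t\<le>e. g t = 0" using f0_supp by (simp add: g_def)
  then have g_supp0: "\<forall>t\<le>0. g t = 0" using e by auto
  have g_sq: "sq_integrable halfline g" "sq_integrable lborel g"
    using g sq_integrable_halfline(1)[OF g_supp0] by (auto simp: laplace_domain_iff)
  note avg = energy_shift_avg_tendsto[OF M0 g g_supp0]
  have "\<forall>\<^sub>F n in sequentially. energy (shift_avg (Suc n) g) < \<delta> / 16"
    using \<delta> avg(2) by (intro order_tendstoD(2)) auto
  then obtain k where k: "energy (shift_avg (Suc k) g) < \<delta> / 16"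
    by (meson eventually_sequentially le_refl)
  define j where "j = Suc k"
  obtain C where C: "C \<ge> 0"
    "\<And>v. sq_integrable halfline v \<Longrightarrow> \<forall>t\<le>e. v t = 0 \<Longrightarrow>
      (\<lambda>t. v t - shift_avg j v t) \<in> laplace_domain M \<and> energy (\<lambda>t. v t - shift_avg j v t) \<le> C * sq_norm halfline v"
    using energy_minus_shift_avg_bound[OF M0 e, of j] by (auto simp: j_def)
  \<comment> \<open>The factor \<open>C + 1\<close> instead of \<open>C\<close> avoids division by zero.\<close>
  have "\<delta> / (16 * (C + 1)) > 0" using \<delta> C(1) by simp
  then obtain u p q where u: "smooth u" "e < p" "p < q" "\<forall>t. t \<notin> {p..q} \<longrightarrow> u t = 0"
    "sq_norm lborel (\<lambda>t. u t - g t) < \<delta> / (16 * (C + 1))"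
    using test_functions_dense[OF g_sq(2), of e "\<delta> / (16 * (C + 1))"] g_supp by blast
  have uC0: "u \<in> C0_infinity"
    unfolding C0_infinity_iff using u e by (intro conjI exI[of _ p] exI[of _ q]) auto
  define w where "w = (\<lambda>t. u t - shift_avg j u t)"
  have w: "w \<in> C0_infinity"
    unfolding w_def by (intro linear_subspace_diff[OF linear_subspace_C0_infinity] C0_infinity_shift_avg uC0)
  define v where "v = (\<lambda>t. u t - g t)"
  have v_supp: "\<forall>t\<le>e. v t = 0" using u g_supp by (auto simp: v_def)
  then have v_supp0: "\<forall>t\<le>0. v t = 0" using e by auto
  have v_sq: "sq_integrable halfline v"
    unfolding v_def by (intro sq_integrable_diff C0_infinity_sq_integrable uC0 g_sq)
  have v_n: "sq_norm halfline v < \<delta> / (16 * (C + 1))"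
    using u(5) sq_integrable_halfline(2)[OF v_supp0] by (simp add: v_def)
  note vdom = C(2)[OF v_sq v_supp]
  have "C * sq_norm halfline v \<le> (C + 1) * sq_norm halfline v" by (intro mult_right_mono) auto
  also have "\<dots> < \<delta> / 16" using v_n C(1) by (simp add: field_simps)
  finally have v_e: "energy (\<lambda>t. v t - shift_avg j v t) < \<delta> / 16" using vdom by linarith
  let ?P = "\<lambda>t. v t - shift_avg j v t" and ?R = "shift_avg j g" and ?S = "\<lambda>t. g t - f0 t"
  note sub = linear_subspace_laplace_domain[OF M0]
  have R: "?R \<in> laplace_domain M" using avg(1) by (simp add: j_def)
  have S: "?S \<in> laplace_domain M" by (rule linear_subspace_diff[OF sub g f0])
  have R': "(\<lambda>t. (-1) * ?R t) \<in> laplace_domain M" by (rule linear_subspaceD(3)[OF sub R])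
  have eR: "energy (\<lambda>t. (-1) * ?R t) < \<delta> / 16"
    using k unfolding energy_def laplace_cmult[abs_def] sq_norm_cmult by (simp add: j_def)
  have RS: "(\<lambda>t. (-1) * ?R t + ?S t) \<in> laplace_domain M" by (rule laplace_domain_add(1)[OF M0 R' S])
  \<comment> \<open>The weights of the three terms are \<open>2\<close>, \<open>4\<close> and \<open>4\<close>, and \<open>10 \<sqdot> \<delta> / 16 < \<delta>\<close>.\<close>
  have "energy (\<lambda>t. ?P t + ((-1) * ?R t + ?S t)) \<le> 2 * energy ?P + 2 * energy (\<lambda>t. (-1) * ?R t + ?S t)"
    by (rule energy_add[OF M0 conjunct1[OF vdom] RS])
  also have "energy (\<lambda>t. (-1) * ?R t + ?S t) \<le> 2 * energy (\<lambda>t. (-1) * ?R t) + 2 * energy ?S"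
    by (rule energy_add[OF M0 R' S])
  finally have "energy (\<lambda>t. ?P t + ((-1) * ?R t + ?S t)) < \<delta>"
    using v_e eR n \<delta> by (simp add: g_def e_def)
  moreover have "(\<lambda>t. ?P t + ((-1) * ?R t + ?S t)) = (\<lambda>t. w t - f0 t)"
    by (simp add: v_def w_def shift_avg_diff algebra_simps)
  moreover have "energy (\<lambda>t. w t - f0 t) = energy (\<lambda>t. w t - f t)"
    unfolding energy_def
    by (intro arg_cong2[of _ _ _ _ "(+)"] arg_cong[of _ _ "sq_norm M"] ext laplace_cong sq_norm_halfline_cong)
       (simp_all add: f0_eq)
  ultimately show ?thesis using w by auto
qed

end

section \<open>The Hankel form as a Laplace form\<close>

lemma (in pair_sigma_finite) integrable_product_bound:
  fixes F :: "'a \<times> 'b \<Rightarrow> 'c :: {banach, second_countable_topology}"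
  assumes F: "F \<in> borel_measurable (M1 \<Otimes>\<^sub>M M2)"
    and u: "integrable M1 u" and v: "integrable M2 v"
    and le: "AE x in M1. AE y in M2. norm (F (x, y)) \<le> u x * (v y :: real)"
  shows "integrable (M1 \<Otimes>\<^sub>M M2) F"
proof (rule integrableI_bounded[OF F])
  have [measurable]: "u \<in> borel_measurable M1" "v \<in> borel_measurable M2" using u v by auto
  have [measurable]: "F \<in> borel_measurable (M1 \<Otimes>\<^sub>M M2)" by (rule F)
  have "(\<integral>\<^sup>+p. norm (F p) \<partial>(M1 \<Otimes>\<^sub>M M2)) = (\<integral>\<^sup>+x. (\<integral>\<^sup>+y. norm (F (x, y)) \<partial>M2) \<partial>M1)"
    by (simp add: M2.nn_integral_fst[symmetric])
  also have "\<dots> \<le> (\<integral>\<^sup>+x. (\<integral>\<^sup>+y. ennreal \<bar>u x\<bar> * ennreal \<bar>v y\<bar> \<partial>M2) \<partial>M1)"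
  proof (intro nn_integral_mono_AE, use le in eventually_elim)
    fix x assume "AE y in M2. norm (F (x, y)) \<le> u x * v y"
    then show "(\<integral>\<^sup>+y. norm (F (x, y)) \<partial>M2) \<le> (\<integral>\<^sup>+y. ennreal \<bar>u x\<bar> * ennreal \<bar>v y\<bar> \<partial>M2)"
    proof (intro nn_integral_mono_AE, eventually_elim)
      fix y assume "norm (F (x, y)) \<le> u x * v y"
      also have "\<dots> \<le> \<bar>u x\<bar> * \<bar>v y\<bar>" by (simp flip: abs_mult)
      finally show "ennreal (norm (F (x, y))) \<le> ennreal \<bar>u x\<bar> * ennreal \<bar>v y\<bar>"
        by (simp add: ennreal_leI flip: ennreal_mult)
    qed
  qed
  also have "\<dots> = (\<integral>\<^sup>+x. ennreal \<bar>u x\<bar> \<partial>M1) * (\<integral>\<^sup>+y. ennreal \<bar>v y\<bar> \<partial>M2)"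
    by (simp add: nn_integral_cmult nn_integral_multc)
  also have "\<dots> < \<infinity>"
    using u v by (auto simp: integrable_iff_bounded ennreal_mult_less_top)
  finally show "(\<integral>\<^sup>+p. norm (F p) \<partial>(M1 \<Otimes>\<^sub>M M2)) < \<infinity>" .
qed

context laplace_weight
begin

lemma ident_measurable_M [measurable]: "(\<lambda>t. t) \<in> borel_measurable M"
  by (rule borel_measurable_M) simp

lemma compact_support_laplace_domain:
  assumes "f \<in> L2_compact_support"
  shows "f \<in> laplace_domain M"
proof -
  have f: "sq_integrable halfline f" using assms by (simp add: L2_compact_support_iff)
  obtain a C where aC: "a > 0" "C \<ge> 0" "\<And>l. l \<ge> 0 \<Longrightarrow> cmod (laplace f l) \<le> exp (- a * l) * C"
    using laplace_compact_support[OF assms] by metis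
  have "sq_integrable M (laplace f)"
  proof (rule sq_integrable_bound(1))
    show "integrable M (\<lambda>l. exp (- (2 * a) * l) * C\<^sup>2)"
      using aC(1) by (intro integrable_mult_left exp_integrable) simp
    show "laplace f \<in> borel_measurable M"
      using f by (intro borel_measurable_M laplace_measurable) auto
    show "AE l in M. (cmod (laplace f l))\<^sup>2 \<le> exp (- (2 * a) * l) * C\<^sup>2"
    proof (intro AE_I2)
      fix l assume "l \<in> space M"
      then have "(cmod (laplace f l))\<^sup>2 \<le> (exp (- a * l) * C)\<^sup>2"
        using aC(3)[of l] by (intro power_mono) (auto simp: space_M)
      then show "(cmod (laplace f l))\<^sup>2 \<le> exp (- (2 * a) * l) * C\<^sup>2"
        by (simp add: power_mult_distrib mult.assoc flip: exp_double)
    qed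
  qed
  with f show ?thesis by (simp add: laplace_domain_iff)
qed

lemma nonneg_form_laplace_form_compact_support:
  assumes "linear_subspace D" "D \<subseteq> L2_compact_support"
  shows "nonneg_form D (laplace_form M)"
proof (rule nonneg_form_laplace_form[OF assms(1)])
  show "D \<subseteq> laplace_domain M" using assms(2) compact_support_laplace_domain by blast
  fix f assume "f \<in> D"
  then have "f \<in> L2_compact_support" using assms(2) by blast
  then have "integrable halfline (\<lambda>t. complex_of_real (exp (- t * l)) * f t)" if "l \<ge> 0" for l
    using that laplace_compact_support[of f] by metis
  then show "AE l in M. integrable halfline (\<lambda>t. complex_of_real (exp (- t * l)) * f t)"
    by (intro AE_I2) (simp add: space_M)
qed

text \<open>Fubini's theorem for one variable of the Hankel form; the integrand is bounded by
\<open>B exp (- a l) \<bar>g t\<bar>\<close> if \<open>g\<close> vanishes up to \<open>a > 0\<close>. It serves for both variables: with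
\<open>\<phi> = exp (- t l)\<close> for the inner integral and with \<open>\<phi> = L f\<close> for the outer one.\<close>

lemma integral_laplace_swap:
  assumes g: "g \<in> L2_compact_support" and \<phi>: "\<phi> \<in> borel_measurable M"
    and B: "\<And>l. l \<ge> 0 \<Longrightarrow> cmod (\<phi> l) \<le> B"
  shows "(LINT t|halfline. (LINT l|M. complex_of_real (exp (- t * l)) * \<phi> l) * g t) =
    (LINT l|M. \<phi> l * laplace g l)"
proof -
  interpret H: sigma_finite_measure halfline by (rule sigma_finite_halfline)
  interpret P: pair_sigma_finite halfline M ..
  obtain a where a: "a > 0" "integrable halfline g" "AE t in halfline. t < a \<longrightarrow> g t = 0"
    using laplace_compact_support[OF g] by metis
  have [measurable]: "g \<in> borel_measurable halfline" "\<phi> \<in> borel_measurable M"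
    using a(2) \<phi> by auto
  let ?F = "\<lambda>t l. complex_of_real (exp (- t * l)) * \<phi> l * g t"
  have "integrable (halfline \<Otimes>\<^sub>M M) (case_prod ?F)"
  proof (rule P.integrable_product_bound)
    show "case_prod ?F \<in> borel_measurable (halfline \<Otimes>\<^sub>M M)" by measurable
    show "integrable halfline (\<lambda>t. B * cmod (g t))"
      using a(2) by (intro integrable_mult_right integrable_norm)
    show "integrable M (\<lambda>l. exp (- a * l))" by (rule exp_integrable[OF a(1)])
    show "AE t in halfline. AE l in M. norm (case_prod ?F (t, l)) \<le> B * cmod (g t) * exp (- a * l)"
      using a(3)
    proof eventually_elim
      fix t assume t: "t < a \<longrightarrow> g t = 0"
      show "AE l in M. norm (case_prod ?F (t, l)) \<le> B * cmod (g t) * exp (- a * l)"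
      proof (intro AE_I2)
        fix l assume "l \<in> space M"
        then have l: "l \<ge> 0" by (simp add: space_M)
        show "norm (case_prod ?F (t, l)) \<le> B * cmod (g t) * exp (- a * l)"
        proof (cases "t < a")
          case False
          then have "a * l \<le> t * l" using l by (intro mult_right_mono) auto
          then have "exp (- t * l) * cmod (\<phi> l) \<le> exp (- a * l) * B"
            using B[OF l] by (intro mult_mono) auto
          then have "exp (- t * l) * cmod (\<phi> l) * cmod (g t) \<le> exp (- a * l) * B * cmod (g t)"
            by (intro mult_right_mono) auto
          then show ?thesis by (simp add: norm_mult mult.commute mult.left_commute)
        qed (use t in simp)
      qed
    qed
  qed
  from P.Fubini_integral[OF this]
  have "(LINT l|M. LINT t|halfline. ?F t l) = (LINT t|halfline. LINT l|M. ?F t l)" .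
  moreover have "(LINT t|halfline. ?F t l) = \<phi> l * laplace g l" for l
    unfolding laplace_def by (simp add: mult.assoc mult.left_commute[of _ "\<phi> l"])
  moreover have "(LINT l|M. ?F t l) = (LINT l|M. complex_of_real (exp (- t * l)) * \<phi> l) * g t" for t
    by simp
  ultimately show ?thesis by simp
qed

context
  fixes h :: "real \<Rightarrow> real"
  assumes h: "\<And>t. t > 0 \<Longrightarrow> h t = (LINT l|M. exp (- t * l))"
begin

lemma hankel_form_eq_laplace_form:
  assumes f: "f \<in> L2_compact_support" and g: "g \<in> L2_compact_support"
  shows "hankel_form h f g = laplace_form M f g"
proof -
  obtain a C where aC: "a > 0" "C \<ge> 0" "\<And>l. l \<ge> 0 \<Longrightarrow> cmod (laplace f l) \<le> exp (- a * l) * C"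
    using laplace_compact_support[OF f] by metis
  have gc: "(\<lambda>t. cnj (g t)) \<in> L2_compact_support"
    using g by (auto simp: L2_compact_support_iff sq_integrable_def)
  have inner: "(LINT s|halfline. complex_of_real (h (t + s)) * f s * cnj (g t)) =
      (LINT l|M. complex_of_real (exp (- t * l)) * laplace f l) * cnj (g t)" if "t > 0" for t
  proof -
    have "(LINT s|halfline. complex_of_real (h (t + s)) * f s) =
        (LINT s|halfline. (LINT l|M. complex_of_real (exp (- s * l)) * complex_of_real (exp (- t * l))) * f s)"
    proof (intro Bochner_Integration.integral_cong refl)
      fix s assume "s \<in> space halfline"
      then have "complex_of_real (h (t + s)) = (LINT l|M. complex_of_real (exp (- (t + s) * l)))"
        using that h[of "t + s"] by (simp add: space_restrict_space)
      also have "\<dots> = (LINT l|M. complex_of_real (exp (- s * l)) * complex_of_real (exp (- t * l)))"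
        by (intro Bochner_Integration.integral_cong refl)
           (simp add: algebra_simps flip: of_real_mult exp_add)
      finally show "complex_of_real (h (t + s)) * f s =
        (LINT l|M. complex_of_real (exp (- s * l)) * complex_of_real (exp (- t * l))) * f s" by simp
    qed
    also have "\<dots> = (LINT l|M. complex_of_real (exp (- t * l)) * laplace f l)"
      by (rule integral_laplace_swap[OF f, of _ 1]) (use that in auto)
    finally show ?thesis by simp
  qed
  have "hankel_form h f g =
      (LINT t|halfline. (LINT l|M. complex_of_real (exp (- t * l)) * laplace f l) * cnj (g t))"
    unfolding hankel_form_def
    by (intro Bochner_Integration.integral_cong refl inner) (simp add: space_restrict_space)
  also have "\<dots> = (LINT l|M. laplace f l * laplace (\<lambda>t. cnj (g t)) l)"
  proof (rule integral_laplace_swap[OF gc, of _ C])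
    show "laplace f \<in> borel_measurable M"
      using f by (intro borel_measurable_M laplace_measurable) (auto simp: L2_compact_support_iff)
    fix l :: real assume l: "l \<ge> 0"
    then have "exp (- a * l) * C \<le> 1 * C" using aC by (intro mult_right_mono) auto
    then show "cmod (laplace f l) \<le> C" using aC(3)[OF l] by simp
  qed
  also have "\<dots> = laplace_form M f g"
  proof -
    have "laplace (\<lambda>t. cnj (g t)) l = cnj (laplace g l)" for l
      unfolding laplace_def by (subst Bochner_Integration.integral_cnj[symmetric]) simp
    then show ?thesis by (simp add: laplace_form_def)
  qed
  finally show ?thesis .
qed

text \<open>The kernel \<open>h\<close> is decreasing, so \<open>h (t + s) \<le> h (2 a)\<close> on the support of the integrand.\<close>

lemma integrable_hankel_kernel:
  assumes f: "f \<in> L2_compact_support"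
  shows "integrable (halfline \<Otimes>\<^sub>M halfline) (\<lambda>(t, s). complex_of_real (h (t + s)) * f s * cnj (f t))"
proof -
  interpret H: sigma_finite_measure halfline by (rule sigma_finite_halfline)
  interpret P: pair_sigma_finite halfline halfline ..
  obtain a where a: "a > 0" "integrable halfline f" "AE t in halfline. t < a \<longrightarrow> f t = 0"
    using laplace_compact_support[OF f] by metis
  have [measurable]: "f \<in> borel_measurable halfline" using a(2) by auto
  define H where "H = (\<lambda>t. LINT l|M. exp (- t * l))"
  have [measurable]: "H \<in> borel_measurable borel"
    unfolding H_def by (rule borel_measurable_lebesgue_integral) measurable
  have mono: "\<bar>H (t + s)\<bar> \<le> H (a + a)" if "\<not> t < a" "\<not> s < a" for t s
  proof -
    have "H (t + s) \<le> H (a + a)" unfolding H_def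
    proof (rule integral_mono)
      show "integrable M (\<lambda>l. exp (- (t + s) * l))" by (rule exp_integrable) (use that a(1) in auto)
      show "integrable M (\<lambda>l. exp (- (a + a) * l))" by (rule exp_integrable) (use a(1) in auto)
      fix l assume "l \<in> space M"
      then have "(a + a) * l \<le> (t + s) * l" using that by (intro mult_right_mono) (auto simp: space_M)
      then show "exp (- (t + s) * l) \<le> exp (- (a + a) * l)" by (simp del: minus_add_distrib)
    qed
    moreover have "0 \<le> H (t + s)" unfolding H_def by simp
    ultimately show ?thesis by simp
  qed
  have "integrable (halfline \<Otimes>\<^sub>M halfline) (\<lambda>(t, s). complex_of_real (H (t + s)) * f s * cnj (f t))"
  proof (rule P.integrable_product_bound)
    show "(\<lambda>(t, s). complex_of_real (H (t + s)) * f s * cnj (f t)) \<in> borel_measurable (halfline \<Otimes>\<^sub>M halfline)"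
      by measurable
    show "integrable halfline (\<lambda>t. H (a + a) * cmod (f t))" "integrable halfline (\<lambda>t. cmod (f t))"
      using a(2) by (auto intro: integrable_mult_right)
    show "AE t in halfline. AE s in halfline.
        norm (case (t, s) of (t, s) \<Rightarrow> complex_of_real (H (t + s)) * f s * cnj (f t)) \<le>
        H (a + a) * cmod (f t) * cmod (f s)"
      using a(3)
    proof eventually_elim
      fix t assume t: "t < a \<longrightarrow> f t = 0"
      show "AE s in halfline.
        norm (case (t, s) of (t, s) \<Rightarrow> complex_of_real (H (t + s)) * f s * cnj (f t)) \<le>
        H (a + a) * cmod (f t) * cmod (f s)"
        using a(3)
      proof eventually_elim
        fix s assume s: "s < a \<longrightarrow> f s = 0"
        show "norm (case (t, s) of (t, s) \<Rightarrow> complex_of_real (H (t + s)) * f s * cnj (f t)) \<le>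
          H (a + a) * cmod (f t) * cmod (f s)"
        proof (cases "t < a \<or> s < a")
          case False
          then have "\<bar>H (t + s)\<bar> * (cmod (f t) * cmod (f s)) \<le> H (a + a) * (cmod (f t) * cmod (f s))"
            using mono[of t s] by (intro mult_right_mono) auto
          then show ?thesis by (simp add: norm_mult mult_ac)
        qed (use t s in auto)
      qed
    qed
  qed
  moreover have "integrable (halfline \<Otimes>\<^sub>M halfline) (\<lambda>(t, s). complex_of_real (H (t + s)) * f s * cnj (f t)) \<longleftrightarrow>
      integrable (halfline \<Otimes>\<^sub>M halfline) (\<lambda>(t, s). complex_of_real (h (t + s)) * f s * cnj (f t))"
    by (rule Bochner_Integration.integrable_cong[OF refl])
       (auto simp: space_pair_measure space_restrict_space H_def h simp del: minus_add_distrib)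
  ultimately show ?thesis by simp
qed

lemma nonneg_form_hankel_form:
  assumes D: "linear_subspace D" "D \<subseteq> L2_compact_support"
  shows "nonneg_form D (hankel_form h)"
  by (rule nonneg_form_cong[OF nonneg_form_laplace_form_compact_support[OF D]])
     (use D(2) in \<open>auto intro!: hankel_form_eq_laplace_form\<close>)

lemma is_form_closure_hankel_form:
  assumes M0: "emeasure M {0} = 0"
    and D: "linear_subspace D" "C0_infinity \<subseteq> D" "D \<subseteq> L2_compact_support"
  shows "is_form_closure D (hankel_form h) (laplace_domain M) (laplace_form M)"
  unfolding is_form_closure_def
proof (intro conjI ballI)
  show "nonneg_form D (hankel_form h)" by (rule nonneg_form_hankel_form[OF D(1,3)])
  show "closed_form (laplace_domain M) (laplace_form M)" by (rule closed_form_laplace_form[OF M0])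
  show "D \<subseteq> laplace_domain M" using D(3) compact_support_laplace_domain by blast
  show "laplace_form M f g = hankel_form h f g" if "f \<in> D" "g \<in> D" for f g
    using that D(3) by (intro hankel_form_eq_laplace_form[symmetric]) auto
  fix f assume f: "f \<in> laplace_domain M"
  have "\<exists>u. u \<in> D \<and> energy (\<lambda>t. u t - f t) < inverse (real (Suc n))" for n
    using C0_infinity_core[OF M0 f, of "inverse (real (Suc n))"] D(2) by auto
  then obtain u where u: "\<And>n. u n \<in> D" "\<And>n. energy (\<lambda>t. u n t - f t) < inverse (real (Suc n))"
    by metis
  have "(\<lambda>n. energy (\<lambda>t. u n t - f t)) \<longlonglongrightarrow> 0"
  proof (rule tendsto_sandwich[OF _ _ tendsto_const LIMSEQ_inverse_real_of_nat])
    show "\<forall>\<^sub>F n in sequentially. 0 \<le> energy (\<lambda>t. u n t - f t)" by (simp add: energy_def)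
    show "\<forall>\<^sub>F n in sequentially. energy (\<lambda>t. u n t - f t) \<le> inverse (real (Suc n))"
      using u(2) by (intro always_eventually allI less_imp_le)
  qed
  then have "(\<lambda>n. form_norm (laplace_form M) (\<lambda>t. u n t - f t)) \<longlonglongrightarrow> 0"
    unfolding form_norm_laplace_form energy_def using tendsto_real_sqrt by fastforce
  with u(1) show "\<exists>u. (\<forall>n. u n \<in> D) \<and> (\<lambda>n. form_norm (laplace_form M) (\<lambda>t. u n t - f t)) \<longlonglongrightarrow> 0"
    by blast
qed

end

end

section \<open>An atom at zero destroys closability\<close>

text \<open>The dilates \<open>\<phi> (t / m) / m\<close>, \<open>m = n + 1\<close>, of a bump \<open>\<phi>\<close>: dilation keeps the integral, which is
  the Laplace transform at \<open>0\<close>, and lets the \<open>L\<^sup>2\<close> norm tend to \<open>0\<close>.\<close>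

definition spread_bump :: "nat \<Rightarrow> real \<Rightarrow> complex" where
  "spread_bump n t = complex_of_real (bump 1 2 1 (t / real (Suc n)) / real (Suc n))"

lemma spread_bump_outside: "t \<notin> {real (Suc n)<..<2 * real (Suc n)} \<Longrightarrow> spread_bump n t = 0"
  unfolding spread_bump_def by (subst bump_outside) (auto simp: field_simps)

lemma spread_bump_C0_infinity: "spread_bump n \<in> C0_infinity"
proof -
  have "smooth (\<lambda>t. complex_of_real (1 / real (Suc n)) * complex_of_real (bump 1 2 1 (1 / real (Suc n) * t + 0)))"
    by (intro smooth_cmult smooth_affine[where f="\<lambda>t. complex_of_real (bump 1 2 1 t)"] smooth_bump)
  then have "smooth (spread_bump n)" by (simp add: spread_bump_def[abs_def])
  moreover have "\<forall>t. t \<notin> {real (Suc n)..2 * real (Suc n)} \<longrightarrow> spread_bump n t = 0"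
    by (auto intro!: spread_bump_outside simp del: of_nat_Suc)
  ultimately show ?thesis
    unfolding C0_infinity_iff
    by (intro conjI exI[of _ "real (Suc n)"] exI[of _ "2 * real (Suc n)"]) auto
qed

lemma bump_integral:
  shows "integrable lborel (bump 1 2 1)" "integral\<^sup>L lborel (bump 1 2 1) > 0"
proof -
  have "continuous_on UNIV (\<lambda>t. Re (complex_of_real (bump 1 2 1 t)))"
    by (intro continuous_intros smooth_continuous smooth_bump)
  then have [measurable]: "bump 1 2 1 \<in> borel_measurable borel"
    by (intro borel_measurable_continuous_onI) simp
  show int: "integrable lborel (bump 1 2 1)"
    by (rule Bochner_Integration.integrable_bound[OF integrable_indicator_interval[of 1 1 2]])
       (use bump_bounds bump_outside[of 1 _ 1 2] in \<open>auto simp: indicator_def\<close>)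
  show "integral\<^sup>L lborel (bump 1 2 1) > 0"
  proof (rule ccontr)
    assume "\<not> ?thesis"
    moreover have "0 \<le> integral\<^sup>L lborel (bump 1 2 1)"
      by (intro Bochner_Integration.integral_nonneg bump_bounds)
    ultimately have "integral\<^sup>L lborel (bump 1 2 1) = 0" by linarith
    then have "AE t in lborel. bump 1 2 1 t = 0"
      using integral_nonneg_eq_0_iff_AE[OF int] bump_bounds(1) by auto
    then have "AE t in lborel. t \<notin> {1<..<2::real}"
      by eventually_elim (use bump_pos[of 1 1 _ 2] in force)
    moreover have "{t \<in> space lborel. \<not> t \<notin> {1<..<2::real}} = {1<..<2}" by auto
    from AE_iff_measurable[OF _ this]
    have "(AE t in lborel. t \<notin> {1<..<2::real}) \<longleftrightarrow> emeasure lborel {1<..<2::real} = 0"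
      by (simp only: sets_lborel open_greaterThanLessThan borel_open)
    ultimately have "emeasure lborel {1<..<2::real} = 0" by simp
    then show False by simp
  qed
qed

lemma sq_norm_spread_bump: "(\<lambda>n. sq_norm halfline (spread_bump n)) \<longlonglongrightarrow> 0"
proof -
  define B where "B = (LINT t|lborel. (bump 1 2 1 t)\<^sup>2)"
  have "sq_norm halfline (spread_bump n) = B * inverse (real (Suc n))" for n
  proof -
    have "\<forall>t\<le>0. spread_bump n t = 0" by (auto intro!: spread_bump_outside simp del: of_nat_Suc)
    then have "sq_norm halfline (spread_bump n) = sq_norm lborel (spread_bump n)" by (rule sq_integrable_halfline(2))
    also have "\<dots> = (LINT t|lborel. (inverse (real (Suc n)))\<^sup>2 * (bump 1 2 1 (0 + inverse (real (Suc n)) * t))\<^sup>2)"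
      unfolding sq_norm_def spread_bump_def norm_of_real
      by (intro Bochner_Integration.integral_cong refl)
         (simp add: divide_inverse power_mult_distrib abs_mult mult.commute del: of_nat_Suc)
    also have "\<dots> = (inverse (real (Suc n)))\<^sup>2 * (LINT t|lborel. (bump 1 2 1 (0 + inverse (real (Suc n)) * t))\<^sup>2)"
      by simp
    also have "(LINT t|lborel. (bump 1 2 1 (0 + inverse (real (Suc n)) * t))\<^sup>2) = real (Suc n) * B"
      using lborel_integral_real_affine[of "inverse (real (Suc n))" "\<lambda>t. (bump 1 2 1 t)\<^sup>2" 0]
      by (simp add: B_def field_simps del: of_nat_Suc)
    also have "(inverse (real (Suc n)))\<^sup>2 * (real (Suc n) * B) = B * inverse (real (Suc n))"
      by (simp add: power2_eq_square field_simps del: of_nat_Suc)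
    finally show ?thesis .
  qed
  then show ?thesis using tendsto_mult[OF tendsto_const[of B] LIMSEQ_inverse_real_of_nat] by simp
qed

lemma laplace_spread_bump:
  shows "laplace (spread_bump n) 0 = complex_of_real (integral\<^sup>L lborel (bump 1 2 1))"
    and "l \<ge> 0 \<Longrightarrow> cmod (laplace (spread_bump n) l) \<le> exp (- l * real (Suc n)) * integral\<^sup>L lborel (bump 1 2 1)"
proof -
  let ?I = "integral\<^sup>L lborel (bump 1 2 1)"
  have supp: "\<forall>t\<le>0. spread_bump n t = 0" by (auto intro!: spread_bump_outside simp del: of_nat_Suc)
  have scale: "bump 1 2 1 (t / real (Suc n)) / real (Suc n) = inverse (real (Suc n)) * bump 1 2 1 (0 + inverse (real (Suc n)) * t)" for t
    by (simp add: divide_inverse mult.commute)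
  have I: "(LINT t|lborel. bump 1 2 1 (t / real (Suc n)) / real (Suc n)) = ?I"
    unfolding scale
    using lborel_integral_real_affine[of "inverse (real (Suc n))" "bump 1 2 1" 0]
    by (simp del: of_nat_Suc)
  have int: "integrable lborel (\<lambda>t. bump 1 2 1 (t / real (Suc n)) / real (Suc n))"
    unfolding scale by (intro integrable_mult_right lborel_integrable_real_affine bump_integral) simp
  show "laplace (spread_bump n) 0 = complex_of_real ?I"
    unfolding laplace_lborel[OF supp] spread_bump_def using I by (simp del: of_nat_Suc of_real_divide)
  assume l: "l \<ge> 0"
  have le: "cmod (complex_of_real (exp (- t * l)) * spread_bump n t) \<le>
      exp (- l * real (Suc n)) * (bump 1 2 1 (t / real (Suc n)) / real (Suc n))" for t
  proof (cases "t \<in> {real (Suc n)<..<2 * real (Suc n)}")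
    case True
    then have "l * real (Suc n) \<le> l * t" using l by (intro mult_left_mono) auto
    then have "exp (- t * l) * (bump 1 2 1 (t / real (Suc n)) / real (Suc n)) \<le>
        exp (- l * real (Suc n)) * (bump 1 2 1 (t / real (Suc n)) / real (Suc n))"
      using bump_bounds(1)[of 1 2 1 "t / real (Suc n)"]
      by (intro mult_right_mono) (auto simp: mult.commute simp del: of_nat_Suc)
    moreover have "cmod (spread_bump n t) = bump 1 2 1 (t / real (Suc n)) / real (Suc n)"
      using bump_bounds(1)[of 1 2 1 "t / real (Suc n)"] unfolding spread_bump_def norm_of_real by simp
    ultimately show ?thesis unfolding norm_mult by simp
  next
    case False
    then show ?thesis using bump_bounds(1)[of 1 2 1 "t / real (Suc n)"]
      by (simp add: spread_bump_outside del: of_nat_Suc)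
  qed
  have "cmod (laplace (spread_bump n) l) \<le>
      (LINT t|lborel. exp (- l * real (Suc n)) * (bump 1 2 1 (t / real (Suc n)) / real (Suc n)))"
    unfolding laplace_lborel[OF supp]
  proof (rule order_trans[OF integral_norm_bound integral_mono'])
    show "integrable lborel (\<lambda>t. exp (- l * real (Suc n)) * (bump 1 2 1 (t / real (Suc n)) / real (Suc n)))"
      by (intro integrable_mult_right int)
    show "0 \<le> exp (- l * real (Suc n)) * (bump 1 2 1 (t / real (Suc n)) / real (Suc n))" for t
      by (intro mult_nonneg_nonneg divide_nonneg_nonneg bump_bounds) auto
  qed (rule le)
  also have "\<dots> = exp (- l * real (Suc n)) * ?I" unfolding integral_mult_right_zero I ..
  finally show "cmod (laplace (spread_bump n) l) \<le> exp (- l * real (Suc n)) * ?I" .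
qed

context laplace_weight
begin

text \<open>The dilated bumps \<open>u\<^sub>n\<close> tend to \<open>0\<close> in \<open>L\<^sup>2\<close>, and \<open>L u\<^sub>n\<close> tends in \<open>L\<^sup>2(M)\<close> to the function \<open>atom\<close>
supported at the origin. A closed extension forces \<open>L u\<^sub>n \<rightarrow> 0\<close> in \<open>L\<^sup>2(M)\<close>, so \<open>atom\<close> vanishes
almost everywhere, that is, \<open>M {0} = 0\<close>.\<close>

lemma not_admits_closure_hankel_form:
  assumes h: "\<And>t. t > 0 \<Longrightarrow> h t = (LINT l|M. exp (- t * l))"
    and D: "linear_subspace D" "C0_infinity \<subseteq> D" "D \<subseteq> L2_compact_support"
    and closure: "admits_closure D (hankel_form h)"
  shows "emeasure M {0} = 0"
proof -
  obtain D' a where cl: "is_form_closure D (hankel_form h) D' a"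
    using closure unfolding admits_closure_def by blast
  then have a: "nonneg_form D' a" and "D \<subseteq> D'" and ext: "\<forall>f\<in>D. \<forall>g\<in>D. a f g = hankel_form h f g"
    unfolding is_form_closure_def closed_form_def by blast+
  define I where "I = integral\<^sup>L lborel (bump 1 2 1)"
  have I: "I > 0" unfolding I_def by (rule bump_integral)
  define u where "u = spread_bump"
  have uD: "u n \<in> D" for n using spread_bump_C0_infinity[of n] D(2) by (auto simp: u_def)
  have uE: "u n \<in> L2_compact_support" for n using uD D(3) by blast
  have usq: "sq_integrable halfline (u n)" "sq_integrable M (laplace (u n))" for n
    using compact_support_laplace_domain[OF uE[of n]] by (auto simp: laplace_domain_iff)
  have form: "a f f = complex_of_real (sq_norm M (laplace f))" if "f \<in> D" for f
    using ext that hankel_form_eq_laplace_form[OF h, of f f] D(3) laplace_form_self by auto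
  \<comment> \<open>The limit of the transforms \<open>L u\<^sub>n\<close>: their common value \<open>I\<close> at the origin, \<open>0\<close> elsewhere.\<close>
  define atom where "atom = (\<lambda>l. complex_of_real I * indicator {0::real} l)"
  have atom: "sq_integrable M atom"
  proof (rule sq_integrable_bound(1))
    show "integrable M (\<lambda>l. I\<^sup>2 * exp (- 1 * l))" by (intro integrable_mult_right exp_integrable) simp
    show "atom \<in> borel_measurable M" unfolding atom_def by (intro borel_measurable_M) measurable
  qed (auto simp: atom_def indicator_def)
  define v where "v = (\<lambda>n l. laplace (u n) l - atom l)"
  have vsq: "sq_integrable M (v n)" for n unfolding v_def by (intro sq_integrable_diff usq atom)
  have v_lim: "(\<lambda>n. sq_norm M (v n)) \<longlonglongrightarrow> 0"
  proof (rule sq_norm_tendsto_0)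
    show "integrable M (\<lambda>l. I\<^sup>2 * exp (- 2 * l))" by (intro integrable_mult_right exp_integrable) simp
    have v0: "v n 0 = 0" for n
      by (simp add: v_def u_def atom_def laplace_spread_bump I_def)
    have vpos: "cmod (v n l) \<le> exp (- l * real (Suc n)) * I" if "l > 0" for n l
      using that laplace_spread_bump(2)[of l n] by (simp add: v_def u_def atom_def I_def)
    show "AE l in M. (\<lambda>n. v n l) \<longlonglongrightarrow> 0"
    proof (intro AE_I2)
      fix l assume "l \<in> space M"
      then consider "l = 0" | "l > 0" by (auto simp: space_M less_le)
      then show "(\<lambda>n. v n l) \<longlonglongrightarrow> 0"
      proof cases
        case 2
        have "filterlim (\<lambda>n. - l * real (Suc n)) at_bot sequentially"
          using 2 filterlim_compose[OF filterlim_real_sequentially filterlim_Suc]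
          by (intro filterlim_tendsto_neg_mult_at_bot[OF tendsto_const]) auto
        from tendsto_mult[OF filterlim_compose[OF exp_at_bot this] tendsto_const[of I]]
        have "(\<lambda>n. exp (- l * real (Suc n)) * I) \<longlonglongrightarrow> 0" by simp
        then show ?thesis
          by (rule Lim_null_comparison[OF always_eventually, rotated]) (use vpos[OF 2] in blast)
      qed (simp add: v0)
    qed
    show "AE l in M. (cmod (v n l))\<^sup>2 \<le> I\<^sup>2 * exp (- 2 * l)" for n
    proof (intro AE_I2)
      fix l assume "l \<in> space M"
      then consider "l = 0" | "l > 0" by (auto simp: space_M less_le)
      then show "(cmod (v n l))\<^sup>2 \<le> I\<^sup>2 * exp (- 2 * l)"
      proof cases
        case 2
        then have "l * 1 \<le> l * real (Suc n)" by (intro mult_left_mono) auto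
        then have "exp (- l * real (Suc n)) * I \<le> exp (- l) * I" using I by (intro mult_right_mono) auto
        with vpos[OF 2, of n] have "cmod (v n l) \<le> exp (- l) * I" by linarith
        then have "(cmod (v n l))\<^sup>2 \<le> (exp (- l) * I)\<^sup>2" by (intro power_mono) auto
        then show ?thesis by (simp add: power_mult_distrib mult.commute flip: exp_double)
      qed (simp add: v0)
    qed
  qed (use vsq in auto)
  have u_lim: "(\<lambda>n. sq_norm halfline (u n)) \<longlonglongrightarrow> 0" unfolding u_def by (rule sq_norm_spread_bump)
  have dist_le: "sq_norm M (laplace (\<lambda>t. u m t - u n t)) + sq_norm halfline (\<lambda>t. u m t - u n t) \<le>
      (2 * sq_norm M (v m) + 2 * sq_norm halfline (u m)) + (2 * sq_norm M (v n) + 2 * sq_norm halfline (u n))" for m n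
  proof -
    have "sq_norm M (laplace (\<lambda>t. u m t - u n t)) = sq_norm M (\<lambda>l. v m l - v n l)"
      unfolding sq_norm_def
    proof (intro Bochner_Integration.integral_cong refl)
      fix l assume l: "l \<in> space M"
      have "integrable halfline (\<lambda>t. complex_of_real (exp (- t * l)) * u k t)" for k
        using l laplace_compact_support[OF uE[of k]] by (metis atLeast_iff space_M)
      then have "laplace (\<lambda>t. u m t - u n t) l = laplace (u m) l - laplace (u n) l"
        unfolding laplace_def by (simp add: right_diff_distrib)
      then show "(cmod (laplace (\<lambda>t. u m t - u n t) l))\<^sup>2 = (cmod (v m l - v n l))\<^sup>2"
        by (simp add: v_def)
    qed
    then show ?thesis
      using sq_integrable_diff(2)[OF vsq[of m] vsq[of n]] sq_integrable_diff(2)[OF usq(1)[of m] usq(1)[of n]]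
      by simp
  qed
  have "\<exists>N. \<forall>m\<ge>N. \<forall>n\<ge>N. form_norm a (\<lambda>t. u m t - u n t) < e" if "e > 0" for e
  proof -
    have "(\<lambda>n. 2 * sq_norm M (v n) + 2 * sq_norm halfline (u n)) \<longlonglongrightarrow> 2 * 0 + 2 * 0"
      by (intro tendsto_intros v_lim u_lim)
    then have "\<forall>\<^sub>F n in sequentially. 2 * sq_norm M (v n) + 2 * sq_norm halfline (u n) < e\<^sup>2 / 2"
      using that by (intro order_tendstoD(2)) auto
    then obtain N where N: "\<And>n. n \<ge> N \<Longrightarrow> 2 * sq_norm M (v n) + 2 * sq_norm halfline (u n) < e\<^sup>2 / 2"
      by (auto simp: eventually_sequentially)
    have "form_norm a (\<lambda>t. u m t - u n t) < e" if mn: "m \<ge> N" "n \<ge> N" for m n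
    proof -
      have d: "(\<lambda>t. u m t - u n t) \<in> D" by (intro linear_subspace_diff[OF D(1)] uD)
      have "form_norm a (\<lambda>t. u m t - u n t) =
          sqrt (sq_norm M (laplace (\<lambda>t. u m t - u n t)) + sq_norm halfline (\<lambda>t. u m t - u n t))"
        by (simp add: form_norm_def form[OF d] sq_norm_def[of halfline])
      also have "\<dots> < sqrt (e\<^sup>2)"
        using dist_le[of m n] N[OF mn(1)] N[OF mn(2)] by (intro real_sqrt_less_mono) linarith
      finally show ?thesis using \<open>e > 0\<close> by simp
    qed
    then show ?thesis by blast
  qed
  note cauchy = this
  have uD': "u n \<in> D'" for n using uD \<open>D \<subseteq> D'\<close> by blast
  have "closed_form D' a" using cl unfolding is_form_closure_def by (elim conjE)
  then have "\<forall>w. (\<forall>n. w n \<in> D') \<and> (\<forall>e>0. \<exists>N. \<forall>m\<ge>N. \<forall>n\<ge>N. form_norm a (\<lambda>t. w m t - w n t) < e) \<longrightarrow>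
      (\<exists>f\<in>D'. (\<lambda>n. form_norm a (\<lambda>t. w n t - f t)) \<longlonglongrightarrow> 0)"
    unfolding closed_form_def by (elim conjE)
  from mp[OF spec[OF this, of u]] uD' cauchy
  obtain f where f: "f \<in> D'" "(\<lambda>n. form_norm a (\<lambda>t. u n t - f t)) \<longlonglongrightarrow> 0"
    by blast
  have fsq: "sq_integrable halfline f" using nonneg_formD(1)[OF a] f(1) L2_iff by auto
  note D' = nonneg_formD(2)[OF a]
  have dD': "(\<lambda>t. u n t - f t) \<in> D'" for n by (rule linear_subspace_diff[OF D' uD' f(1)])
  have nonneg: "0 \<le> Re (a (\<lambda>t. u n t - f t) (\<lambda>t. u n t - f t))" for n
    using nonneg_formD(6)[OF a] dD'[of n] by blast
  have sq_lim: "(\<lambda>n. Re (a (\<lambda>t. u n t - f t) (\<lambda>t. u n t - f t)) + sq_norm halfline (\<lambda>t. u n t - f t)) \<longlonglongrightarrow> 0"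
  proof -
    have "(\<lambda>n. (form_norm a (\<lambda>t. u n t - f t))\<^sup>2) \<longlonglongrightarrow> 0\<^sup>2" by (intro tendsto_power f(2))
    moreover have "(form_norm a (\<lambda>t. u n t - f t))\<^sup>2 =
        Re (a (\<lambda>t. u n t - f t) (\<lambda>t. u n t - f t)) + sq_norm halfline (\<lambda>t. u n t - f t)" for n
      using nonneg[of n] sq_norm_nonneg[of halfline "\<lambda>t. u n t - f t"]
      by (simp add: form_norm_def sq_norm_def[of halfline])
    ultimately show ?thesis by simp
  qed
  have d_lim: "(\<lambda>n. sq_norm halfline (\<lambda>t. u n t - f t)) \<longlonglongrightarrow> 0"
    by (rule tendsto_sandwich[OF _ _ tendsto_const sq_lim]) (use nonneg in auto)
  have a_lim: "(\<lambda>n. Re (a (\<lambda>t. u n t - f t) (\<lambda>t. u n t - f t))) \<longlonglongrightarrow> 0"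
    by (rule tendsto_sandwich[OF _ _ tendsto_const sq_lim]) (use nonneg in auto)
  \<comment> \<open>The limit of \<open>u\<^sub>n\<close> in the closed extension agrees with its limit \<open>0\<close> in \<open>L\<^sup>2\<close>.\<close>
  have "sq_norm halfline f = 0"
  proof -
    have "sq_norm halfline f \<le> 2 * sq_norm halfline (u n) + 2 * sq_norm halfline (\<lambda>t. u n t - f t)" for n
      using sq_integrable_diff(2)[OF usq(1) sq_integrable_diff(1)[OF usq(1) fsq], of n n] by simp
    moreover have "(\<lambda>n. 2 * sq_norm halfline (u n) + 2 * sq_norm halfline (\<lambda>t. u n t - f t)) \<longlonglongrightarrow> 2 * 0 + 2 * 0"
      by (intro tendsto_intros u_lim d_lim)
    ultimately have "sq_norm halfline f \<le> 2 * 0 + 2 * 0" by (intro LIMSEQ_le_const) auto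
    then show ?thesis using sq_norm_nonneg[of halfline f] by simp
  qed
  then have f0: "AE t in halfline. f t = 0" by (rule sq_norm_eq_0_imp_AE[OF fsq])
  have lu_lim: "(\<lambda>n. sq_norm M (laplace (u n))) \<longlonglongrightarrow> 0"
    using a_lim by (simp add: nonneg_form_diff_null[OF a f(1) f0 uD'] form[OF uD])
  have "sq_norm M atom = 0"
  proof -
    have "sq_norm M atom \<le> 2 * sq_norm M (laplace (u n)) + 2 * sq_norm M (v n)" for n
      using sq_integrable_diff(2)[OF usq(2) vsq, of n n] by (simp add: v_def)
    moreover have "(\<lambda>n. 2 * sq_norm M (laplace (u n)) + 2 * sq_norm M (v n)) \<longlonglongrightarrow> 2 * 0 + 2 * 0"
      by (intro tendsto_intros lu_lim v_lim)
    ultimately have "sq_norm M atom \<le> 2 * 0 + 2 * 0" by (intro LIMSEQ_le_const) auto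
    then show ?thesis using sq_norm_nonneg[of M atom] by simp
  qed
  then have "AE l in M. atom l = 0" by (rule sq_norm_eq_0_imp_AE[OF atom])
  then have "AE l in M. l \<notin> {0}" by eventually_elim (use I in \<open>auto simp: atom_def\<close>)
  moreover have "{l \<in> space M. \<not> l \<notin> {0}} = {0}" by (auto simp: space_M)
  ultimately show ?thesis
    using AE_iff_measurable[of "{0}" M "\<lambda>l. l \<notin> {0}"] sets_M_I[of "{0}"] by auto
qed

end

section \<open>Closability and closure of Hankel forms\<close>

theorem theorem3p10:
  fixes M :: "real measure" and h :: "real \<Rightarrow> real"
  assumes M_sets: "sets M = sets (restrict_space borel {0..})"
    and M_locally_finite: "\<And>K. compact K \<Longrightarrow> K \<subseteq> {0..} \<Longrightarrow> emeasure M K < \<infinity>"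
    and M_laplace: "\<And>t. t > 0 \<Longrightarrow> integrable M (\<lambda>l. exp (- t * l))"
    and h: "\<And>t. t > 0 \<Longrightarrow> h t = (LINT l|M. exp (- t * l))"
  shows "(\<forall>f \<in> L2_compact_support.
            integrable (halfline \<Otimes>\<^sub>M halfline)
              (\<lambda>(t, s). complex_of_real (h (t + s)) * f s * cnj (f t)) \<and>
            integrable M (\<lambda>l. (cmod (laplace f l))\<^sup>2) \<and>
            hankel_form h f f = complex_of_real (LINT l|M. (cmod (laplace f l))\<^sup>2))
       \<and> (\<forall>D \<in> {L2_compact_support, C0_infinity}.
            admits_closure D (hankel_form h) \<longleftrightarrow> emeasure M {0} = 0)
       \<and> (emeasure M {0} = 0 \<and> (\<exists>k::real. k > 0 \<and> integrable M (\<lambda>l. (1 + l) powr (- k))) \<longrightarrow>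
            closed_form (laplace_domain M) (laplace_form M) \<and>
            (\<forall>D \<in> {L2_compact_support, C0_infinity}.
               is_form_closure D (hankel_form h) (laplace_domain M) (laplace_form M)))"
proof -
  interpret laplace_weight M
    by (intro laplace_weight.intro M_sets M_locally_finite M_laplace)
  have D: "linear_subspace D" "C0_infinity \<subseteq> D" "D \<subseteq> L2_compact_support"
    if "D \<in> {L2_compact_support, C0_infinity}" for D
    using that linear_subspace_L2_compact_support linear_subspace_C0_infinity C0_infinity_subset by auto
  have closure: "is_form_closure D (hankel_form h) (laplace_domain M) (laplace_form M)"
    if "emeasure M {0} = 0" "D \<in> {L2_compact_support, C0_infinity}" for D
    by (rule is_form_closure_hankel_form[OF h that(1) D[OF that(2)]])
  show ?thesis
  proof (intro conjI ballI impI)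
    fix f assume f: "f \<in> L2_compact_support"
    show "integrable (halfline \<Otimes>\<^sub>M halfline)
        (\<lambda>(t, s). complex_of_real (h (t + s)) * f s * cnj (f t))"
      by (rule integrable_hankel_kernel[OF h f])
    show "integrable M (\<lambda>l. (cmod (laplace f l))\<^sup>2)"
      using compact_support_laplace_domain[OF f] by (simp add: laplace_domain_def)
    show "hankel_form h f f = complex_of_real (LINT l|M. (cmod (laplace f l))\<^sup>2)"
      using hankel_form_eq_laplace_form[OF h f f] by (simp add: laplace_form_self sq_norm_def)
  next
    fix D assume "D \<in> {L2_compact_support, C0_infinity}"
    note D' = this
    show "admits_closure D (hankel_form h) \<longleftrightarrow> emeasure M {0} = 0"
    proof
      show "emeasure M {0} = 0" if "admits_closure D (hankel_form h)"
        by (rule not_admits_closure_hankel_form[OF h D[OF D'] that])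
      show "admits_closure D (hankel_form h)" if "emeasure M {0} = 0"
        unfolding admits_closure_def using closure[OF that D'] by (intro exI)
    qed
  next
    assume "emeasure M {0} = 0 \<and> (\<exists>k::real. k > 0 \<and> integrable M (\<lambda>l. (1 + l) powr (- k)))"
    then show "closed_form (laplace_domain M) (laplace_form M)"
      by (intro closed_form_laplace_form) blast
  next
    fix D assume "emeasure M {0} = 0 \<and> (\<exists>k::real. k > 0 \<and> integrable M (\<lambda>l. (1 + l) powr (- k)))"
      "D \<in> {L2_compact_support, C0_infinity}"
    then show "is_form_closure D (hankel_form h) (laplace_domain M) (laplace_form M)"
      by (intro closure) blast+
  qed
qed

end
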